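(* Consider the dynamics on $\mathbb{R}^{2d}$ $$\mathrm{d}q_t=p_t\,\mathrm{d}t-\mu Jq_t\,\mathrm{d}t,\qquad \mathrm{d}p_t=-q_t\,\mathrm{d}t-\mu Jp_t\,\mathrm{d}t-\gamma p_t\,\mathrm{d}t+\sqrt{2\gamma}\,\mathrm{d}W_t,$$ with $\gamma>\sqrt2$, and an observable $f(q)=q\cdot Kq+l\cdot q+C$ with $K\in\mathbb{R}^{d\times d}$ symmetric, $l\in\mathbb{R}^d$, $C\in\mathbb{R}$. If at least one of the conditions $[J,K]\ne0$ and $l\notin\ker J$ is satisfied, then the asymptotic variance $\sigma_f^2=\sigma_f^2(\mu)$ is at a local maximum for the unperturbed dynamics $\mu=0$, in the sense that $$\partial_\mu\sigma_f^2\big|_{\mu=0}=0\qquad\text{and}\qquad\partial_\mu^2\sigma_f^2\big|_{\mu=0}<0 .$$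
   Context: $J\in\mathbb{R}^{d\times d}$ is a constant skew-symmetric matrix, $\mu\in\mathbb{R}$, $W$ is a standard $d$-dimensional Brownian motion, $[J,K]=JK-KJ$. The dynamics is ergodic with invariant measure $\widehat\pi=\mathcal{N}(0,I_{2d})$, whose $q$-marginal is $\pi=\mathcal{N}(0,I_d)$. Let $\mathcal{L}$ be the generator of its Markov semigroup on $L^2(\widehat\pi)$. For $f\in L^2(\pi)$, regarded as a function of $(q,p)$ depending on $q$ only, the asymptotic variance is $\sigma_f^2=\langle\chi,f-\pi(f)\rangle_{L^2(\widehat\pi)}$, where $\chi\in\mathcal{D}(\mathcal{L})$ is the unique solution of $-\mathcal{L}\chi=f-\pi(f)$, $\widehat\pi(\chi)=0$. *)

theory Defs
  imports "HOL-Probability.Probability"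
begin

text \<open>The isotropic Gaussian law with mean 0 and covariance \<open>\<sigma>\<^sup>2 I\<close>; \<open>\<sigma>\<close> is the
  standard deviation, as in \<^const>\<open>normal_density\<close>.\<close>

definition gaussian :: "real \<Rightarrow> 'a::euclidean_space measure" where
  "gaussian \<sigma> = density lborel (\<lambda>x. ennreal (\<Prod>b\<in>Basis. normal_density 0 \<sigma> (x \<bullet> b)))"

definition standard_brownian_motion ::
    "'w measure \<Rightarrow> (real \<Rightarrow> 'w \<Rightarrow> 'a::euclidean_space) \<Rightarrow> bool" where
  "standard_brownian_motion M W \<longleftrightarrow>
     prob_space M \<and>
     (\<forall>t\<ge>0. W t \<in> borel_measurable M) \<and>
     (AE \<omega> in M. W 0 \<omega> = 0) \<and>
     (AE \<omega> in M. continuous_on {0..} (\<lambda>t. W t \<omega>)) \<and>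
     (\<forall>s t. 0 \<le> s \<and> s < t \<longrightarrow>
        distr M borel (\<lambda>\<omega>. W t \<omega> - W s \<omega>) = gaussian (sqrt (t - s))) \<and>
     (\<forall>(n::nat) \<tau>. 0 \<le> \<tau> 0 \<and> (\<forall>i<n. \<tau> i < \<tau> (Suc i)) \<longrightarrow>
        prob_space.indep_vars M (\<lambda>_. borel) (\<lambda>i \<omega>. W (\<tau> (Suc i)) \<omega> - W (\<tau> i) \<omega>) {..<n})"

definition langevin_drift ::
    "real^'n^'n \<Rightarrow> real \<Rightarrow> real \<Rightarrow> (real^'n) \<times> (real^'n) \<Rightarrow> (real^'n) \<times> (real^'n)" where
  "langevin_drift J \<gamma> \<mu> = (\<lambda>(q, p). (p - \<mu> *\<^sub>R (J *v q), - q - \<mu> *\<^sub>R (J *v p) - \<gamma> *\<^sub>R p))"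

text \<open>The noise coefficient is constant, so the stochastic integral of \<open>sqrt (2 * \<gamma>)\<close> against
  \<open>W\<close> is \<open>sqrt (2 * \<gamma>) *\<^sub>R W t\<close> and the equation is a pathwise integral equation. The drift is
  Lipschitz, so its continuous solution is determined path by path by \<open>x\<close> and \<open>W\<close>; adaptedness
  is automatic (up to null sets) and is not required separately.\<close>

definition langevin_solution ::
    "'w measure \<Rightarrow> (real \<Rightarrow> 'w \<Rightarrow> real^'n) \<Rightarrow> real^'n^'n \<Rightarrow> real \<Rightarrow> real \<Rightarrow>
     (real^'n) \<times> (real^'n) \<Rightarrow> (real \<Rightarrow> 'w \<Rightarrow> (real^'n) \<times> (real^'n)) \<Rightarrow> bool" where
  "langevin_solution M W J \<gamma> \<mu> x X \<longleftrightarrow>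
     (\<forall>t\<ge>0. X t \<in> borel_measurable M) \<and>
     (AE \<omega> in M. continuous_on {0..} (\<lambda>t. X t \<omega>) \<and>
        (\<forall>t\<ge>0. X t \<omega> = x + integral {0..t} (\<lambda>s. langevin_drift J \<gamma> \<mu> (X s \<omega>))
                          + (0, sqrt (2 * \<gamma>) *\<^sub>R W t \<omega>)))"

text \<open>\<open>X x\<close> is the process started at the point \<open>x\<close>.\<close>

definition markov_semigroup ::
    "'w measure \<Rightarrow> ('s \<Rightarrow> real \<Rightarrow> 'w \<Rightarrow> 's) \<Rightarrow> real \<Rightarrow> ('s \<Rightarrow> real) \<Rightarrow> 's \<Rightarrow> real" where
  "markov_semigroup M X t g x = (\<integral>\<omega>. g (X x t \<omega>) \<partial>M)"

definition L2 :: "'s measure \<Rightarrow> ('s \<Rightarrow> real) set" where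
  "L2 N = {g \<in> borel_measurable N. integrable N (\<lambda>x. (g x)\<^sup>2)}"

text \<open>The graph of the generator of a semigroup \<open>P\<close> on \<open>L2 N\<close>: \<open>is_generator N P g h\<close> says that
  \<open>g\<close> lies in the domain and that its image is \<open>h\<close>, as classes modulo \<open>N\<close>-null sets. The
  difference quotient converges in the norm of \<open>L2 N\<close>.\<close>

definition is_generator ::
    "'s measure \<Rightarrow> (real \<Rightarrow> ('s \<Rightarrow> real) \<Rightarrow> 's \<Rightarrow> real) \<Rightarrow> ('s \<Rightarrow> real) \<Rightarrow> ('s \<Rightarrow> real) \<Rightarrow> bool" where
  "is_generator N P g h \<longleftrightarrow>
     g \<in> L2 N \<and> h \<in> L2 N \<and> (\<forall>t\<ge>0. P t g \<in> L2 N) \<and>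
     ((\<lambda>t. \<integral>x. ((P t g x - g x) / t - h x)\<^sup>2 \<partial>N) \<longlongrightarrow> 0) (at_right 0)"

definition centered :: "('a::euclidean_space \<Rightarrow> real) \<Rightarrow> 'a \<Rightarrow> real" where
  "centered f q = f q - (\<integral>y. f y \<partial>gaussian 1)"

definition poisson_solution ::
    "(real \<Rightarrow> ('a \<times> 'a \<Rightarrow> real) \<Rightarrow> 'a \<times> 'a \<Rightarrow> real) \<Rightarrow>
     ('a::euclidean_space \<Rightarrow> real) \<Rightarrow> ('a \<times> 'a \<Rightarrow> real) \<Rightarrow> bool" where
  "poisson_solution P f \<phi> \<longleftrightarrow>
     is_generator (gaussian 1) P \<phi> (\<lambda>z. - centered f (fst z)) \<and>
     (\<integral>z. \<phi> z \<partial>gaussian 1) = 0"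

text \<open>\<open>\<phi>\<close> is unique only up to null sets, so the description operator is applied to the inner
  product, which does not depend on the representative.\<close>

definition asymptotic_variance ::
    "(real \<Rightarrow> ('a \<times> 'a \<Rightarrow> real) \<Rightarrow> 'a \<times> 'a \<Rightarrow> real) \<Rightarrow> ('a::euclidean_space \<Rightarrow> real) \<Rightarrow> real" where
  "asymptotic_variance P f =
     (THE s. \<exists>\<phi>. poisson_solution P f \<phi> \<and> s = (\<integral>z. \<phi> z * centered f (fst z) \<partial>gaussian 1))"

end

(*  The rotation \<mu> J acts alike on positions and momenta, so the drift stays dissipative and N(0, I) stays
    invariant. The solution of the linear equation is Gaussian, hence the semigroup maps quadratic
    polynomials to quadratic polynomials and the Poisson equation for a quadratic observable becomes a
    linear fixed point equation u = u0 + \<mu> T u for the coefficients. Its Neumann series makes the variance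
    an explicit power series in \<mu>, whose coefficients of order 1 and 2 are 0 and
      - (\<gamma>^6 - \<gamma>^4 + \<gamma>^2 + 4) / (4 \<gamma>^3) |[J,K]|^2 - \<gamma> (\<gamma>^2 - 2) |J l|^2.
    The variance does not depend on the chosen solution of the Poisson equation: time reversal
    makes the semigroup for -\<mu>, conjugated by the momentum flip, the adjoint of the one for \<mu>, and
    pairing with an explicit solution for -\<mu> evaluates the inner product. *)

theory Submission
  imports Defs
begin

subsection \<open>Power series of a linear operator\<close>

text \<open>No stochastic calculus enters the law of the process. Pairing the integral equation with
  the backward flow exp((t - s) B) k of the adjoint drift B cancels the drift path by path and
  leaves a limit of linear combinations of independent increments of \<open>W\<close>. The squared
  norm lost along this flow is exactly the variance injected by the noise, so the process started at
  x has mean exp(t A) x and covariance I - exp(t A) exp(t B), for every \<mu>. The obstacle is the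
  description operator in the variance: every solution of the Poisson equation, not only the
  quadratic one, has to give the same number. Uniqueness of the solution is not proved for this; the
  duality between \<mu> and -\<mu> supplies the number. In the coefficient equation \<mu> multiplies
  only commutators with J and products with J. Both operations are skew for the Euclidean inner
  products, which makes the first-order term vanish and the second-order term minus a weighted sum
  of squares. The weight of |J l|^2 changes sign at \<gamma>^2 = 2, the origin of the
  threshold.\<close>

lemma norm_funpow_le:
  fixes T :: "'a::euclidean_space \<Rightarrow> 'a"
  assumes "linear T"
  shows "norm ((T ^^ n) x) \<le> onorm T ^ n * norm x"
proof (induction n)
  case (Suc n)
  have bl: "bounded_linear T" using assms by (simp add: linear_conv_bounded_linear)
  have "norm (T ((T ^^ n) x)) \<le> onorm T * norm ((T ^^ n) x)" using onorm[OF bl] .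
  also have "\<dots> \<le> onorm T * (onorm T ^ n * norm x)"
    using Suc onorm_pos_le[OF bl] by (intro mult_left_mono)
  finally show ?case by (simp add: mult.assoc)
qed simp

lemma linear_funpow:
  fixes T :: "'a::real_vector \<Rightarrow> 'a"
  shows "linear T \<Longrightarrow> linear (T ^^ n)"
  by (induction n) (auto simp: id_def[symmetric] linear_id intro: linear_compose)

text \<open>This is exp(t T) x, written as a series of vectors so that \<open>T\<close> may be any
  linear function on a Euclidean space, here one acting on pairs.\<close>

definition lin_exp :: "('a::euclidean_space \<Rightarrow> 'a) \<Rightarrow> real \<Rightarrow> 'a \<Rightarrow> 'a" where
  "lin_exp T t x = (\<Sum>n. (t ^ n / fact n) *\<^sub>R (T ^^ n) x)"

lemma summable_lin_exp:
  fixes T :: "'a::euclidean_space \<Rightarrow> 'a"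
  assumes "linear T"
  shows "summable (\<lambda>n. (t ^ n / fact n) *\<^sub>R (T ^^ n) x)"
proof (rule summable_comparison_test')
  show "summable (\<lambda>n. ((\<bar>t\<bar> * onorm T) ^ n /\<^sub>R fact n) * norm x)"
    by (intro summable_mult2 summable_exp_generic)
  fix n :: nat
  have "norm ((t ^ n / fact n) *\<^sub>R (T ^^ n) x) = \<bar>t\<bar> ^ n / fact n * norm ((T ^^ n) x)"
    by (simp add: power_abs)
  also have "\<dots> \<le> \<bar>t\<bar> ^ n / fact n * (onorm T ^ n * norm x)"
    by (intro mult_left_mono norm_funpow_le assms) auto
  finally show "norm ((t ^ n / fact n) *\<^sub>R (T ^^ n) x) \<le> ((\<bar>t\<bar> * onorm T) ^ n /\<^sub>R fact n) * norm x"
    by (simp add: power_mult_distrib field_simps)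
qed

text \<open>Tested against a fixed vector, the exponential becomes a scalar power series in
  \<open>t\<close>; both its adjoint and its derivative are read off from this form.\<close>

lemma inner_lin_exp:
  assumes "linear T"
  shows "(\<lambda>n. (t ^ n / fact n) * (k \<bullet> (T ^^ n) x)) sums (k \<bullet> lin_exp T t x)"
proof -
  have "(\<lambda>n. k \<bullet> ((t ^ n / fact n) *\<^sub>R (T ^^ n) x)) sums (k \<bullet> lin_exp T t x)"
    unfolding lin_exp_def
    by (rule bounded_linear.sums[OF bounded_linear_inner_right])
       (use summable_lin_exp[OF assms] in \<open>simp add: summable_sums\<close>)
  then show ?thesis by simp
qed

lemma lin_exp_adjoint:
  assumes "linear T" "linear T'" "\<And>x y. T x \<bullet> y = x \<bullet> T' y"
  shows "lin_exp T t x \<bullet> y = x \<bullet> lin_exp T' t y"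
proof -
  have *: "(T ^^ n) x \<bullet> y = x \<bullet> (T' ^^ n) y" for n x y
    by (induction n arbitrary: x y) (simp_all add: funpow_swap1 assms(3))
  have "(\<lambda>n. (t ^ n / fact n) * (y \<bullet> (T ^^ n) x)) sums (y \<bullet> lin_exp T t x)"
    by (rule inner_lin_exp) fact
  moreover have "(\<lambda>n. (t ^ n / fact n) * (x \<bullet> (T' ^^ n) y)) sums (x \<bullet> lin_exp T' t y)"
    by (rule inner_lin_exp) fact
  ultimately show ?thesis
    using sums_unique2 by (simp add: * inner_commute[of y])
qed

text \<open>A relation between \<open>R\<close> and the generators passes to every power and so to
  the series. It serves with \<open>R = T\<close>, where it says that \<open>T\<close> commutes with
  its own exponential, and with the momentum flip as \<open>R\<close>.\<close>

lemma lin_exp_intertwine: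
  assumes "linear T" "linear R" "\<And>x. R (T x) = T' (R x)"
  shows "R (lin_exp T t x) = lin_exp T' t (R x)"
proof -
  have bl: "bounded_linear R" using assms(2) by (simp add: linear_conv_bounded_linear)
  have *: "R ((T ^^ n) x) = (T' ^^ n) (R x)" for n by (induction n) (simp_all add: assms(3))
  have "R (lin_exp T t x) = (\<Sum>n. R ((t ^ n / fact n) *\<^sub>R (T ^^ n) x))"
    unfolding lin_exp_def by (intro bounded_linear.suminf[OF bl] summable_lin_exp assms)
  then show ?thesis by (simp add: lin_exp_def linear_cmul[OF assms(2)] *)
qed

lemma linear_lin_exp:
  assumes "linear T"
  shows "linear (lin_exp T t)"
proof (rule linearI)
  note lin = linear_funpow[OF assms]
  show "lin_exp T t (x + y) = lin_exp T t x + lin_exp T t y" for x y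
    unfolding lin_exp_def
    by (simp add: linear_add[OF lin] scaleR_add_right suminf_add[OF summable_lin_exp summable_lin_exp, OF assms assms])
  show "lin_exp T t (c *\<^sub>R x) = c *\<^sub>R lin_exp T t x" for c x
    unfolding lin_exp_def
    by (simp add: linear_cmul[OF lin] suminf_scaleR_right[OF summable_lin_exp, OF assms] mult.commute)
qed

lemma lin_exp_0 [simp]: "lin_exp T 0 x = x"
proof -
  have "(\<lambda>n. (0 ^ n / fact n) *\<^sub>R (T ^^ n) x) sums (\<Sum>n\<in>{0}. (0 ^ n / fact n) *\<^sub>R (T ^^ n) x)"
    by (rule sums_finite) auto
  then show ?thesis by (simp add: lin_exp_def sums_iff)
qed

lemma lin_exp_vector_derivative:
  assumes "linear T"
  shows "((\<lambda>t. lin_exp T t x) has_vector_derivative T (lin_exp T t x)) (at t within S)"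
proof -
  \<comment> \<open>Each coordinate is an everywhere convergent real power series. Differentiating
    cancels one factor of the factorial, and the shifted coefficients are those of the series
    started at \<open>T x\<close>.\<close>
  have comp: "((\<lambda>t. k \<bullet> lin_exp T t x) has_real_derivative k \<bullet> T (lin_exp T t x)) (at t)" for k
  proof -
    define c where "c n = (k \<bullet> (T ^^ n) x) / fact n" for n
    have c: "(\<lambda>n. c n * s ^ n) sums (k \<bullet> lin_exp T s x)" for s
      using inner_lin_exp[OF assms, of s k x] by (simp add: c_def mult.commute)
    have d: "(\<lambda>n. diffs c n * s ^ n) sums (k \<bullet> T (lin_exp T s x))" for s
    proof -
      have "diffs c n * s ^ n = (s ^ n / fact n) * (k \<bullet> (T ^^ n) (T x))" for n
        by (simp add: diffs_def c_def funpow_swap1 del: of_nat_Suc)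
      moreover have "T (lin_exp T s x) = lin_exp T s (T x)"
        by (rule lin_exp_intertwine) (auto intro: assms)
      ultimately show ?thesis using inner_lin_exp[OF assms, of s k "T x"] by simp
    qed
    have "DERIV (\<lambda>s. \<Sum>n. c n * s ^ n) t :> (\<Sum>n. diffs c n * t ^ n)"
      using c by (intro termdiffs_strong_converges_everywhere) (auto simp: sums_iff)
    then show ?thesis using c d by (simp add: sums_iff)
  qed
  show ?thesis
    unfolding has_vector_derivative_def
  proof (subst has_derivative_componentwise_within, intro ballI)
    fix b :: 'a
    have "((\<lambda>t. b \<bullet> lin_exp T t x) has_derivative (\<lambda>h. (b \<bullet> T (lin_exp T t x)) * h)) (at t within S)"
      using DERIV_subset[OF comp] by (auto simp: has_field_derivative_def)
    then show "((\<lambda>t. lin_exp T t x \<bullet> b) has_derivative (\<lambda>h. (h *\<^sub>R T (lin_exp T t x)) \<bullet> b)) (at t within S)"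
      by (simp add: inner_commute mult.commute)
  qed
qed

section \<open>Neumann series of a fixed point equation and its derivatives at 0\<close>

definition neumann :: "('a::euclidean_space \<Rightarrow> 'a) \<Rightarrow> 'a \<Rightarrow> real \<Rightarrow> 'a" where
  "neumann T u \<mu> = (\<Sum>n. \<mu> ^ n *\<^sub>R (T ^^ n) u)"

lemma summable_neumann:
  fixes T :: "'a::euclidean_space \<Rightarrow> 'a"
  assumes "linear T" "\<bar>\<mu>\<bar> * onorm T < 1"
  shows "summable (\<lambda>n. \<mu> ^ n *\<^sub>R (T ^^ n) u)"
proof (rule summable_comparison_test')
  have "0 \<le> onorm T" using assms(1) by (simp add: linear_conv_bounded_linear onorm_pos_le)
  then show "summable (\<lambda>n. (\<bar>\<mu>\<bar> * onorm T) ^ n * norm u)"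
    using assms by (intro summable_mult2 summable_geometric) (auto simp: abs_mult)
  fix n :: nat
  have "norm (\<mu> ^ n *\<^sub>R (T ^^ n) u) \<le> \<bar>\<mu>\<bar> ^ n * (onorm T ^ n * norm u)"
    using norm_funpow_le[OF assms(1), of n u] by (simp add: power_abs mult_left_mono)
  then show "norm (\<mu> ^ n *\<^sub>R (T ^^ n) u) \<le> (\<bar>\<mu>\<bar> * onorm T) ^ n * norm u"
    by (simp add: power_mult_distrib mult.assoc)
qed

lemma neumann_fixpoint:
  assumes "linear T" "\<bar>\<mu>\<bar> * onorm T < 1"
  shows "neumann T u \<mu> = u + \<mu> *\<^sub>R T (neumann T u \<mu>)"
proof -
  have bl: "bounded_linear T" using assms(1) by (simp add: linear_conv_bounded_linear)
  note sm = summable_neumann[OF assms, of u]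
  have "\<mu> *\<^sub>R T (neumann T u \<mu>) = (\<Sum>n. \<mu> *\<^sub>R T (\<mu> ^ n *\<^sub>R (T ^^ n) u))"
    unfolding neumann_def
    by (simp add: bounded_linear.suminf[OF bl sm]
        suminf_scaleR_right[OF bounded_linear.summable[OF bl sm]])
  also have "\<dots> = (\<Sum>n. \<mu> ^ Suc n *\<^sub>R (T ^^ Suc n) u)"
    by (simp add: linear_cmul[OF assms(1)])
  also have "\<dots> = neumann T u \<mu> - u"
    using suminf_split_head[OF sm] by (simp add: neumann_def)
  finally show ?thesis by simp
qed

text \<open>The difference of two fixed points would be strictly shorter than itself. Uniqueness is
  what later forces the matrix blocks of the solution to be symmetric.\<close>

lemma neumann_unique:
  fixes T :: "'a::euclidean_space \<Rightarrow> 'a"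
  assumes "linear T" "\<bar>\<mu>\<bar> * onorm T < 1" "v = u + \<mu> *\<^sub>R T v" "w = u + \<mu> *\<^sub>R T w"
  shows "v = w"
proof (rule ccontr)
  assume "v \<noteq> w"
  have bl: "bounded_linear T" using assms(1) by (simp add: linear_conv_bounded_linear)
  have "v - w = \<mu> *\<^sub>R T (v - w)"
    using assms(3,4) by (simp add: linear_diff[OF assms(1)] scaleR_diff_right) (metis add_diff_cancel_left)
  then have "norm (v - w) = \<bar>\<mu>\<bar> * norm (T (v - w))" by (metis norm_scaleR)
  also have "\<dots> \<le> \<bar>\<mu>\<bar> * (onorm T * norm (v - w))"
    using onorm[OF bl] by (intro mult_left_mono) auto
  also have "\<dots> < norm (v - w)"
    using assms(2) \<open>v \<noteq> w\<close> by (simp add: mult.assoc[symmetric])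
  finally show False by simp
qed

lemma inner_neumann:
  assumes "linear T" "\<bar>\<mu>\<bar> * onorm T < 1"
  shows "(\<lambda>n. (k \<bullet> (T ^^ n) u) * \<mu> ^ n) sums (k \<bullet> neumann T u \<mu>)"
proof -
  have "(\<lambda>n. k \<bullet> (\<mu> ^ n *\<^sub>R (T ^^ n) u)) sums (k \<bullet> neumann T u \<mu>)"
    unfolding neumann_def
    by (rule bounded_linear.sums[OF bounded_linear_inner_right])
       (use summable_neumann[OF assms] in \<open>simp add: summable_sums\<close>)
  then show ?thesis by (simp add: mult.commute)
qed

text \<open>A function that agrees with a power series near 0 may be differentiated twice term by
  term. The two differentiability claims accompany the values because \<open>deriv\<close> denotes
  some number even where no derivative exists.\<close>

lemma power_series_derivatives:
  fixes g :: "real \<Rightarrow> real"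
  assumes "0 < r" and g: "\<And>x. \<bar>x\<bar> < r \<Longrightarrow> (\<lambda>n. c n * x ^ n) sums g x"
  shows "\<forall>\<^sub>F x in nhds 0. g differentiable at x" "deriv g 0 = c 1"
    "deriv g differentiable at 0" "deriv (deriv g) 0 = 2 * c 2"
proof -
  have near: "\<forall>\<^sub>F x in nhds a. \<bar>x\<bar> < r" if "\<bar>a\<bar> < r" for a
    using that by (intro eventually_nhds_in_open[of "{x. \<bar>x\<bar> < r}", simplified])
      (auto intro!: open_Collect_less continuous_intros)
  have g': "(g has_real_derivative (\<Sum>n. diffs c n * x ^ n)) (at x)" if "\<bar>x\<bar> < r" for x
  proof -
    have "((\<lambda>x. \<Sum>n. c n * x ^ n) has_real_derivative (\<Sum>n. diffs c n * x ^ n)) (at x)"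
      using that g by (intro termdiffs_strong'[where K = r]) (auto simp: sums_iff)
    moreover have "\<forall>\<^sub>F x in nhds x. g x = (\<Sum>n. c n * x ^ n)"
      using near[OF that] by eventually_elim (use g in \<open>simp add: sums_iff\<close>)
    ultimately show ?thesis by (subst DERIV_cong_ev) auto
  qed
  have sm: "summable (\<lambda>n. diffs c n * x ^ n)" if "\<bar>x\<bar> < r" for x
    using that g by (intro termdiff_converges[where K = r]) (auto simp: sums_iff)
  have ev: "\<forall>\<^sub>F x in nhds 0. deriv g x = (\<Sum>n. diffs c n * x ^ n)"
    using near[of 0] \<open>0 < r\<close> by (auto elim!: eventually_mono intro!: DERIV_imp_deriv g')
  have "((\<lambda>x. \<Sum>n. diffs c n * x ^ n) has_real_derivative (\<Sum>n. diffs (diffs c) n * 0 ^ n)) (at 0)"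
    using sm \<open>0 < r\<close> by (intro termdiffs_strong'[where K = r]) auto
  then have g'': "(deriv g has_real_derivative (\<Sum>n. diffs (diffs c) n * 0 ^ n)) (at 0)"
    using ev by (subst DERIV_cong_ev) auto
  show "\<forall>\<^sub>F x in nhds 0. g differentiable at x"
    using near[of 0] \<open>0 < r\<close> by (auto elim!: eventually_mono simp: real_differentiable_def intro!: g')
  show "deriv g 0 = c 1" using DERIV_imp_deriv[OF g', of 0] \<open>0 < r\<close> by (simp add: diffs_def)
  show "deriv g differentiable at 0" using g'' by (auto simp: real_differentiable_def)
  show "deriv (deriv g) 0 = 2 * c 2"
    using DERIV_imp_deriv[OF g''] by (simp add: diffs_def numeral_2_eq_2)
qed

subsection \<open>Gaussian measures and characteristic functions\<close>

definition vchar :: "'a::euclidean_space measure \<Rightarrow> 'a \<Rightarrow> complex" where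
  "vchar M k = (CLINT x|M. iexp (k \<bullet> x))"

lemma space_gaussian [simp]: "space (gaussian \<sigma>) = UNIV"
  and sets_gaussian [simp, measurable_cong]: "sets (gaussian \<sigma>) = sets borel"
  by (simp_all add: gaussian_def)

lemma prob_space_gaussian:
  assumes "\<sigma> > 0"
  shows "prob_space (gaussian \<sigma> :: 'a::euclidean_space measure)"
proof
  have "(\<integral>\<^sup>+x. ennreal (normal_density 0 \<sigma> x) \<partial>lborel) = 1"
    using prob_space.emeasure_space_1[OF prob_space_normal_density[OF assms]]
    by (simp add: emeasure_density)
  moreover have "emeasure (gaussian \<sigma> :: 'a measure) UNIV
      = (\<integral>\<^sup>+x. (\<Prod>b\<in>Basis. ennreal (normal_density 0 \<sigma> (x \<bullet> b))) \<partial>(lborel :: 'a measure))"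
    by (simp add: gaussian_def emeasure_density prod_ennreal)
  ultimately show "emeasure (gaussian \<sigma> :: 'a measure) (space (gaussian \<sigma>)) = 1"
    by (subst (asm) nn_integral_lborel_prod) auto
qed

lemma integral_lborel_prod:
  fixes f :: "'a::euclidean_space \<Rightarrow> real \<Rightarrow> complex"
  assumes "\<And>b. b \<in> Basis \<Longrightarrow> integrable lborel (f b)"
  shows "(\<integral>x. (\<Prod>b\<in>Basis. f b (x \<bullet> b)) \<partial>lborel) = (\<Prod>b\<in>Basis. \<integral>x. f b x \<partial>lborel)"
proof -
  interpret product_sigma_finite "\<lambda>_::'a. lborel :: real measure" ..
  have meas: "f b \<in> borel_measurable borel" if "b \<in> Basis" for b
    using borel_measurable_integrable[OF assms[OF that]] by simp
  have "(\<integral>x. (\<Prod>b\<in>Basis. f b (x \<bullet> b)) \<partial>lborel)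
      = (\<integral>g. (\<Prod>b\<in>Basis. f b ((\<Sum>b\<in>Basis. g b *\<^sub>R b) \<bullet> b)) \<partial>(\<Pi>\<^sub>M b\<in>Basis. lborel))"
    unfolding lborel_def[where 'a='a] lborel_eq_real[symmetric]
    using meas by (subst integral_distr) (auto intro!: borel_measurable_prod)
  also have "\<dots> = (\<integral>g. (\<Prod>b\<in>Basis. f b (g b)) \<partial>(\<Pi>\<^sub>M b\<in>Basis. lborel))"
    by simp
  also have "\<dots> = (\<Prod>b\<in>Basis. \<integral>x. f b x \<partial>lborel)"
    by (rule product_integral_prod) (auto intro: assms)
  finally show ?thesis .
qed

lemma char_normal_density:
  assumes "\<sigma> > 0"
  shows "integrable lborel (\<lambda>x. normal_density 0 \<sigma> x *\<^sub>R iexp (s * x))"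
    and "(\<integral>x. normal_density 0 \<sigma> x *\<^sub>R iexp (s * x) \<partial>lborel) = exp (- (\<sigma>\<^sup>2 * s\<^sup>2 / 2))"
proof -
  show "integrable lborel (\<lambda>x. normal_density 0 \<sigma> x *\<^sub>R iexp (s * x))"
    by (rule Bochner_Integration.integrable_bound[OF integrable_normal_density[OF assms, of 0]]) auto
  have nd: "normal_density 0 \<sigma> (\<sigma> * x) = std_normal_density x / \<sigma>" for x
    using assms by (simp add: normal_density_def real_sqrt_mult power_mult_distrib)
  have "(\<integral>x. normal_density 0 \<sigma> x *\<^sub>R iexp (s * x) \<partial>lborel)
      = \<bar>\<sigma>\<bar> *\<^sub>R (\<integral>x. normal_density 0 \<sigma> (0 + \<sigma> * x) *\<^sub>R iexp (s * (0 + \<sigma> * x)) \<partial>lborel)"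
    using assms by (intro lborel_integral_real_affine) simp
  also have "\<dots> = \<sigma> *\<^sub>R (\<integral>x. (1 / \<sigma>) *\<^sub>R (std_normal_density x *\<^sub>R iexp ((s * \<sigma>) * x)) \<partial>lborel)"
    using assms by (simp add: nd mult.assoc)
  also have "\<dots> = (\<integral>x. std_normal_density x *\<^sub>R iexp ((s * \<sigma>) * x) \<partial>lborel)"
    using assms by (subst integral_scaleR_right) simp
  also have "\<dots> = char std_normal_distribution (s * \<sigma>)"
    unfolding char_def by (subst integral_density) (auto simp: normal_density_nonneg)
  also have "\<dots> = exp (- (\<sigma>\<^sup>2 * s\<^sup>2 / 2))"
    by (simp add: char_std_normal_distribution power_mult_distrib mult.commute)
  finally show "(\<integral>x. normal_density 0 \<sigma> x *\<^sub>R iexp (s * x) \<partial>lborel) = exp (- (\<sigma>\<^sup>2 * s\<^sup>2 / 2))" .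
qed

lemma vchar_gaussian:
  fixes k :: "'a::euclidean_space"
  assumes "\<sigma> > 0"
  shows "vchar (gaussian \<sigma>) k = exp (- (\<sigma>\<^sup>2 * (k \<bullet> k) / 2))"
proof -
  have "vchar (gaussian \<sigma>) k
      = (\<integral>x. (\<Prod>b\<in>Basis. normal_density 0 \<sigma> (x \<bullet> b)) *\<^sub>R iexp (k \<bullet> x) \<partial>lborel)"
    unfolding vchar_def gaussian_def
    by (subst integral_density) (auto intro!: AE_I2 prod_nonneg)
  also have "\<dots> = (\<integral>x. (\<Prod>b\<in>Basis. normal_density 0 \<sigma> (x \<bullet> b) *\<^sub>R iexp ((k \<bullet> b) * (x \<bullet> b))) \<partial>lborel)"
  proof (intro Bochner_Integration.integral_cong refl)
    fix x :: 'a
    have "iexp (k \<bullet> x) = (\<Prod>b\<in>Basis. iexp ((k \<bullet> b) * (x \<bullet> b)))"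
      by (subst euclidean_inner) (simp add: sum_distrib_left exp_sum)
    then show "(\<Prod>b\<in>Basis. normal_density 0 \<sigma> (x \<bullet> b)) *\<^sub>R iexp (k \<bullet> x)
        = (\<Prod>b\<in>Basis. normal_density 0 \<sigma> (x \<bullet> b) *\<^sub>R iexp ((k \<bullet> b) * (x \<bullet> b)))"
      by (simp add: scaleR_conv_of_real prod.distrib)
  qed
  also have "\<dots> = (\<Prod>b\<in>Basis. \<integral>x. normal_density 0 \<sigma> x *\<^sub>R iexp ((k \<bullet> b) * x) \<partial>lborel)"
    by (intro integral_lborel_prod char_normal_density assms)
  also have "\<dots> = (\<Prod>b\<in>Basis. complex_of_real (exp (- (\<sigma>\<^sup>2 * (k \<bullet> b)\<^sup>2 / 2))))"
    by (simp only: char_normal_density(2)[OF assms])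
  also have "\<dots> = exp (\<Sum>b\<in>Basis. - (\<sigma>\<^sup>2 * (k \<bullet> b)\<^sup>2 / 2))"
    by (simp add: exp_sum del: of_real_exp)
  also have "(\<Sum>b\<in>Basis. - (\<sigma>\<^sup>2 * (k \<bullet> b)\<^sup>2 / 2)) = - (\<sigma>\<^sup>2 * (k \<bullet> k) / 2)"
    by (subst euclidean_inner) (simp add: sum_negf sum_distrib_left sum_divide_distrib power2_eq_square)
  finally show ?thesis .
qed

lemma gaussian_density:
  assumes "\<sigma> > 0"
  obtains c where "c > 0"
    "gaussian \<sigma> = density lborel (\<lambda>x::'a::euclidean_space. ennreal (c * exp (- (x \<bullet> x) / (2 * \<sigma>\<^sup>2))))"
proof
  let ?c = "(1 / sqrt (2 * pi * \<sigma>\<^sup>2)) ^ DIM('a)"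
  show "?c > 0" using assms by simp
  have "(\<Prod>b\<in>Basis. normal_density 0 \<sigma> (x \<bullet> b)) = ?c * exp (- (x \<bullet> x) / (2 * \<sigma>\<^sup>2))" for x :: 'a
  proof -
    have "(\<Prod>b\<in>Basis. exp (- (x \<bullet> b)\<^sup>2 / (2 * \<sigma>\<^sup>2))) = exp (\<Sum>b\<in>Basis. - (x \<bullet> b)\<^sup>2 / (2 * \<sigma>\<^sup>2))"
      by (simp add: exp_sum)
    also have "(\<Sum>b\<in>Basis. - (x \<bullet> b)\<^sup>2 / (2 * \<sigma>\<^sup>2)) = - (x \<bullet> x) / (2 * \<sigma>\<^sup>2)"
      by (subst euclidean_inner[of x x]) (simp add: sum_divide_distrib sum_negf power2_eq_square)
    finally show ?thesis by (simp add: normal_density_def prod_dividef power_divide)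
  qed
  then show "gaussian \<sigma> = density lborel (\<lambda>x::'a. ennreal (?c * exp (- (x \<bullet> x) / (2 * \<sigma>\<^sup>2))))"
    by (simp add: gaussian_def)
qed

text \<open>Averaging \<open>iexp (k \<bullet> (x - y))\<close> over \<open>k\<close> with respect to \<open>gaussian s\<close> turns the
  characteristic function into the convolution with a Gaussian density.\<close>

lemma gaussian_smoothing:
  fixes M :: "'a::euclidean_space measure"
  assumes "prob_space M" and [measurable_cong]: "sets M = sets borel" and "s > 0"
  shows "(\<integral>x. exp (- (s\<^sup>2 * ((x - y) \<bullet> (x - y)) / 2)) \<partial>M)
    = (CLINT k|gaussian s. iexp (- (k \<bullet> y)) * vchar M k)"
proof -
  interpret M: prob_space M by fact
  interpret G: prob_space "gaussian s :: 'a measure" by (rule prob_space_gaussian) fact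
  interpret P: pair_prob_space M "gaussian s :: 'a measure" ..
  have "(CLINT x|M. complex_of_real (exp (- (s\<^sup>2 * ((x - y) \<bullet> (x - y)) / 2))))
      = (CLINT x|M. (CLINT k|gaussian s. iexp ((x - y) \<bullet> k)))"
    by (simp only: vchar_gaussian[OF \<open>s > 0\<close>, unfolded vchar_def])
  also have "\<dots> = (CLINT k|gaussian s. (CLINT x|M. iexp ((x - y) \<bullet> k)))"
    by (rule P.Fubini_integral[symmetric])
       (auto intro!: P.P.integrable_const_bound[of _ 1] simp: case_prod_beta')
  also have "\<dots> = (CLINT k|gaussian s. iexp (- (k \<bullet> y)) * vchar M k)"
    unfolding vchar_def integral_mult_right_zero[symmetric] exp_add[symmetric]
    by (simp add: inner_diff_left inner_commute algebra_simps)
  finally show ?thesis by (simp only: integral_complex_of_real)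
qed

lemma nn_integral_lborel_affine:
  fixes x :: "'a::euclidean_space"
  assumes "c \<noteq> 0" and [measurable]: "f \<in> borel_measurable borel"
  shows "(\<integral>\<^sup>+y. f y \<partial>lborel) = ennreal (\<bar>c\<bar> ^ DIM('a)) * (\<integral>\<^sup>+z. f (x + c *\<^sub>R z) \<partial>lborel)"
  by (subst lborel_affine[OF assms(1), of x])
     (simp add: nn_integral_density nn_integral_distr nn_integral_cmult)

text \<open>Substituting y = x + \<sigma> z shows that a shifted and scaled Gaussian has the
  Gaussian kernel centred at \<open>x\<close> as its density. The constant is quantified before
  \<open>x\<close> and \<open>h\<close>, so that it can be shared by the two measures compared
  next.\<close>

lemma nn_integral_gaussian_translate:
  assumes "\<sigma> > 0"
  shows "\<exists>c>0. \<forall>(x::'a::euclidean_space) h. h \<in> borel_measurable borel \<longrightarrow> (\<integral>\<^sup>+z. h (x + \<sigma> *\<^sub>R z) \<partial>gaussian 1)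
     = (\<integral>\<^sup>+y. ennreal (c * exp (- ((x - y) \<bullet> (x - y)) / (2 * \<sigma>\<^sup>2))) * h y \<partial>lborel)"
proof -
  obtain c where c: "c > 0"
    "gaussian 1 = density lborel (\<lambda>x::'a. ennreal (c * exp (- (x \<bullet> x) / (2 * 1\<^sup>2))))"
    using gaussian_density[of 1] by auto
  let ?s = "\<sigma> ^ DIM('a)"
  show ?thesis
  proof (intro exI[of _ "c / ?s"] conjI allI impI)
    show "c / ?s > 0" using c(1) assms by simp
    fix h :: "'a \<Rightarrow> ennreal" and x :: 'a
    assume [measurable]: "h \<in> borel_measurable borel"
    have e: "- ((x - (x + \<sigma> *\<^sub>R z)) \<bullet> (x - (x + \<sigma> *\<^sub>R z))) / (2 * \<sigma>\<^sup>2) = - (z \<bullet> z) / 2" for z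
      using assms by (simp add: power2_eq_square)
    have "(\<integral>\<^sup>+y. ennreal (c / ?s * exp (- ((x - y) \<bullet> (x - y)) / (2 * \<sigma>\<^sup>2))) * h y \<partial>lborel)
        = ennreal ?s * (\<integral>\<^sup>+z. ennreal (c / ?s * exp (- (z \<bullet> z) / 2)) * h (x + \<sigma> *\<^sub>R z) \<partial>lborel)"
      using assms by (subst nn_integral_lborel_affine[of \<sigma> _ x]) (simp_all only: e, auto)
    also have "\<dots> = (\<integral>\<^sup>+z. ennreal ?s * ennreal (c / ?s * exp (- (z \<bullet> z) / 2)) * h (x + \<sigma> *\<^sub>R z) \<partial>lborel)"
      by (subst nn_integral_cmult[symmetric]) (auto simp: mult.assoc)
    also have "\<dots> = (\<integral>\<^sup>+z. ennreal (c * exp (- (z \<bullet> z) / 2)) * h (x + \<sigma> *\<^sub>R z) \<partial>lborel)"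
      using assms by (simp add: ennreal_mult'[symmetric])
    also have "\<dots> = (\<integral>\<^sup>+z. h (x + \<sigma> *\<^sub>R z) \<partial>gaussian 1)"
      by (simp add: c(2) nn_integral_density)
    finally show "(\<integral>\<^sup>+z. h (x + \<sigma> *\<^sub>R z) \<partial>gaussian 1)
       = (\<integral>\<^sup>+y. ennreal (c / ?s * exp (- ((x - y) \<bullet> (x - y)) / (2 * \<sigma>\<^sup>2))) * h y \<partial>lborel)" by simp
  qed
qed

text \<open>Adding an independent Gaussian of size \<sigma> gives any law a density, namely the
  average of the Gaussian kernel over that law. By \<open>gaussian_smoothing\<close> with s =
  1/\<sigma> this density is computed from \<open>vchar\<close> alone, hence is common to both
  measures.\<close>

lemma vchar_smoothed_integral:
  fixes M1 M2 :: "'a::euclidean_space measure"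
  assumes "prob_space M1" and [measurable_cong]: "sets M1 = sets borel"
    and "prob_space M2" and [measurable_cong]: "sets M2 = sets borel"
    and "vchar M1 = vchar M2" "\<sigma> > 0" and [measurable]: "h \<in> borel_measurable borel"
  shows "(\<integral>\<^sup>+x. (\<integral>\<^sup>+z. h (x + \<sigma> *\<^sub>R z) \<partial>gaussian 1) \<partial>M1) = (\<integral>\<^sup>+x. (\<integral>\<^sup>+z. h (x + \<sigma> *\<^sub>R z) \<partial>gaussian 1) \<partial>M2)"
proof -
  obtain c where c: "c > 0" "\<forall>(x::'a) h. h \<in> borel_measurable borel \<longrightarrow> (\<integral>\<^sup>+z. h (x + \<sigma> *\<^sub>R z) \<partial>gaussian 1)
     = (\<integral>\<^sup>+y. ennreal (c * exp (- ((x - y) \<bullet> (x - y)) / (2 * \<sigma>\<^sup>2))) * h y \<partial>lborel)"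
    using nn_integral_gaussian_translate[OF \<open>\<sigma> > 0\<close>, where 'a = 'a] by (elim exE conjE)
  have *: "(\<integral>\<^sup>+x. (\<integral>\<^sup>+z. h (x + \<sigma> *\<^sub>R z) \<partial>gaussian 1) \<partial>M)
      = (\<integral>\<^sup>+y. ennreal c * ennreal (\<integral>x. exp (- ((x - y) \<bullet> (x - y)) / (2 * \<sigma>\<^sup>2)) \<partial>M) * h y \<partial>lborel)"
    if "prob_space M" and [measurable_cong]: "sets M = sets borel" for M :: "'a measure"
  proof -
    interpret M: prob_space M by fact
    interpret P: pair_sigma_finite lborel M ..
    have int: "integrable M (\<lambda>x. exp (- ((x - y) \<bullet> (x - y)) / (2 * \<sigma>\<^sup>2)))" for y
      by (rule M.integrable_const_bound[of _ 1]) (auto simp: divide_nonpos_nonneg)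
    have "(\<integral>\<^sup>+x. (\<integral>\<^sup>+z. h (x + \<sigma> *\<^sub>R z) \<partial>gaussian 1) \<partial>M)
      = (\<integral>\<^sup>+x. (\<integral>\<^sup>+y. ennreal (c * exp (- ((x - y) \<bullet> (x - y)) / (2 * \<sigma>\<^sup>2))) * h y \<partial>lborel) \<partial>M)"
      by (simp add: c(2)[rule_format])
    also have "\<dots> = (\<integral>\<^sup>+y. (\<integral>\<^sup>+x. ennreal (c * exp (- ((x - y) \<bullet> (x - y)) / (2 * \<sigma>\<^sup>2))) * h y \<partial>M) \<partial>lborel)"
      by (rule P.Fubini') simp
    also have "\<dots> = (\<integral>\<^sup>+y. ennreal c * ennreal (\<integral>x. exp (- ((x - y) \<bullet> (x - y)) / (2 * \<sigma>\<^sup>2)) \<partial>M) * h y \<partial>lborel)"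
      using c(1) by (intro nn_integral_cong)
        (simp add: nn_integral_multc ennreal_mult nn_integral_cmult nn_integral_eq_integral[OF int, simplified])
    finally show ?thesis .
  qed
  have sm: "complex_of_real (\<integral>x. exp (- ((x - y) \<bullet> (x - y)) / (2 * \<sigma>\<^sup>2)) \<partial>M)
      = (CLINT k|gaussian (1 / \<sigma>). iexp (- (k \<bullet> y)) * vchar M k)"
    if "prob_space M" "sets M = sets borel" for M :: "'a measure" and y
  proof -
    have "- ((1 / \<sigma>)\<^sup>2 * ((x - y) \<bullet> (x - y)) / 2) = - ((x - y) \<bullet> (x - y)) / (2 * \<sigma>\<^sup>2)" for x
      by (simp add: power_divide)
    then show ?thesis
      using gaussian_smoothing[OF that, of "1 / \<sigma>" y] \<open>\<sigma> > 0\<close> by (simp add: mult.commute)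
  qed
  have "(\<integral>x. exp (- ((x - y) \<bullet> (x - y)) / (2 * \<sigma>\<^sup>2)) \<partial>M1)
      = (\<integral>x. exp (- ((x - y) \<bullet> (x - y)) / (2 * \<sigma>\<^sup>2)) \<partial>M2)" for y
    by (rule of_real_eq_iff[where 'a = complex, THEN iffD1]) (simp only: sm assms(1-5))
  then show ?thesis by (simp only: *[OF assms(1,2)] *[OF assms(3,4)])
qed

text \<open>The smoothed laws agree, and the smoothing is removed by letting its size
  \<open>1 / Suc n\<close> tend to 0, which gives equal integrals of continuous functions bounded
  above by 1. Truncated multiples of the distance to the complement then increase to the indicator
  of an open set, and open sets generate the Borel sets.\<close>

theorem vchar_unique:
  fixes M1 M2 :: "'a::euclidean_space measure"
  assumes M1: "prob_space M1" and [measurable_cong]: "sets M1 = sets borel"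
    and M2: "prob_space M2" and [measurable_cong]: "sets M2 = sets borel"
    and eq: "\<And>k. vchar M1 k = vchar M2 k"
  shows "M1 = M2"
proof -
  have conv: "(\<lambda>n. \<integral>\<^sup>+x. (\<integral>\<^sup>+z. ennreal (h (x + (1 / Suc n) *\<^sub>R z)) \<partial>gaussian 1) \<partial>M) \<longlonglongrightarrow> (\<integral>\<^sup>+x. ennreal (h x) \<partial>M)"
    if "prob_space M" and [measurable_cong]: "sets M = sets borel"
      and h: "continuous_on UNIV h" "\<And>x. h x \<le> 1" for M :: "'a measure" and h :: "'a \<Rightarrow> real"
  proof -
    interpret M: prob_space M by fact
    interpret G: prob_space "gaussian 1 :: 'a measure" by (rule prob_space_gaussian) simp
    interpret P: pair_prob_space M "gaussian 1 :: 'a measure" ..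
    have [measurable]: "h \<in> borel_measurable borel" using h(1) by (rule borel_measurable_continuous_onI)
    have "(\<lambda>n. \<integral>\<^sup>+p. ennreal (h (fst p + (1 / Suc n) *\<^sub>R snd p)) \<partial>(M \<Otimes>\<^sub>M gaussian 1))
        \<longlonglongrightarrow> (\<integral>\<^sup>+p. ennreal (h (fst p)) \<partial>(M \<Otimes>\<^sub>M (gaussian 1 :: 'a measure)))"
    proof (rule nn_integral_dominated_convergence[where w = "\<lambda>_ :: 'a \<times> 'a. 1"])
      show "AE p in M \<Otimes>\<^sub>M gaussian 1. (\<lambda>n. ennreal (h (fst p + (1 / Suc n) *\<^sub>R snd p))) \<longlonglongrightarrow> ennreal (h (fst p))"
      proof (intro AE_I2 tendsto_ennrealI)
        fix p :: "'a \<times> 'a"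
        have "(\<lambda>n. 1 / real (Suc n)) \<longlonglongrightarrow> 0" by (rule LIMSEQ_Suc[OF lim_1_over_n])
        then have "(\<lambda>n. fst p + (1 / Suc n) *\<^sub>R snd p) \<longlonglongrightarrow> fst p + 0 *\<^sub>R snd p"
          by (intro tendsto_intros)
        then show "(\<lambda>n. h (fst p + (1 / Suc n) *\<^sub>R snd p)) \<longlonglongrightarrow> h (fst p)"
          using continuous_on_tendsto_compose[OF h(1)] by simp
      qed
      show "AE p in M \<Otimes>\<^sub>M gaussian 1. ennreal (h (fst p + (1 / Suc n) *\<^sub>R snd p)) \<le> 1" for n
        using h(2) by (auto simp: ennreal_le_1)
    qed (auto simp: P.emeasure_space_1)
    then show ?thesis
      by (simp add: G.nn_integral_fst[symmetric] G.emeasure_space_1[simplified])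
  qed
  have inth: "(\<integral>\<^sup>+x. ennreal (h x) \<partial>M1) = (\<integral>\<^sup>+x. ennreal (h x) \<partial>M2)"
    if h: "continuous_on UNIV h" "\<And>x. h x \<le> 1" for h :: "'a \<Rightarrow> real"
  proof (rule LIMSEQ_unique)
    have [measurable]: "h \<in> borel_measurable borel" using h(1) by (rule borel_measurable_continuous_onI)
    have "(\<integral>\<^sup>+x. (\<integral>\<^sup>+z. ennreal (h (x + (1 / Suc n) *\<^sub>R z)) \<partial>gaussian 1) \<partial>M1)
        = (\<integral>\<^sup>+x. (\<integral>\<^sup>+z. ennreal (h (x + (1 / Suc n) *\<^sub>R z)) \<partial>gaussian 1) \<partial>M2)" for n
      by (intro vchar_smoothed_integral assms ext) auto
    then show "(\<lambda>n. \<integral>\<^sup>+x. (\<integral>\<^sup>+z. ennreal (h (x + (1 / Suc n) *\<^sub>R z)) \<partial>gaussian 1) \<partial>M1) \<longlonglongrightarrow> (\<integral>\<^sup>+x. ennreal (h x) \<partial>M2)"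
      using conv[OF M2 assms(4) h] by simp
  qed (rule conv[OF M1 assms(2) h])
  have op: "emeasure M1 U = emeasure M2 U" if "open U" for U
  \<comment> \<open>The whole space is treated separately: its complement is empty and
    \<open>infdist\<close> to the empty set is 0, so the approximating functions below would all
    vanish.\<close>
  proof (cases "U = UNIV")
    case True
    then show ?thesis
      using prob_space.emeasure_space_1[OF M1] prob_space.emeasure_space_1[OF M2]
        sets_eq_imp_space_eq[OF assms(2)] sets_eq_imp_space_eq[OF assms(4)] by simp
  next
    case False
    then have ne: "- U \<noteq> {}" by auto
    define h where "h n x = min 1 (real n * infdist x (- U))" for n :: nat and x
    have lim: "(\<lambda>n. \<integral>\<^sup>+x. ennreal (h n x) \<partial>M) \<longlonglongrightarrow> emeasure M U"
      if "prob_space M" and [measurable_cong]: "sets M = sets borel" for M :: "'a measure"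
    proof -
      interpret M: prob_space M by fact
      have [measurable]: "h n \<in> borel_measurable borel" for n
        unfolding h_def by (intro borel_measurable_continuous_onI continuous_intros)
      have hle: "h n x \<le> 1" for n x by (simp add: h_def)
      have [measurable]: "U \<in> sets borel" using \<open>open U\<close> by simp
      have "(\<lambda>n. \<integral>\<^sup>+x. ennreal (h n x) \<partial>M) \<longlonglongrightarrow> (\<integral>\<^sup>+x. indicator U x \<partial>M)"
      proof (rule nn_integral_dominated_convergence[where w = "\<lambda>_ :: 'a. 1"])
        show "AE x in M. (\<lambda>n. ennreal (h n x)) \<longlonglongrightarrow> indicator U x"
        proof (intro AE_I2)
          fix x
          show "(\<lambda>n. ennreal (h n x)) \<longlonglongrightarrow> indicator U x"
          proof (cases "x \<in> U")
            case True
            have "infdist x (- U) > 0"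
              using in_closed_iff_infdist_zero[of "- U" x] True \<open>open U\<close> ne infdist_nonneg[of x "- U"]
              by (auto simp: closed_Compl less_le)
            then obtain m where m: "1 \<le> real m * infdist x (- U)"
              by (metis reals_Archimedean3 less_imp_le)
            have "\<forall>\<^sub>F n in sequentially. h n x = 1"
              using eventually_ge_at_top[of m]
            proof eventually_elim
              case (elim n)
              have "real m * infdist x (- U) \<le> real n * infdist x (- U)"
                using elim infdist_nonneg by (intro mult_right_mono) auto
              then show ?case using m by (simp add: h_def)
            qed
            then show ?thesis using True by (auto intro!: tendsto_eventually elim: eventually_mono)
          next
            case False
            then have "infdist x (- U) = 0" by simp
            then show ?thesis using False by (simp add: h_def)
          qed
        qed
      qed (auto simp: hle ennreal_le_1 M.emeasure_space_1)
      then show ?thesis by simp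
    qed
    have "(\<integral>\<^sup>+x. ennreal (h n x) \<partial>M1) = (\<integral>\<^sup>+x. ennreal (h n x) \<partial>M2)" for n
      unfolding h_def by (intro inth continuous_intros) auto
    then show ?thesis using lim[OF M1 assms(2)] lim[OF M2 assms(4)] by (simp add: LIMSEQ_unique)
  qed
  show ?thesis
  proof (rule measure_eqI_generator_eq[where E = "{U. open U}" and \<Omega> = UNIV and A = "\<lambda>_. UNIV"])
    show "sets M1 = sigma_sets UNIV {U. open U}" "sets M2 = sigma_sets UNIV {U. open U}"
      by (simp_all add: assms(2,4) borel_def)
    show "emeasure M1 UNIV \<noteq> \<infinity>"
      using prob_space.emeasure_space_1[OF M1] sets_eq_imp_space_eq[OF assms(2)] by simp
  qed (auto simp: Int_stable_def op)
qed

subsection \<open>Gaussian moments\<close>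

text \<open>The law is described as an affine image of the standard normal law instead of by a
  density, so that the degenerate case \<open>v = 0\<close> is covered; it occurs for the process at
  time 0.\<close>

lemma char_imp_normal:
  fixes Y :: "'w \<Rightarrow> real"
  assumes "prob_space M" and [measurable]: "Y \<in> borel_measurable M" and "v \<ge> 0"
    and char: "\<And>s. (CLINT \<omega>|M. iexp (s * Y \<omega>)) = iexp (s * m) * exp (- (s\<^sup>2 * v / 2))"
  shows "distr M borel Y = distr std_normal_distribution borel (\<lambda>z. m + sqrt v * z)"
proof (rule Levy_uniqueness)
  interpret prob_space M by fact
  interpret S: real_distribution std_normal_distribution by (rule real_dist_normal_dist)
  show "real_distribution (distr M borel Y)" by (rule real_distribution_distr) simp
  show "real_distribution (distr std_normal_distribution borel (\<lambda>z. m + sqrt v * z))"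
    by (rule S.real_distribution_distr) simp
  show "char (distr M borel Y) = char (distr std_normal_distribution borel (\<lambda>z. m + sqrt v * z))"
  proof
    fix s
    have "char (distr std_normal_distribution borel (\<lambda>z. m + sqrt v * z)) s
        = (CLINT z|std_normal_distribution. iexp (s * m) * iexp ((s * sqrt v) * z))"
      unfolding char_def by (subst integral_distr) (auto simp: exp_add[symmetric] algebra_simps)
    also have "\<dots> = iexp (s * m) * char std_normal_distribution (s * sqrt v)"
      unfolding char_def by (rule integral_mult_right_zero)
    also have "\<dots> = iexp (s * m) * exp (- (s\<^sup>2 * v / 2))"
      using \<open>v \<ge> 0\<close> by (simp add: char_std_normal_distribution power_mult_distrib)
    also have "\<dots> = char (distr M borel Y) s"
      unfolding char[symmetric] char_def by (subst integral_distr) auto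
    finally show "char (distr M borel Y) s = char (distr std_normal_distribution borel (\<lambda>z. m + sqrt v * z)) s" ..
  qed
qed

lemma std_normal_moments:
  shows "(\<integral>z. z \<partial>std_normal_distribution) = 0" "(\<integral>z. z\<^sup>2 \<partial>std_normal_distribution) = 1"
    "(\<integral>z. z ^ 4 \<partial>std_normal_distribution) = 3"
proof -
  show "(\<integral>z. z \<partial>std_normal_distribution) = 0"
    using integral_std_normal_distribution_moment_odd[of 1] by simp
  show "(\<integral>z. z\<^sup>2 \<partial>std_normal_distribution) = 1"
    using std_normal_distribution_even_moments[of 1] by simp
  show "(\<integral>z. z ^ 4 \<partial>std_normal_distribution) = 3"
    using std_normal_distribution_even_moments(1)[of 2] by (simp add: fact_numeral)
qed

lemma normal_moments:
  fixes Y :: "'w \<Rightarrow> real"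
  assumes "prob_space M" and [measurable]: "Y \<in> borel_measurable M" and "v \<ge> 0"
    and char: "\<And>s. (CLINT \<omega>|M. iexp (s * Y \<omega>)) = iexp (s * m) * exp (- (s\<^sup>2 * v / 2))"
  shows "integrable M (\<lambda>\<omega>. Y \<omega> ^ n)"
    and "(\<integral>\<omega>. Y \<omega> \<partial>M) = m" and "(\<integral>\<omega>. (Y \<omega>)\<^sup>2 \<partial>M) = m\<^sup>2 + v"
    and "m = 0 \<Longrightarrow> (\<integral>\<omega>. Y \<omega> ^ 4 \<partial>M) = 3 * v\<^sup>2"
proof -
  interpret S: real_distribution std_normal_distribution by (rule real_dist_normal_dist)
  note law = char_imp_normal[OF assms]
  have tr: "(\<integral>\<omega>. Y \<omega> ^ n \<partial>M) = (\<integral>z. (m + sqrt v * z) ^ n \<partial>std_normal_distribution)" for n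
    using arg_cong[OF law, of "\<lambda>D. \<integral>y. y ^ n \<partial>D"] by (simp add: integral_distr)
  have intz: "integrable std_normal_distribution (\<lambda>z. z ^ n)" for n
    by (rule integrable_std_normal_distribution_moment)
  have "integrable std_normal_distribution (\<lambda>z. (m + sqrt v * z) ^ n)"
    unfolding binomial_ring power_mult_distrib mult.assoc[symmetric]
    by (intro Bochner_Integration.integrable_sum integrable_mult_right intz)
  then have "integrable (distr std_normal_distribution borel (\<lambda>z. m + sqrt v * z)) (\<lambda>y. y ^ n)"
    by (subst integrable_distr_eq) auto
  then show "integrable M (\<lambda>\<omega>. Y \<omega> ^ n)"
    unfolding law[symmetric] by (subst (asm) integrable_distr_eq) auto
  have i1: "integrable std_normal_distribution (\<lambda>z. z)" and i2: "integrable std_normal_distribution (\<lambda>z. z\<^sup>2)"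
    using intz[of 1] intz[of 2] by simp_all
  show "(\<integral>\<omega>. Y \<omega> \<partial>M) = m"
    using tr[of 1] i1 by (simp add: std_normal_moments S.prob_space[simplified])
  have "(m + sqrt v * z)\<^sup>2 = m\<^sup>2 + (2 * m * sqrt v) * z + v * z\<^sup>2" for z
    using \<open>v \<ge> 0\<close> by (simp add: power2_sum power_mult_distrib)
  then show "(\<integral>\<omega>. (Y \<omega>)\<^sup>2 \<partial>M) = m\<^sup>2 + v"
    using tr[of 2] i1 i2 by (simp add: std_normal_moments S.prob_space[simplified])
  have "sqrt v ^ 4 = v\<^sup>2" using \<open>v \<ge> 0\<close> by (simp add: power4_eq_xxxx power2_eq_square)
  then show "(\<integral>\<omega>. Y \<omega> ^ 4 \<partial>M) = 3 * v\<^sup>2" if "m = 0"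
    using tr[of 4] that by (simp add: power_mult_distrib std_normal_moments)
qed

text \<open>The polarised second Hermite polynomial. Subtracting \<open>a \<bullet> b\<close> makes
  it centred under the standard Gaussian law and orthogonal to linear functions; moreover the
  semigroup maps \<open>herm a b\<close> to a polynomial of the same kind, acting on
  \<open>a\<close> and \<open>b\<close> separately.\<close>

definition herm :: "'a::real_inner \<Rightarrow> 'a \<Rightarrow> 'a \<Rightarrow> real" where
  "herm a b z = (a \<bullet> z) * (b \<bullet> z) - a \<bullet> b"

text \<open>The last hypothesis says that \<open>Y\<close> is Gaussian with mean \<open>Q x\<close> and covariance \<open>I - Q P\<close>,
  where \<open>Q\<close> is the transpose of \<open>P\<close>.\<close>

lemma ou_moments:
  fixes Y :: "'w \<Rightarrow> 'a::euclidean_space"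
  assumes "prob_space M" and [measurable]: "Y \<in> borel_measurable M"
    and P: "linear P" "\<And>k. P k \<bullet> P k \<le> k \<bullet> k"
    and char: "\<And>k. (CLINT \<omega>|M. iexp (k \<bullet> Y \<omega>)) = iexp (P k \<bullet> x) * exp (- ((k \<bullet> k - P k \<bullet> P k) / 2))"
  shows "integrable M (\<lambda>\<omega>. (a \<bullet> Y \<omega>) ^ n)" "integrable M (\<lambda>\<omega>. a \<bullet> Y \<omega>)"
    and "integrable M (\<lambda>\<omega>. herm a b (Y \<omega>))"
    and "(\<integral>\<omega>. a \<bullet> Y \<omega> \<partial>M) = P a \<bullet> x"
    and "(\<integral>\<omega>. herm a b (Y \<omega>) \<partial>M) = herm (P a) (P b) x"
    and "x = 0 \<Longrightarrow> (\<integral>\<omega>. (a \<bullet> Y \<omega>) ^ 4 \<partial>M) = 3 * (a \<bullet> a - P a \<bullet> P a)\<^sup>2"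
proof -
  interpret prob_space M by fact
  \<comment> \<open>Replacing the test vector by \<open>s *\<^sub>R a\<close> turns the
    characteristic function of the vector \<open>Y\<close> into that of the real variable
    \<open>a \<bullet> Y\<close>, which is therefore normal.\<close>
  have c: "(CLINT \<omega>|M. iexp (s * (a \<bullet> Y \<omega>)))
      = iexp (s * (P a \<bullet> x)) * exp (- (s\<^sup>2 * (a \<bullet> a - P a \<bullet> P a) / 2))" for s a
    using char[of "s *\<^sub>R a"] by (simp add: linear_cmul[OF P(1)] algebra_simps power2_eq_square)
  note mom = normal_moments[OF assms(1) _ _ c]
  show int: "integrable M (\<lambda>\<omega>. (a \<bullet> Y \<omega>) ^ n)" for a n by (rule mom) (use P(2) in auto)
  show "integrable M (\<lambda>\<omega>. a \<bullet> Y \<omega>)" using int[of a 1] by simp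
  show "(\<integral>\<omega>. a \<bullet> Y \<omega> \<partial>M) = P a \<bullet> x" by (rule mom) (use P(2) in auto)
  show "(\<integral>\<omega>. (a \<bullet> Y \<omega>) ^ 4 \<partial>M) = 3 * (a \<bullet> a - P a \<bullet> P a)\<^sup>2" if "x = 0"
    by (rule mom) (use P(2) that in auto)
  have sq: "(\<integral>\<omega>. (a \<bullet> Y \<omega>)\<^sup>2 \<partial>M) = (P a \<bullet> x)\<^sup>2 + (a \<bullet> a - P a \<bullet> P a)" for a
    by (rule mom) (use P(2) in auto)
  \<comment> \<open>Polarisation reduces the mixed moment to squares of one-dimensional projections.
    The resulting covariance \<open>a \<bullet> b - P a \<bullet> P b\<close> replaces the
    subtracted constant \<open>a \<bullet> b\<close> by \<open>P a \<bullet> P b\<close>, which is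
    why the result is again a \<open>herm\<close>.\<close>
  have pol: "(a \<bullet> y) * (b \<bullet> y) = (((a + b) \<bullet> y)\<^sup>2 - (a \<bullet> y)\<^sup>2 - (b \<bullet> y)\<^sup>2) / 2" for y
    by (simp add: inner_add_left power2_sum)
  show "integrable M (\<lambda>\<omega>. herm a b (Y \<omega>))"
    unfolding herm_def pol by (intro Bochner_Integration.integrable_diff integrable_divide int) auto
  have "(\<integral>\<omega>. herm a b (Y \<omega>) \<partial>M) = ((\<integral>\<omega>. ((a + b) \<bullet> Y \<omega>)\<^sup>2 \<partial>M) - (\<integral>\<omega>. (a \<bullet> Y \<omega>)\<^sup>2 \<partial>M)
      - (\<integral>\<omega>. (b \<bullet> Y \<omega>)\<^sup>2 \<partial>M)) / 2 - a \<bullet> b"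
    unfolding herm_def pol using int by (simp add: prob_space)
  also have "\<dots> = herm (P a) (P b) x"
    unfolding sq herm_def
    by (simp add: linear_add[OF P(1)] inner_add_left inner_add_right power2_sum inner_commute field_simps)
  finally show "(\<integral>\<omega>. herm a b (Y \<omega>) \<partial>M) = herm (P a) (P b) x" .
qed

text \<open>The standard Gaussian law is the case \<open>P = 0\<close> of the preceding computation:
  mean 0 and covariance I.\<close>

lemma gaussian_moments:
  fixes a b :: "'a::euclidean_space"
  shows "integrable (gaussian 1) (\<lambda>z. (a \<bullet> z) ^ n)"
    and "(\<integral>z. a \<bullet> z \<partial>gaussian 1) = 0" "(\<integral>z. herm a b z \<partial>gaussian 1) = 0"
    and "(\<integral>z. (a \<bullet> z) ^ 4 \<partial>gaussian 1) = 3 * (a \<bullet> a)\<^sup>2"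
proof -
  have *: "prob_space (gaussian 1 :: 'a measure)" "(\<lambda>z. z) \<in> borel_measurable (gaussian 1 :: 'a measure)"
    "linear (\<lambda>_::'a. 0::'a)" "\<And>k::'a. (0::'a) \<bullet> 0 \<le> k \<bullet> k"
    by (auto simp: prob_space_gaussian linear_iff)
  have c: "(CLINT z|gaussian 1. iexp (k \<bullet> z)) = iexp (0 \<bullet> (0::'a)) * exp (- ((k \<bullet> k - 0 \<bullet> (0::'a)) / 2))" for k :: 'a
    using vchar_gaussian[of 1 k] by (simp add: vchar_def)
  note mom = ou_moments[OF * c]
  show "integrable (gaussian 1) (\<lambda>z. (a \<bullet> z) ^ n)" by (rule mom)
  show "(\<integral>z. a \<bullet> z \<partial>gaussian 1) = 0" using mom(4) by simp
  show "(\<integral>z. herm a b z \<partial>gaussian 1) = 0" using mom(5) by (simp add: herm_def)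
  show "(\<integral>z. (a \<bullet> z) ^ 4 \<partial>gaussian 1) = 3 * (a \<bullet> a)\<^sup>2" using mom(6) by simp
qed

text \<open>A symmetric involution is orthogonal, so it preserves the norm of the argument of the
  characteristic function. It is applied to z \<mapsto> -z, which kills odd moments, and to the
  momentum flip.\<close>

lemma gaussian_involution:
  fixes R :: "'a::euclidean_space \<Rightarrow> 'a"
  assumes "linear R" and self: "\<And>x y. R x \<bullet> y = x \<bullet> R y" and inv: "\<And>x. R (R x) = x"
  shows "distr (gaussian 1) borel R = gaussian 1"
proof (rule vchar_unique)
  interpret prob_space "gaussian 1 :: 'a measure" by (rule prob_space_gaussian) simp
  have [measurable]: "R \<in> borel_measurable borel"
    using assms(1) by (intro borel_measurable_continuous_onI linear_continuous_on)
      (simp add: linear_conv_bounded_linear)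
  show "prob_space (distr (gaussian 1) borel R)" by (rule prob_space_distr) simp
  show "prob_space (gaussian 1 :: 'a measure)" by (rule prob_space_gaussian) simp
  fix k
  have "vchar (distr (gaussian 1) borel R) k = vchar (gaussian 1) (R k)"
    unfolding vchar_def by (subst integral_distr) (auto simp: self)
  also have "\<dots> = vchar (gaussian 1) k" by (simp add: vchar_gaussian self inv)
  finally show "vchar (distr (gaussian 1) borel R) k = vchar (gaussian 1) k" .
qed auto

lemma integral_gaussian_involution:
  fixes R :: "'a::euclidean_space \<Rightarrow> 'a" and f :: "'a \<Rightarrow> real"
  assumes "linear R" "\<And>x y. R x \<bullet> y = x \<bullet> R y" "\<And>x. R (R x) = x" "f \<in> borel_measurable borel"
  shows "(\<integral>z. f (R z) \<partial>gaussian 1) = (\<integral>z. f z \<partial>gaussian 1)"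
proof -
  have [measurable]: "R \<in> borel_measurable borel"
    using assms(1) by (intro borel_measurable_continuous_onI linear_continuous_on)
      (simp add: linear_conv_bounded_linear)
  have "(\<integral>z. f (R z) \<partial>gaussian 1) = (\<integral>z. f z \<partial>distr (gaussian 1) borel R)"
    using assms(4) by (subst integral_distr) auto
  then show ?thesis by (simp add: gaussian_involution assms)
qed

lemma integrable_gaussian_quartic:
  fixes f :: "'a::euclidean_space \<Rightarrow> real"
  assumes "f \<in> borel_measurable borel" "\<And>z. \<bar>f z\<bar> \<le> C * (1 + z \<bullet> z)\<^sup>2"
  shows "integrable (gaussian 1) f"
proof -
  interpret prob_space "gaussian 1 :: 'a measure" by (rule prob_space_gaussian) simp
  let ?g = "\<lambda>z::'a. \<bar>C\<bar> * (2 + 2 * (\<Sum>b\<in>Basis. \<Sum>c\<in>Basis. (b \<bullet> z) ^ 4 + (c \<bullet> z) ^ 4))"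
  show ?thesis
  proof (rule Bochner_Integration.integrable_bound)
    show "integrable (gaussian 1) ?g"
      by (intro integrable_mult_right Bochner_Integration.integrable_add
          Bochner_Integration.integrable_sum gaussian_moments) auto
    show "AE z in gaussian 1. norm (f z) \<le> norm (?g z)"
    proof (rule AE_I2)
      fix z :: 'a
      \<comment> \<open>The fourth power of the norm is expanded over pairs of coordinates, and each
        mixed term is dominated by fourth powers of single coordinates, which are known to be
        integrable.\<close>
      have "(z \<bullet> z)\<^sup>2 = (\<Sum>b\<in>Basis. \<Sum>c\<in>Basis. (b \<bullet> z)\<^sup>2 * (c \<bullet> z)\<^sup>2)"
        by (subst euclidean_inner) (simp add: power2_eq_square sum_product inner_commute)
      also have "\<dots> \<le> (\<Sum>b\<in>Basis. \<Sum>c\<in>Basis. (b \<bullet> z) ^ 4 + (c \<bullet> z) ^ 4)"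
      proof (intro sum_mono)
        fix b c :: 'a
        have "2 * ((b \<bullet> z)\<^sup>2 * (c \<bullet> z)\<^sup>2) \<le> ((b \<bullet> z)\<^sup>2)\<^sup>2 + ((c \<bullet> z)\<^sup>2)\<^sup>2"
          using sum_squares_bound[of "(b \<bullet> z)\<^sup>2" "(c \<bullet> z)\<^sup>2"] by simp
        moreover have "0 \<le> (b \<bullet> z)\<^sup>2 * (c \<bullet> z)\<^sup>2" by simp
        ultimately have "(b \<bullet> z)\<^sup>2 * (c \<bullet> z)\<^sup>2 \<le> ((b \<bullet> z)\<^sup>2)\<^sup>2 + ((c \<bullet> z)\<^sup>2)\<^sup>2" by linarith
        then show "(b \<bullet> z)\<^sup>2 * (c \<bullet> z)\<^sup>2 \<le> (b \<bullet> z) ^ 4 + (c \<bullet> z) ^ 4" by simp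
      qed
      finally have le: "(z \<bullet> z)\<^sup>2 \<le> (\<Sum>b\<in>Basis. \<Sum>c\<in>Basis. (b \<bullet> z) ^ 4 + (c \<bullet> z) ^ 4)" .
      have "(1 + z \<bullet> z)\<^sup>2 \<le> 2 + 2 * (z \<bullet> z)\<^sup>2"
        using sum_squares_bound[of 1 "z \<bullet> z"] by (simp add: power2_sum)
      with le have "(1 + z \<bullet> z)\<^sup>2 \<le> 2 + 2 * (\<Sum>b\<in>Basis. \<Sum>c\<in>Basis. (b \<bullet> z) ^ 4 + (c \<bullet> z) ^ 4)" by linarith
      then have "\<bar>C\<bar> * (1 + z \<bullet> z)\<^sup>2 \<le> ?g z" by (intro mult_left_mono) auto
      moreover have "\<bar>f z\<bar> \<le> \<bar>C\<bar> * (1 + z \<bullet> z)\<^sup>2"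
        using assms(2)[of z] by (meson abs_ge_self mult_right_mono order_trans zero_le_power2)
      ultimately show "norm (f z) \<le> norm (?g z)" by simp
    qed
  qed (use assms(1) in simp)
qed

lemma abs_inner_le_quadratic: "\<bar>a \<bullet> z\<bar> \<le> norm a * (1 + z \<bullet> z)" for z :: "'a::real_inner"
proof -
  have "norm z \<le> 1 + (norm z)\<^sup>2"
    using sum_squares_bound[of 1 "norm z"] norm_ge_zero[of z] unfolding power_one mult_1_right by linarith
  then have "norm a * norm z \<le> norm a * (1 + z \<bullet> z)"
    by (intro mult_left_mono) (auto simp: power2_norm_eq_inner)
  then show ?thesis using Cauchy_Schwarz_ineq2[of a z] by linarith
qed

lemma abs_herm_le: "\<bar>herm a b z\<bar> \<le> norm a * norm b * (1 + z \<bullet> z)" for z :: "'a::real_inner"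
proof -
  have "\<bar>(a \<bullet> z) * (b \<bullet> z)\<bar> \<le> (norm a * norm z) * (norm b * norm z)"
    unfolding abs_mult by (intro mult_mono Cauchy_Schwarz_ineq2) auto
  also have "\<dots> = norm a * norm b * (z \<bullet> z)"
    by (simp add: power2_norm_eq_inner[symmetric] power2_eq_square)
  finally show ?thesis
    using Cauchy_Schwarz_ineq2[of a b] unfolding herm_def by (simp add: distrib_left)
qed

lemma integrable_gaussian_quadratics:
  fixes f g :: "'a::euclidean_space \<Rightarrow> real"
  assumes [measurable]: "f \<in> borel_measurable borel" "g \<in> borel_measurable borel"
    and "\<And>z. \<bar>f z\<bar> \<le> C * (1 + z \<bullet> z)" "\<And>z. \<bar>g z\<bar> \<le> D * (1 + z \<bullet> z)"
  shows "integrable (gaussian 1) (\<lambda>z. f z * g z)"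
proof (rule integrable_gaussian_quartic)
  fix z
  have "\<bar>f z * g z\<bar> \<le> (C * (1 + z \<bullet> z)) * (D * (1 + z \<bullet> z))"
    unfolding abs_mult by (intro mult_mono assms) (use assms(3)[of z] in auto)
  then show "\<bar>f z * g z\<bar> \<le> (C * D) * (1 + z \<bullet> z)\<^sup>2" by (simp add: power2_eq_square mult_ac)
qed simp

lemma integrable_quadratic:
  fixes f :: "'a::euclidean_space \<Rightarrow> real"
  assumes [measurable]: "f \<in> borel_measurable borel" and "\<And>z. \<bar>f z\<bar> \<le> C * (1 + z \<bullet> z)"
  shows "integrable (gaussian 1) f"
  using integrable_gaussian_quadratics[of f "\<lambda>_. 1" C 1] assms by simp

text \<open>Wick's formula for four factors, obtained from the one-dimensional fourth moment alone
  by three polarisations: equal vectors, then two equal pairs, then one equal pair, then the general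
  case.\<close>

lemma gaussian_fourth_moment:
  fixes a b c d :: "'a::euclidean_space"
  shows "integrable (gaussian 1) (\<lambda>z. ((a \<bullet> z) * (b \<bullet> z)) * ((c \<bullet> z) * (d \<bullet> z)))" (is ?int)
    and "(\<integral>z. ((a \<bullet> z) * (b \<bullet> z)) * ((c \<bullet> z) * (d \<bullet> z)) \<partial>gaussian 1)
      = (a \<bullet> b) * (c \<bullet> d) + (a \<bullet> c) * (b \<bullet> d) + (a \<bullet> d) * (b \<bullet> c)"
proof -
  have bd: "\<bar>(a \<bullet> z) * (b \<bullet> z)\<bar> \<le> (norm a * norm b) * (1 + z \<bullet> z)" for a b z :: 'a
  proof -
    have "\<bar>(a \<bullet> z) * (b \<bullet> z)\<bar> \<le> (norm a * norm z) * (norm b * norm z)"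
      unfolding abs_mult by (intro mult_mono Cauchy_Schwarz_ineq2) auto
    also have "\<dots> = norm a * norm b * (z \<bullet> z)"
      by (simp add: power2_norm_eq_inner[symmetric] power2_eq_square)
    also have "\<dots> \<le> (norm a * norm b) * (1 + z \<bullet> z)" by (intro mult_left_mono) auto
    finally show ?thesis .
  qed
  have int: "integrable (gaussian 1) (\<lambda>z. ((a \<bullet> z) * (b \<bullet> z)) * ((c \<bullet> z) * (d \<bullet> z)))" for a b c d :: 'a
    by (rule integrable_gaussian_quadratics[OF _ _ bd bd]) auto
  then show ?int .
  define E where "E a b c d = (\<integral>z. ((a \<bullet> z) * (b \<bullet> z)) * ((c \<bullet> z) * (d \<bullet> z)) \<partial>gaussian 1)" for a b c d :: 'a
  have E4: "E a a a a = 3 * (a \<bullet> a)\<^sup>2" for a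
    unfolding E_def gaussian_moments(4)[symmetric] by (simp add: power4_eq_xxxx mult.assoc)
  have E22: "E a a b b = (a \<bullet> a) * (b \<bullet> b) + 2 * (a \<bullet> b)\<^sup>2" for a b
  proof -
    \<comment> \<open>This is (x + y)^4 + (x - y)^4 = 2 x^4 + 12 x^2 y^2 + 2 y^4 solved for the
      mixed term.\<close>
    have "((a \<bullet> z) * (a \<bullet> z)) * ((b \<bullet> z) * (b \<bullet> z)) =
      ((((a + b) \<bullet> z) * ((a + b) \<bullet> z)) * (((a + b) \<bullet> z) * ((a + b) \<bullet> z))
      + (((a - b) \<bullet> z) * ((a - b) \<bullet> z)) * (((a - b) \<bullet> z) * ((a - b) \<bullet> z))
      - 2 * (((a \<bullet> z) * (a \<bullet> z)) * ((a \<bullet> z) * (a \<bullet> z)))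
      - 2 * (((b \<bullet> z) * (b \<bullet> z)) * ((b \<bullet> z) * (b \<bullet> z)))) / 12" for z
      by (simp add: inner_add_left inner_diff_left algebra_simps)
    note e = this
    have "E a a b b = (E (a + b) (a + b) (a + b) (a + b) + E (a - b) (a - b) (a - b) (a - b)
        - 2 * E a a a a - 2 * E b b b b) / 12"
      unfolding E_def by (simp only: e) (simp add: int)
    then show ?thesis unfolding E4
      by (simp add: inner_add_left inner_diff_left inner_add_right inner_diff_right
          inner_commute power2_eq_square algebra_simps)
  qed
  have E112: "E a b c c = (a \<bullet> b) * (c \<bullet> c) + 2 * (a \<bullet> c) * (b \<bullet> c)" for a b c
  proof -
    have "((a \<bullet> z) * (b \<bullet> z)) * ((c \<bullet> z) * (c \<bullet> z)) =
      ((((a + b) \<bullet> z) * ((a + b) \<bullet> z)) * ((c \<bullet> z) * (c \<bullet> z))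
      - (((a - b) \<bullet> z) * ((a - b) \<bullet> z)) * ((c \<bullet> z) * (c \<bullet> z))) / 4" for z
      by (simp add: inner_add_left inner_diff_left algebra_simps)
    note e = this
    have "E a b c c = (E (a + b) (a + b) c c - E (a - b) (a - b) c c) / 4"
      unfolding E_def by (simp only: e) (simp add: int)
    then show ?thesis unfolding E22
      by (simp add: inner_add_left inner_diff_left inner_add_right inner_diff_right
          inner_commute power2_eq_square algebra_simps)
  qed
  have "((a \<bullet> z) * (b \<bullet> z)) * ((c \<bullet> z) * (d \<bullet> z)) =
      (((a \<bullet> z) * (b \<bullet> z)) * (((c + d) \<bullet> z) * ((c + d) \<bullet> z))
      - ((a \<bullet> z) * (b \<bullet> z)) * (((c - d) \<bullet> z) * ((c - d) \<bullet> z))) / 4" for z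
    by (simp add: inner_add_left inner_diff_left algebra_simps)
  note e = this
  have "E a b c d = (E a b (c + d) (c + d) - E a b (c - d) (c - d)) / 4"
    unfolding E_def by (simp only: e) (simp add: int)
  then have "E a b c d = (a \<bullet> b) * (c \<bullet> d) + (a \<bullet> c) * (b \<bullet> d) + (a \<bullet> d) * (b \<bullet> c)"
    unfolding E112 by (simp add: inner_add_left inner_diff_left inner_add_right
        inner_diff_right inner_commute algebra_simps)
  then show "(\<integral>z. ((a \<bullet> z) * (b \<bullet> z)) * ((c \<bullet> z) * (d \<bullet> z)) \<partial>gaussian 1)
      = (a \<bullet> b) * (c \<bullet> d) + (a \<bullet> c) * (b \<bullet> d) + (a \<bullet> d) * (b \<bullet> c)"
    by (simp only: E_def)
qed

lemma herm_measurable [measurable]: "herm a b \<in> borel_measurable borel"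
  for a :: "'a::euclidean_space"
  unfolding herm_def[abs_def] by measurable

lemma gaussian_herm_orthogonality:
  fixes a b c d :: "'a::euclidean_space"
  shows "(\<integral>z. herm a b z * herm c d z \<partial>gaussian 1) = (a \<bullet> c) * (b \<bullet> d) + (a \<bullet> d) * (b \<bullet> c)"
    and "(\<integral>z. herm a b z * (c \<bullet> z) \<partial>gaussian 1) = 0"
    and "(\<integral>z. (a \<bullet> z) * (b \<bullet> z) \<partial>gaussian 1) = a \<bullet> b"
proof -
  interpret prob_space "gaussian 1 :: 'a measure" by (rule prob_space_gaussian) simp
  have int: "integrable (gaussian 1) (\<lambda>z. herm a b z)" for a b :: 'a
    by (rule integrable_quadratic[OF _ abs_herm_le]) simp
  have int2: "integrable (gaussian 1) (\<lambda>z. (a \<bullet> z) * (b \<bullet> z))" for a b :: 'a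
    by (rule integrable_gaussian_quadratics[OF _ _ abs_inner_le_quadratic abs_inner_le_quadratic]) auto
  show two: "(\<integral>z. (a \<bullet> z) * (b \<bullet> z) \<partial>gaussian 1) = a \<bullet> b" for a b :: 'a
    using gaussian_moments(3)[of a b] int2[of a b] by (simp add: herm_def prob_space[simplified])
  have "herm a b z * herm c d z = ((a \<bullet> z) * (b \<bullet> z)) * ((c \<bullet> z) * (d \<bullet> z))
      - (a \<bullet> b) * ((c \<bullet> z) * (d \<bullet> z)) - (c \<bullet> d) * ((a \<bullet> z) * (b \<bullet> z)) + (a \<bullet> b) * (c \<bullet> d)" for z
    by (simp add: herm_def algebra_simps)
  then show "(\<integral>z. herm a b z * herm c d z \<partial>gaussian 1) = (a \<bullet> c) * (b \<bullet> d) + (a \<bullet> d) * (b \<bullet> c)"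
    using int2 by (simp add: gaussian_fourth_moment two prob_space[simplified])
  \<comment> \<open>The integrand is odd and the Gaussian law is invariant under reflection at the
    origin, so the integral equals its own negative.\<close>
  have "(\<integral>z. herm a b z * (c \<bullet> z) \<partial>gaussian 1) = (\<integral>z. herm a b (- z) * (c \<bullet> (- z)) \<partial>gaussian 1)"
    by (rule integral_gaussian_involution[symmetric]) (auto simp: linear_iff)
  then show "(\<integral>z. herm a b z * (c \<bullet> z) \<partial>gaussian 1) = 0" by (simp add: herm_def)
qed

text \<open>For linear \<open>S\<close> this is the quadratic form of \<open>S\<close> minus its
  trace, plus a linear form. Writing it as a sum of \<open>herm\<close> terms over the basis keeps
  the mean at zero and makes the action of the semigroup explicit.\<close>

definition quad :: "('a::euclidean_space \<Rightarrow> 'a) \<Rightarrow> 'a \<Rightarrow> 'a \<Rightarrow> real" where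
  "quad S c z = (\<Sum>b\<in>Basis. herm b (S b) z) + c \<bullet> z"

lemma quad_eq:
  assumes "linear S"
  shows "quad S c z = S z \<bullet> z - (\<Sum>b\<in>Basis. b \<bullet> S b) + c \<bullet> z"
proof -
  have "S z \<bullet> z = S (\<Sum>b\<in>Basis. (z \<bullet> b) *\<^sub>R b) \<bullet> z" by (simp add: euclidean_representation)
  also have "\<dots> = (\<Sum>b\<in>Basis. (b \<bullet> z) * (S b \<bullet> z))"
    by (simp add: linear_sum[OF assms] linear_cmul[OF assms] inner_sum_left inner_commute[of z])
  finally show ?thesis by (simp add: quad_def herm_def sum_subtractf)
qed

lemma quad_measurable [measurable]: "quad S c \<in> borel_measurable borel"
  unfolding quad_def[abs_def] by measurable

lemma abs_quad_le: "\<bar>quad S c z\<bar> \<le> ((\<Sum>b\<in>Basis. norm (S b)) + norm c) * (1 + z \<bullet> z)"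
proof -
  have "\<bar>\<Sum>b\<in>Basis. herm b (S b) z\<bar> \<le> (\<Sum>b\<in>Basis. norm b * norm (S b) * (1 + z \<bullet> z))"
    by (rule sum_abs[THEN order_trans]) (intro sum_mono abs_herm_le)
  also have "\<dots> = (\<Sum>b\<in>Basis. norm (S b)) * (1 + z \<bullet> z)" by (simp add: sum_distrib_right)
  finally show ?thesis
    using abs_inner_le_quadratic[of c z] by (simp add: quad_def distrib_right)
qed

lemma integral_quad: "(\<integral>z. quad S c z \<partial>gaussian 1) = 0"
proof -
  have "integrable (gaussian 1) (\<lambda>z. herm a b z)" for a b :: 'a
    by (rule integrable_quadratic[OF _ abs_herm_le]) simp
  moreover have "integrable (gaussian 1) (\<lambda>z. c \<bullet> z)"
    by (rule integrable_quadratic[OF _ abs_inner_le_quadratic]) simp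
  ultimately show ?thesis by (simp add: quad_def gaussian_moments)
qed

text \<open>Of the two Wick pairings, the direct one gives the Hilbert-Schmidt product of
  \<open>S\<close> and \<open>K\<close>, the crossed one that of \<open>S\<close> and the adjoint of
  \<open>K\<close>. Symmetry of \<open>K\<close> makes them equal, whence the factor 2. Products of
  a \<open>herm\<close> and a linear function contribute nothing.\<close>

lemma integral_quad_mult_quad:
  assumes "linear S" "linear K" "\<And>x y. K x \<bullet> y = x \<bullet> K y"
  shows "(\<integral>z. quad S c z * quad K l z \<partial>gaussian 1) = 2 * (\<Sum>b\<in>Basis. S b \<bullet> K b) + c \<bullet> l"
proof -
  have h2: "integrable (gaussian 1) (\<lambda>z. herm a b z * herm a' b' z)" for a b a' b' :: 'a
    by (rule integrable_gaussian_quadratics[OF _ _ abs_herm_le abs_herm_le]) auto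
  have h1: "integrable (gaussian 1) (\<lambda>z. herm a b z * (a' \<bullet> z))" for a b a' :: 'a
    by (rule integrable_gaussian_quadratics[OF _ _ abs_herm_le abs_inner_le_quadratic]) auto
  have h0: "integrable (gaussian 1) (\<lambda>z. (a \<bullet> z) * (a' \<bullet> z))" for a a' :: 'a
    by (rule integrable_gaussian_quadratics[OF _ _ abs_inner_le_quadratic abs_inner_le_quadratic]) auto
  have "quad S c z * quad K l z = (\<Sum>b\<in>Basis. \<Sum>b'\<in>Basis. herm b (S b) z * herm b' (K b') z)
      + (\<Sum>b\<in>Basis. herm b (S b) z * (l \<bullet> z)) + (\<Sum>b\<in>Basis. herm b (K b) z * (c \<bullet> z))
      + (c \<bullet> z) * (l \<bullet> z)" for z
    by (simp add: quad_def distrib_left distrib_right sum_product sum_distrib_left sum_distrib_right mult.commute)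
  then have "(\<integral>z. quad S c z * quad K l z \<partial>gaussian 1)
      = (\<Sum>b\<in>Basis. \<Sum>b'\<in>Basis. (b \<bullet> b') * (S b \<bullet> K b') + (b \<bullet> K b') * (S b \<bullet> b')) + c \<bullet> l"
    using h2 h1 h0 by (simp add: gaussian_herm_orthogonality integrable_sum)
  also have "(\<Sum>b'\<in>Basis. (b \<bullet> b') * (S b \<bullet> K b') + (b \<bullet> K b') * (S b \<bullet> b')) = 2 * (S b \<bullet> K b)"
    if "b \<in> Basis" for b
  proof -
    have "(\<Sum>b'\<in>Basis. (b \<bullet> b') * (S b \<bullet> K b')) = (\<Sum>b'\<in>Basis. if b' = b then S b \<bullet> K b else 0)"
      using that by (intro sum.cong) (auto simp: inner_Basis)
    also have "\<dots> = S b \<bullet> K b" using that by simp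
    moreover have "(\<Sum>b'\<in>Basis. (b \<bullet> K b') * (S b \<bullet> b')) = S b \<bullet> K b"
      by (subst (2) euclidean_inner) (simp add: assms(3)[symmetric] mult.commute)
    ultimately show ?thesis by (simp add: sum.distrib)
  qed
  then show ?thesis by (simp add: sum_distrib_left calculation)
qed

subsection \<open>Law of the Langevin process\<close>

text \<open>Each summand is compared with the increment of \<open>V\<close> by the mean value inequality, so no
  integral is needed.\<close>

lemma stieltjes_sum_tendsto:
  fixes U U' w :: "real \<Rightarrow> 'a::real_inner" and V :: "real \<Rightarrow> real"
  assumes "t > 0"
    and U: "\<And>s. s \<in> {0..t} \<Longrightarrow> (U has_vector_derivative U' s) (at s within {0..t})"
    and V: "\<And>s. s \<in> {0..t} \<Longrightarrow> (V has_real_derivative U' s \<bullet> w s) (at s within {0..t})"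
    and B: "\<And>s. s \<in> {0..t} \<Longrightarrow> norm (U' s) \<le> B"
    and w: "continuous_on {0..t} w"
    and \<theta>: "\<And>n i. i < n \<Longrightarrow> \<theta> n i \<in> {real i * t / n..real (Suc i) * t / n}"
  shows "(\<lambda>n. \<Sum>i<n. (U (real (Suc i) * t / n) - U (real i * t / n)) \<bullet> w (\<theta> n i)) \<longlonglongrightarrow> V t - V 0"
proof (rule LIMSEQ_I)
  fix e :: real
  assume "e > 0"
  have B0: "B \<ge> 0" using B[of 0] \<open>t > 0\<close> by (auto intro: order_trans[OF norm_ge_zero])
  \<comment> \<open>The accumulated error over \<open>{0..t}\<close> will be at most
    \<open>B * e' * t\<close>, and this choice keeps it below \<open>e / 2\<close>;
    \<open>B + 1\<close> avoids dividing by zero.\<close>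
  define e' where "e' = e / (2 * (B + 1) * t)"
  have "e' > 0" using \<open>e > 0\<close> \<open>t > 0\<close> B0 by (simp add: e'_def)
  have "uniformly_continuous_on {0..t} w" by (rule compact_uniformly_continuous[OF w]) simp
  then obtain d where "d > 0" and d: "\<And>r s. r \<in> {0..t} \<Longrightarrow> s \<in> {0..t} \<Longrightarrow> dist s r < d \<Longrightarrow> dist (w s) (w r) < e'"
    using \<open>e' > 0\<close> unfolding uniformly_continuous_on_def by metis
  obtain N where N: "t / d < real N" using reals_Archimedean2 by blast
  show "\<exists>N. \<forall>n\<ge>N. norm ((\<Sum>i<n. (U (real (Suc i) * t / n) - U (real i * t / n)) \<bullet> w (\<theta> n i)) - (V t - V 0)) < e"
  proof (intro exI allI impI)
    fix n
    assume "n \<ge> N"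
    have "0 < t / d" using \<open>t > 0\<close> \<open>d > 0\<close> by simp
    have "t / d < n" using N \<open>n \<ge> N\<close> by (rule_tac less_le_trans) auto
    with \<open>0 < t / d\<close> have "0 < n" by (auto intro: gr0I)
    then have tn: "t / n < d" using \<open>t / d < n\<close> \<open>d > 0\<close> by (simp add: field_simps)
    have step: "\<bar>(V (real (Suc i) * t / n) - V (real i * t / n))
        - (U (real (Suc i) * t / n) - U (real i * t / n)) \<bullet> w (\<theta> n i)\<bar> \<le> B * e' * (t / n)"
      if "i < n" for i
    proof -
      define a b where "a = real i * t / n" and "b = real (Suc i) * t / n"
      have ab: "b - a = t / n" "a \<le> b" "0 \<le> a"
        using \<open>t > 0\<close> \<open>0 < n\<close> by (auto simp: a_def b_def field_simps)
      have "real (Suc i) * t \<le> real n * t" using that \<open>t > 0\<close> by (intro mult_right_mono) auto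
      then have "b \<le> t" using \<open>0 < n\<close> by (simp add: b_def field_simps)
      have sub: "{a..b} \<subseteq> {0..t}" using ab \<open>b \<le> t\<close> by auto
      have th: "\<theta> n i \<in> {a..b}" using \<theta>[OF that] by (simp add: a_def b_def)
      have "norm ((V b - U b \<bullet> w (\<theta> n i)) - (V a - U a \<bullet> w (\<theta> n i))) \<le> (B * e') * norm (b - a)"
      proof (rule field_differentiable_bound[where S = "{a..b}" and f = "\<lambda>s. V s - U s \<bullet> w (\<theta> n i)"
            and f' = "\<lambda>s. U' s \<bullet> w s - U' s \<bullet> w (\<theta> n i)"])
        fix s assume s: "s \<in> {a..b}"
        then have s0: "s \<in> {0..t}" using sub by auto
        have "((\<lambda>s. U s \<bullet> w (\<theta> n i)) has_vector_derivative U' s \<bullet> w (\<theta> n i)) (at s within {0..t})"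
          by (rule bounded_linear.has_vector_derivative[OF bounded_linear_inner_left U[OF s0]])
        then have "((\<lambda>s. V s - U s \<bullet> w (\<theta> n i)) has_real_derivative U' s \<bullet> w s - U' s \<bullet> w (\<theta> n i)) (at s within {0..t})"
          by (intro DERIV_diff V s0) (simp add: has_real_derivative_iff_has_vector_derivative)
        then show "((\<lambda>s. V s - U s \<bullet> w (\<theta> n i)) has_real_derivative U' s \<bullet> w s - U' s \<bullet> w (\<theta> n i)) (at s within {a..b})"
          by (rule DERIV_subset) fact
        have "dist s (\<theta> n i) < d" using s th tn ab(1) by (auto simp: dist_real_def)
        then have "dist (w s) (w (\<theta> n i)) < e'" using d s0 th sub by blast
        then have "norm (w s - w (\<theta> n i)) \<le> e'" by (simp add: dist_norm)
        then have "norm (U' s) * norm (w s - w (\<theta> n i)) \<le> B * e'"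
          using B[OF s0] B0 by (intro mult_mono) auto
        then show "norm (U' s \<bullet> w s - U' s \<bullet> w (\<theta> n i)) \<le> B * e'"
          unfolding inner_diff_right[symmetric] real_norm_def
          using Cauchy_Schwarz_ineq2[of "U' s" "w s - w (\<theta> n i)"] by linarith
      qed (use ab in auto)
      then show ?thesis
        using ab \<open>t > 0\<close> unfolding a_def[symmetric] b_def[symmetric]
        by (simp add: inner_diff_left algebra_simps)
    qed
    have "V t - V 0 = (\<Sum>i<n. V (real (Suc i) * t / n) - V (real i * t / n))"
      using \<open>0 < n\<close> by (subst sum_lessThan_telescope[of "\<lambda>i. V (real i * t / n)"]) simp
    then have "norm ((\<Sum>i<n. (U (real (Suc i) * t / n) - U (real i * t / n)) \<bullet> w (\<theta> n i)) - (V t - V 0))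
       = \<bar>\<Sum>i<n. (V (real (Suc i) * t / n) - V (real i * t / n))
        - (U (real (Suc i) * t / n) - U (real i * t / n)) \<bullet> w (\<theta> n i)\<bar>"
      by (simp add: sum_subtractf abs_minus_commute)
    also have "\<dots> \<le> (\<Sum>i<n. B * e' * (t / n))"
      by (rule sum_abs[THEN order_trans]) (intro sum_mono step, simp)
    also have "\<dots> = B * e' * t" using \<open>0 < n\<close> by simp
    also have "\<dots> < e"
    proof -
      have "B * e' * t = e * (B / (2 * (B + 1)))" using \<open>t > 0\<close> B0 by (simp add: e'_def)
      also have "\<dots> < e * 1" using \<open>e > 0\<close> B0 by (intro mult_strict_left_mono) (auto simp: field_simps)
      finally show ?thesis by simp
    qed
    finally show "norm ((\<Sum>i<n. (U (real (Suc i) * t / n) - U (real i * t / n)) \<bullet> w (\<theta> n i)) - (V t - V 0)) < e" .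
  qed
qed

section \<open>The adjoint drift, the momentum flip and the resulting Gaussian law\<close>

lemma skew_inner:
  fixes J :: "real^'n^'n"
  assumes "transpose J = - J"
  shows "(J *v x) \<bullet> y = - (x \<bullet> (J *v y))"
proof -
  have "(J *v x) \<bullet> y = x \<bullet> (transpose J *v y)" by (simp add: dot_lmul_matrix[symmetric] inner_commute)
  then show ?thesis
    by (simp add: assms matrix_vector_mult_def vec_eq_iff inner_vec_def sum_negf sum_distrib_left)
qed

definition flip :: "(real^'n) \<times> (real^'n) \<Rightarrow> (real^'n) \<times> (real^'n)" where
  "flip z = (fst z, - snd z)"

text \<open>The transpose of the drift, as \<open>drift_adjoint\<close> shows. It is introduced as
  the drift with opposite rotation conjugated by \<open>flip\<close>, which puts the symmetry behind
  time reversal into the definition.\<close>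

definition drift_adj :: "real^'n^'n \<Rightarrow> real \<Rightarrow> real \<Rightarrow> (real^'n) \<times> (real^'n) \<Rightarrow> (real^'n) \<times> (real^'n)" where
  "drift_adj J \<gamma> \<mu> z = flip (langevin_drift J \<gamma> (- \<mu>) (flip z))"

lemma drift_adj_eq:
  "drift_adj J \<gamma> \<mu> z = (\<mu> *\<^sub>R (J *v fst z) - snd z, fst z + \<mu> *\<^sub>R (J *v snd z) - \<gamma> *\<^sub>R snd z)"
  by (simp add: drift_adj_def langevin_drift_def flip_def case_prod_beta' algebra_simps
      linear_neg[OF matrix_vector_mul_linear])

lemma linear_drift: "linear (langevin_drift J \<gamma> \<mu>)"
  by (rule linearI) (auto simp: langevin_drift_def algebra_simps matrix_vector_mult_scaleR)

lemma linear_flip: "linear flip"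
  by (rule linearI) (auto simp: flip_def)

lemma flip_flip [simp]: "flip (flip z) = z"
  by (simp add: flip_def)

lemma flip_inner: "flip x \<bullet> y = x \<bullet> flip y"
  by (simp add: flip_def inner_prod_def)

lemma linear_drift_adj: "linear (drift_adj J \<gamma> \<mu>)"
  using linear_compose[OF linear_compose[OF linear_flip linear_drift] linear_flip]
  by (simp add: drift_adj_def[abs_def] o_def)

lemma drift_adjoint:
  assumes "transpose J = - J"
  shows "langevin_drift J \<gamma> \<mu> x \<bullet> y = x \<bullet> drift_adj J \<gamma> \<mu> y"
  by (simp add: drift_adj_eq langevin_drift_def case_prod_beta' inner_prod_def skew_inner[OF assms]
      inner_add_left inner_diff_left inner_add_right inner_diff_right)

lemma linear_imp_has_vector_derivative:
  "linear f \<Longrightarrow> (u has_vector_derivative u') F \<Longrightarrow> ((\<lambda>s. f (u s)) has_vector_derivative f u') F"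
  for f :: "'a::euclidean_space \<Rightarrow> 'b::euclidean_space"
  by (rule bounded_linear.has_vector_derivative) (simp_all add: linear_conv_bounded_linear)

lemma lin_exp_reversed_derivative:
  assumes "linear T"
  shows "((\<lambda>s. lin_exp T (t - s) x) has_vector_derivative - T (lin_exp T (t - s) x)) (at s within S)"
proof -
  have "((\<lambda>s. lin_exp T s x) \<circ> (\<lambda>s. t - s) has_vector_derivative (0 - 1) *\<^sub>R T (lin_exp T (t - s) x)) (at s within S)"
    by (rule vector_diff_chain_within)
       (auto intro!: lin_exp_vector_derivative assms derivative_eq_intros)
  then show ?thesis by (simp add: o_def)
qed

lemma continuous_on_lin_exp:
  assumes "linear T"
  shows "continuous_on S (\<lambda>s. lin_exp T (t - s) x)"
  using lin_exp_reversed_derivative[OF assms]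
  by (intro continuous_on_vector_derivative) auto

text \<open>Variation of constants without a stochastic integral. The path minus its noise,
  \<open>Y\<close>, is differentiable, and in the derivative of \<open>u s \<bullet> Y s\<close> the
  adjoint flow cancels the drift, leaving \<open>U' s \<bullet> W s\<close>. Integrating by parts
  then moves the increments from the smooth function \<open>U\<close> to the rough path
  \<open>W\<close>.\<close>

lemma path_representation:
  fixes J :: "real^'n^'n" and W :: "real \<Rightarrow> real^'n" and X :: "real \<Rightarrow> (real^'n) \<times> (real^'n)"
    and k :: "(real^'n) \<times> (real^'n)"
  assumes J: "transpose J = - J" and "t > 0"
    and W: "continuous_on {0..} W" "W 0 = 0" and Xc: "continuous_on {0..} X"
    and X: "\<And>s. s \<ge> 0 \<Longrightarrow> X s = x + integral {0..s} (\<lambda>r. langevin_drift J \<gamma> \<mu> (X r)) + (0, c *\<^sub>R W s)"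
  defines "u \<equiv> \<lambda>s. lin_exp (drift_adj J \<gamma> \<mu>) (t - s) k"
  shows "(\<lambda>n. \<Sum>i<n. c * (snd (u (real i * t / n)) \<bullet> (W (real (Suc i) * t / n) - W (real i * t / n))))
     \<longlonglongrightarrow> k \<bullet> X t - lin_exp (drift_adj J \<gamma> \<mu>) t k \<bullet> x"
proof -
  let ?A = "langevin_drift J \<gamma> \<mu>" and ?B = "drift_adj J \<gamma> \<mu>"
  \<comment> \<open>The sign matches the backward flow: \<open>u\<close> has derivative
    \<open>- drift_adj J \<gamma> \<mu> (u s)\<close>, so that \<open>U'\<close> below is indeed the
    derivative of \<open>U\<close>.\<close>
  define U where "U s = - (c *\<^sub>R snd (u s))" for s
  define U' where "U' s = c *\<^sub>R snd (?B (u s))" for s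
  define Y where "Y s = x + integral {0..s} (\<lambda>r. ?A (X r))" for s
  define V where "V s = u s \<bullet> Y s" for s
  have u: "(u has_vector_derivative - ?B (u s)) (at s within S)" for s S
    unfolding u_def by (rule lin_exp_reversed_derivative[OF linear_drift_adj])
  have linear_snd': "linear (\<lambda>z::(real^'n) \<times> (real^'n). - (c *\<^sub>R snd z))" by (auto simp: linear_iff algebra_simps)
  have contA: "continuous_on S (\<lambda>r. ?A (X r))" if "S \<subseteq> {0..}" for S
    by (rule continuous_on_compose2[OF linear_continuous_on continuous_on_subset[OF Xc that]])
       (use linear_drift in \<open>auto simp: linear_conv_bounded_linear\<close>)
  have U: "(U has_vector_derivative U' s) (at s within {0..t})" for s
    using linear_imp_has_vector_derivative[OF linear_snd' u] by (simp add: U_def[abs_def] U'_def)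
  have V: "(V has_real_derivative U' s \<bullet> W s) (at s within {0..t})" if s: "s \<in> {0..t}" for s
  proof -
    have Y: "(Y has_vector_derivative ?A (X s)) (at s within {0..t})"
      unfolding Y_def using integral_has_vector_derivative[OF contA s] by (auto intro!: derivative_eq_intros)
    have "(V has_vector_derivative u s \<bullet> ?A (X s) + (- ?B (u s)) \<bullet> Y s) (at s within {0..t})"
      unfolding V_def[abs_def]
      by (rule bounded_bilinear.has_vector_derivative[OF bounded_bilinear_inner u Y])
    moreover have "u s \<bullet> ?A (X s) + (- ?B (u s)) \<bullet> Y s = ?B (u s) \<bullet> (X s - Y s)"
      using drift_adjoint[OF J, of \<gamma> \<mu> "X s" "u s"] by (simp add: inner_commute inner_diff_left inner_diff_right)
    moreover have "X s - Y s = (0, c *\<^sub>R W s)" using X[of s] s by (simp add: Y_def)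
    ultimately show ?thesis
      by (simp add: has_real_derivative_iff_has_vector_derivative U'_def inner_prod_def)
  qed
  have contU': "continuous_on {0..t} U'"
    unfolding U'_def u_def
    by (intro continuous_intros continuous_on_lin_exp linear_drift_adj
        continuous_on_compose2[OF linear_continuous_on[of ?B UNIV]])
       (use linear_drift_adj in \<open>auto simp: linear_conv_bounded_linear\<close>)
  then have "compact (U' ` {0..t})" by (intro compact_continuous_image) auto
  then have "\<exists>B. \<forall>s\<in>{0..t}. norm (U' s) \<le> B"
    by (auto dest!: compact_imp_bounded simp: bounded_iff)
  then obtain B where B: "\<And>s. s \<in> {0..t} \<Longrightarrow> norm (U' s) \<le> B" by blast
  \<comment> \<open>\<open>W\<close> is evaluated at the right end of each subinterval, as the
    summation by parts below requires.\<close>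
  have "(\<lambda>n. \<Sum>i<n. (U (real (Suc i) * t / n) - U (real i * t / n)) \<bullet> W (real (Suc i) * t / n)) \<longlonglongrightarrow> V t - V 0"
    by (rule stieltjes_sum_tendsto[OF \<open>t > 0\<close> U V B continuous_on_subset[OF W(1)]])
       (use \<open>t > 0\<close> in \<open>auto intro!: divide_right_mono\<close>)
  then have lim: "(\<lambda>n. (\<Sum>i<n. (U (real (Suc i) * t / n) - U (real i * t / n)) \<bullet> W (real (Suc i) * t / n)) - U t \<bullet> W t)
      \<longlonglongrightarrow> V t - V 0 - U t \<bullet> W t"
    by (intro tendsto_intros)
  \<comment> \<open>Summation by parts: the boundary term at 0 disappears because
    \<open>W 0 = 0\<close>, and the one at \<open>t\<close> is the term subtracted here. The
    coefficients of the increments of \<open>W\<close> end up at left endpoints.\<close>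
  have abel: "(\<Sum>i<n. (U (real (Suc i) * t / n) - U (real i * t / n)) \<bullet> W (real (Suc i) * t / n)) - U t \<bullet> W t
      = (\<Sum>i<n. c * (snd (u (real i * t / n)) \<bullet> (W (real (Suc i) * t / n) - W (real i * t / n))))" if "n > 0" for n
  proof -
    have "U t \<bullet> W t = (\<Sum>i<n. U (real (Suc i) * t / n) \<bullet> W (real (Suc i) * t / n) - U (real i * t / n) \<bullet> W (real i * t / n))"
      using that W(2) by (subst sum_lessThan_telescope[of "\<lambda>i. U (real i * t / n) \<bullet> W (real i * t / n)"]) simp
    then have "(\<Sum>i<n. (U (real (Suc i) * t / n) - U (real i * t / n)) \<bullet> W (real (Suc i) * t / n)) - U t \<bullet> W t
        = (\<Sum>i<n. - (U (real i * t / n) \<bullet> (W (real (Suc i) * t / n) - W (real i * t / n))))"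
      by (simp add: sum_subtractf[symmetric] inner_diff_left inner_diff_right)
    then show ?thesis by (simp add: U_def)
  qed
  have "X t = Y t + (0, c *\<^sub>R W t)" using X[of t] \<open>t > 0\<close> by (simp add: Y_def)
  moreover have "u t = k" "Y 0 = x" "u 0 = lin_exp ?B t k" by (simp_all add: u_def Y_def)
  ultimately have "V t - V 0 - U t \<bullet> W t = k \<bullet> X t - lin_exp ?B t k \<bullet> x"
    by (simp add: V_def U_def inner_add_right inner_prod_def[of k "(0, c *\<^sub>R W t)"])
  with lim have "(\<lambda>n. (\<Sum>i<n. (U (real (Suc i) * t / n) - U (real i * t / n)) \<bullet> W (real (Suc i) * t / n)) - U t \<bullet> W t)
      \<longlonglongrightarrow> k \<bullet> X t - lin_exp ?B t k \<bullet> x" by (simp only:)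
  then show ?thesis
    by (rule Lim_transform_eventually) (rule eventually_mono[OF eventually_gt_at_top[of 0] abel])
qed

text \<open>Rotation and the exchange of position and momentum are skew, so in the energy balance
  only friction remains: half the squared norm of \<open>u\<close> grows at rate \<gamma> times the
  squared momentum part. This limit is the exponent of the characteristic function of the noise,
  hence the covariance is I minus the contribution of the flow.\<close>

lemma energy_sum_tendsto:
  fixes J :: "real^'n^'n" and k :: "(real^'n) \<times> (real^'n)" and \<gamma> \<mu> :: real
  assumes J: "transpose J = - J" and "t > 0"
  defines "u \<equiv> \<lambda>s. lin_exp (drift_adj J \<gamma> \<mu>) (t - s) k"
  shows "(\<lambda>n. \<Sum>i<n. t / n * (\<gamma> * (snd (u (real i * t / n)) \<bullet> snd (u (real i * t / n)))))
     \<longlonglongrightarrow> (k \<bullet> k - lin_exp (drift_adj J \<gamma> \<mu>) t k \<bullet> lin_exp (drift_adj J \<gamma> \<mu>) t k) / 2"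
proof -
  let ?B = "drift_adj J \<gamma> \<mu>"
  have u: "(u has_vector_derivative - ?B (u s)) (at s within S)" for s S
    unfolding u_def by (rule lin_exp_reversed_derivative[OF linear_drift_adj])
  have cont: "continuous_on {0..t} (\<lambda>s. \<gamma> * (snd (u s) \<bullet> snd (u s)))"
    unfolding u_def by (intro continuous_intros continuous_on_lin_exp linear_drift_adj)
  have diss: "- (?B v \<bullet> v) = \<gamma> * (snd v \<bullet> snd v)" for v
    using skew_inner[OF J, of "fst v" "fst v"] skew_inner[OF J, of "snd v" "snd v"]
    by (simp add: drift_adj_eq inner_prod_def inner_add_right inner_diff_right inner_add_left inner_diff_left inner_commute)
  have "(\<lambda>n. \<Sum>i<n. (real (Suc i) * t / n - real i * t / n) \<bullet> (\<gamma> * (snd (u (real i * t / n)) \<bullet> snd (u (real i * t / n)))))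
      \<longlonglongrightarrow> u t \<bullet> u t / 2 - u 0 \<bullet> u 0 / 2"
  proof (rule stieltjes_sum_tendsto[OF \<open>t > 0\<close>, where U = "\<lambda>s. s" and U' = "\<lambda>_. 1" and B = 1
        and V = "\<lambda>s. u s \<bullet> u s / 2" and w = "\<lambda>s. \<gamma> * (snd (u s) \<bullet> snd (u s))"
        and \<theta> = "\<lambda>n i. real i * t / n"])
    fix s assume "s \<in> {0..t}"
    have "((\<lambda>s. u s \<bullet> u s) has_vector_derivative u s \<bullet> (- ?B (u s)) + (- ?B (u s)) \<bullet> u s) (at s within {0..t})"
      by (rule bounded_bilinear.has_vector_derivative[OF bounded_bilinear_inner u u])
    then have "((\<lambda>s. u s \<bullet> u s) has_real_derivative 2 * (\<gamma> * (snd (u s) \<bullet> snd (u s)))) (at s within {0..t})"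
      unfolding diss[symmetric] by (simp add: has_real_derivative_iff_has_vector_derivative inner_commute)
    then show "((\<lambda>s. u s \<bullet> u s / 2) has_real_derivative 1 \<bullet> (\<gamma> * (snd (u s) \<bullet> snd (u s)))) (at s within {0..t})"
      using DERIV_cdivide[where c = 2] by fastforce
  qed (use \<open>t > 0\<close> cont in \<open>auto intro!: divide_right_mono derivative_eq_intros\<close>)
  moreover have "real (Suc i) * t / n - real i * t / n = t / n" for i n
    by (simp add: diff_divide_distrib[symmetric] algebra_simps)
  ultimately show ?thesis by (simp add: u_def diff_divide_distrib)
qed

lemma lin_exp_drift_adj_contraction:
  fixes J :: "real^'n^'n"
  assumes "transpose J = - J" "\<gamma> > 0" "t \<ge> 0"
  shows "lin_exp (drift_adj J \<gamma> \<mu>) t k \<bullet> lin_exp (drift_adj J \<gamma> \<mu>) t k \<le> k \<bullet> k"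
proof (cases "t = 0")
  case False
  then have "t > 0" using assms by simp
  have "0 \<le> (k \<bullet> k - lin_exp (drift_adj J \<gamma> \<mu>) t k \<bullet> lin_exp (drift_adj J \<gamma> \<mu>) t k) / 2"
    by (rule LIMSEQ_le_const[OF energy_sum_tendsto[OF assms(1) \<open>t > 0\<close>]])
       (use \<open>t > 0\<close> \<open>\<gamma> > 0\<close> in \<open>auto intro!: sum_nonneg mult_nonneg_nonneg\<close>)
  then show ?thesis by simp
qed simp

text \<open>Independence factorises the characteristic function of each approximating sum. A step of
  length t/n contributes -(1/2) (2 \<gamma>) (t/n) |snd u|^2 to the exponent, and these
  contributions add up to the sums of \<open>energy_sum_tendsto\<close>. All integrands have modulus
  1, so the almost sure limit of the sums passes under the integral.\<close>

theorem langevin_char: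
  fixes J :: "real^'n^'n"
  assumes J: "transpose J = - J" and "\<gamma> > 0" "t \<ge> 0"
    and BM: "standard_brownian_motion M W" and sol: "langevin_solution M W J \<gamma> \<mu> x X"
  shows "(CLINT \<omega>|M. iexp (k \<bullet> X t \<omega>)) = iexp (lin_exp (drift_adj J \<gamma> \<mu>) t k \<bullet> x)
    * exp (- ((k \<bullet> k - lin_exp (drift_adj J \<gamma> \<mu>) t k \<bullet> lin_exp (drift_adj J \<gamma> \<mu>) t k) / 2))"
proof -
  interpret prob_space M using BM by (simp add: standard_brownian_motion_def)
  have W [measurable]: "\<And>t. t \<ge> 0 \<Longrightarrow> W t \<in> borel_measurable M"
    and W0: "AE \<omega> in M. W 0 \<omega> = 0" and Wc: "AE \<omega> in M. continuous_on {0..} (\<lambda>t. W t \<omega>)"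
    and incr: "\<And>s t. 0 \<le> s \<Longrightarrow> s < t \<Longrightarrow> distr M borel (\<lambda>\<omega>. W t \<omega> - W s \<omega>) = gaussian (sqrt (t - s))"
    and indep: "\<And>(n::nat) \<tau>. 0 \<le> \<tau> 0 \<Longrightarrow> (\<forall>i<n. \<tau> i < \<tau> (Suc i)) \<Longrightarrow>
        indep_vars (\<lambda>_. borel) (\<lambda>i \<omega>. W (\<tau> (Suc i)) \<omega> - W (\<tau> i) \<omega>) {..<n}"
    using BM by (auto simp: standard_brownian_motion_def)
  have X [measurable]: "X t \<in> borel_measurable M"
    using sol \<open>t \<ge> 0\<close> by (simp add: langevin_solution_def)
  have Xeq: "AE \<omega> in M. continuous_on {0..} (\<lambda>t. X t \<omega>) \<and>
        (\<forall>t\<ge>0. X t \<omega> = x + integral {0..t} (\<lambda>s. langevin_drift J \<gamma> \<mu> (X s \<omega>)) + (0, sqrt (2 * \<gamma>) *\<^sub>R W t \<omega>))"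
    using sol by (simp add: langevin_solution_def)
  show ?thesis
  \<comment> \<open>At time 0 there is no strictly increasing partition to use; the process sits at
    \<open>x\<close> almost surely because \<open>W 0 = 0\<close>.\<close>
  proof (cases "t = 0")
    case True
    have "AE \<omega> in M. X t \<omega> = x" using Xeq W0
    proof eventually_elim
      case (elim \<omega>)
      then show ?case unfolding True by (auto dest!: conjunct2 spec[of _ 0] simp: zero_prod_def[symmetric])
    qed
    then have "(CLINT \<omega>|M. iexp (k \<bullet> X t \<omega>)) = (CLINT \<omega>|M. iexp (k \<bullet> x))"
      by (intro integral_cong_AE) auto
    then show ?thesis using True by (simp add: prob_space)
  next
    case False
    then have "t > 0" using \<open>t \<ge> 0\<close> by simp
    let ?P = "lin_exp (drift_adj J \<gamma> \<mu>) t k" and ?c = "sqrt (2 * \<gamma>)"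
    define u where "u s = lin_exp (drift_adj J \<gamma> \<mu>) (t - s) k" for s
    define D where "D n i \<omega> = W (real (Suc i) * t / n) \<omega> - W (real i * t / n) \<omega>" for n i :: nat and \<omega>
    define S where "S n \<omega> = (\<Sum>i<n. ?c * (snd (u (real i * t / n)) \<bullet> D n i \<omega>))" for n \<omega>
    have Dm [measurable]: "D n i \<in> borel_measurable M" for n i
      unfolding D_def[abs_def] using \<open>t > 0\<close> by (intro borel_measurable_diff W) auto
    have Sm [measurable]: "S n \<in> borel_measurable M" for n
      unfolding S_def[abs_def] by measurable
    have lim: "AE \<omega> in M. (\<lambda>n. S n \<omega>) \<longlonglongrightarrow> k \<bullet> X t \<omega> - ?P \<bullet> x"
      using Xeq W0 Wc
    proof eventually_elim
      case (elim \<omega>)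
      show ?case
        unfolding S_def D_def u_def
        by (rule path_representation[OF J \<open>t > 0\<close>]) (use elim in auto)
    qed
    have charS: "(CLINT \<omega>|M. iexp (S n \<omega>)) = exp (- (\<Sum>i<n. t / n * (\<gamma> * (snd (u (real i * t / n)) \<bullet> snd (u (real i * t / n))))))"
      if "n > 0" for n
    proof -
      have inc: "0 \<le> real i * t / n" "real i * t / n < real (Suc i) * t / n" for i
        using \<open>t > 0\<close> that by (auto intro!: divide_strict_right_mono)
      have gap: "real (Suc i) * t / n - real i * t / n = t / n" for i
        by (simp add: diff_divide_distrib[symmetric] algebra_simps)
      have "indep_vars (\<lambda>_. borel) (D n) {..<n}"
        using indep[of "\<lambda>i. real i * t / n" n] inc unfolding D_def[abs_def] by simp
      then have ind: "indep_vars (\<lambda>_. borel) (\<lambda>i \<omega>. iexp (?c * (snd (u (real i * t / n)) \<bullet> D n i \<omega>))) {..<n}"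
        by (rule indep_vars_compose2) simp
      have "(CLINT \<omega>|M. iexp (S n \<omega>)) = (CLINT \<omega>|M. (\<Prod>i<n. iexp (?c * (snd (u (real i * t / n)) \<bullet> D n i \<omega>))))"
        by (simp add: S_def exp_sum sum_distrib_left)
      also have "\<dots> = (\<Prod>i<n. CLINT \<omega>|M. iexp (?c * (snd (u (real i * t / n)) \<bullet> D n i \<omega>)))"
        by (rule indep_vars_lebesgue_integral[OF _ ind]) (auto intro!: integrable_const_bound[of _ 1])
      also have "\<dots> = (\<Prod>i<n. complex_of_real (exp (- (t / n * (\<gamma> * (snd (u (real i * t / n)) \<bullet> snd (u (real i * t / n))))))))"
      proof (intro prod.cong refl)
        fix i
        have law: "distr M borel (D n i) = gaussian (sqrt (t / n))"
          using incr[OF inc] unfolding D_def[abs_def] gap .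
        have "(CLINT \<omega>|M. iexp (?c * (snd (u (real i * t / n)) \<bullet> D n i \<omega>)))
            = vchar (distr M borel (D n i)) (?c *\<^sub>R snd (u (real i * t / n)))"
          unfolding vchar_def by (subst integral_distr) auto
        also have "\<dots> = exp (- (t / n * (\<gamma> * (snd (u (real i * t / n)) \<bullet> snd (u (real i * t / n))))))"
          unfolding law using \<open>t > 0\<close> \<open>\<gamma> > 0\<close> that
          by (subst vchar_gaussian) (auto simp: power2_eq_square[symmetric] mult.assoc[symmetric])
        finally show "(CLINT \<omega>|M. iexp (?c * (snd (u (real i * t / n)) \<bullet> D n i \<omega>)))
            = exp (- (t / n * (\<gamma> * (snd (u (real i * t / n)) \<bullet> snd (u (real i * t / n))))))" .
      qed
      finally show ?thesis by (simp add: exp_sum sum_negf[symmetric] del: of_real_exp)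
    qed
    have "(\<lambda>n. CLINT \<omega>|M. iexp (S n \<omega>)) \<longlonglongrightarrow> (CLINT \<omega>|M. iexp (k \<bullet> X t \<omega> - ?P \<bullet> x))"
    proof (rule integral_dominated_convergence[where w = "\<lambda>_. 1"])
      show "AE \<omega> in M. (\<lambda>n. iexp (S n \<omega>)) \<longlonglongrightarrow> iexp (k \<bullet> X t \<omega> - ?P \<bullet> x)"
        using lim by eventually_elim (intro tendsto_intros)
    qed auto
    moreover have "(\<lambda>n. CLINT \<omega>|M. iexp (S n \<omega>)) \<longlonglongrightarrow> complex_of_real (exp (- ((k \<bullet> k - ?P \<bullet> ?P) / 2)))"
    proof -
      have "(\<lambda>n. complex_of_real (exp (- (\<Sum>i<n. t / n * (\<gamma> * (snd (u (real i * t / n)) \<bullet> snd (u (real i * t / n))))))))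
          \<longlonglongrightarrow> complex_of_real (exp (- ((k \<bullet> k - ?P \<bullet> ?P) / 2)))"
        unfolding u_def by (intro tendsto_intros energy_sum_tendsto J \<open>t > 0\<close>)
      moreover have "\<forall>\<^sub>F n in sequentially. complex_of_real (exp (- (\<Sum>i<n. t / n * (\<gamma> * (snd (u (real i * t / n)) \<bullet> snd (u (real i * t / n)))))))
          = (CLINT \<omega>|M. iexp (S n \<omega>))"
        using eventually_gt_at_top[of 0] by eventually_elim (simp add: charS)
      ultimately show ?thesis by (rule Lim_transform_eventually)
    qed
    ultimately have "(CLINT \<omega>|M. iexp (k \<bullet> X t \<omega> - ?P \<bullet> x)) = exp (- ((k \<bullet> k - ?P \<bullet> ?P) / 2))"
      by (rule LIMSEQ_unique)
    moreover have "(CLINT \<omega>|M. iexp (k \<bullet> X t \<omega>)) = (CLINT \<omega>|M. iexp (?P \<bullet> x) * iexp (k \<bullet> X t \<omega> - ?P \<bullet> x))"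
      by (simp add: exp_add[symmetric] algebra_simps)
    ultimately show ?thesis by simp
  qed
qed

subsection \<open>The semigroup on square integrable functions\<close>

lemma L2_mult_integrable:
  assumes "f \<in> L2 M" "g \<in> L2 M"
  shows "integrable M (\<lambda>x. f x * g x)"
proof (rule Bochner_Integration.integrable_bound)
  show "integrable M (\<lambda>x. (f x)\<^sup>2 + (g x)\<^sup>2)" using assms by (auto simp: L2_def)
  show "(\<lambda>x. f x * g x) \<in> borel_measurable M" using assms by (auto simp: L2_def)
  have "\<bar>a * b\<bar> \<le> a\<^sup>2 + b\<^sup>2" for a b :: real
  proof -
    have "2 * \<bar>a * b\<bar> \<le> a\<^sup>2 + b\<^sup>2"
      using sum_squares_bound[of "\<bar>a\<bar>" "\<bar>b\<bar>"] by (simp add: abs_mult)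
    then show ?thesis by linarith
  qed
  then show "AE x in M. norm (f x * g x) \<le> norm ((f x)\<^sup>2 + (g x)\<^sup>2)" by simp
qed

lemma L2_add: "f \<in> L2 M \<Longrightarrow> g \<in> L2 M \<Longrightarrow> (\<lambda>x. f x + g x) \<in> L2 M"
  using L2_mult_integrable[of f M g] by (auto simp: L2_def power2_sum mult.assoc)

lemma L2_cmult: "f \<in> L2 M \<Longrightarrow> (\<lambda>x. c * f x) \<in> L2 M"
  by (auto simp: L2_def power_mult_distrib)

lemma L2_diff: "f \<in> L2 M \<Longrightarrow> g \<in> L2 M \<Longrightarrow> (\<lambda>x. f x - g x) \<in> L2 M"
  using L2_add[OF _ L2_cmult[of g M "-1"], of f] by simp

text \<open>Young's inequality with weight \<open>e / K\<close> replaces the Cauchy--Schwarz inequality here.\<close>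

lemma L2_tendsto_inner:
  assumes d: "\<And>t. t > 0 \<Longrightarrow> d t \<in> L2 M" and h: "h \<in> L2 M" and g: "g \<in> L2 M"
    and lim: "((\<lambda>t. \<integral>x. (d t x - h x)\<^sup>2 \<partial>M) \<longlongrightarrow> 0) (at_right (0::real))"
  shows "((\<lambda>t. \<integral>x. d t x * g x \<partial>M) \<longlongrightarrow> (\<integral>x. h x * g x \<partial>M)) (at_right 0)"
proof (rule tendstoI)
  fix e :: real
  assume "e > 0"
  \<comment> \<open>Adding 1 keeps \<open>K\<close> positive even when \<open>g\<close> vanishes
    almost everywhere and makes the bound on its squared norm strict.\<close>
  define K where "K = (\<integral>x. (g x)\<^sup>2 \<partial>M) + 1"
  have K: "K > 0" "(\<integral>x. (g x)\<^sup>2 \<partial>M) < K" by (auto simp: K_def intro!: add_nonneg_pos)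
  have "\<forall>\<^sub>F t in at_right 0. (\<integral>x. (d t x - h x)\<^sup>2 \<partial>M) < e\<^sup>2 / K"
    using order_tendstoD(2)[OF lim, of "e\<^sup>2 / K"] \<open>e > 0\<close> K by simp
  moreover have "\<forall>\<^sub>F t in at_right (0::real). t > 0" by (rule eventually_at_right_less)
  ultimately show "\<forall>\<^sub>F t in at_right 0. dist (\<integral>x. d t x * g x \<partial>M) (\<integral>x. h x * g x \<partial>M) < e"
  proof eventually_elim
    case (elim t)
    let ?u = "\<lambda>x. d t x - h x"
    have u: "?u \<in> L2 M" by (rule L2_diff[OF d[OF elim(2)] h])
    have int: "integrable M (\<lambda>x. (?u x)\<^sup>2)" "integrable M (\<lambda>x. (g x)\<^sup>2)" "integrable M (\<lambda>x. ?u x * g x)"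
      using u g L2_mult_integrable[OF u g] by (auto simp: L2_def)
    have "\<bar>\<integral>x. ?u x * g x \<partial>M\<bar> \<le> (\<integral>x. \<bar>?u x * g x\<bar> \<partial>M)" by (rule integral_abs_bound)
    also have "\<dots> \<le> (\<integral>x. (e / (2 * K)) * (g x)\<^sup>2 + (K / (2 * e)) * (?u x)\<^sup>2 \<partial>M)"
    proof (rule integral_mono)
      fix x
      have "0 \<le> (\<bar>g x\<bar> * e - \<bar>?u x\<bar> * K)\<^sup>2" by simp
      then have "2 * e * K * \<bar>?u x * g x\<bar> \<le> e\<^sup>2 * (g x)\<^sup>2 + K\<^sup>2 * (?u x)\<^sup>2"
        by (simp add: power2_diff power_mult_distrib abs_mult mult_ac)
      then have "\<bar>?u x * g x\<bar> \<le> (e\<^sup>2 * (g x)\<^sup>2 + K\<^sup>2 * (?u x)\<^sup>2) / (2 * e * K)"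
        using \<open>e > 0\<close> K by (simp add: pos_le_divide_eq mult.commute)
      also have "\<dots> = (e / (2 * K)) * (g x)\<^sup>2 + (K / (2 * e)) * (?u x)\<^sup>2"
        using \<open>e > 0\<close> K by (simp add: field_simps power2_eq_square)
      finally show "\<bar>?u x * g x\<bar> \<le> (e / (2 * K)) * (g x)\<^sup>2 + (K / (2 * e)) * (?u x)\<^sup>2" .
    qed (use int in auto)
    also have "\<dots> = (e / (2 * K)) * (\<integral>x. (g x)\<^sup>2 \<partial>M) + (K / (2 * e)) * (\<integral>x. (?u x)\<^sup>2 \<partial>M)"
      using int by simp
    also have "\<dots> < (e / (2 * K)) * K + (K / (2 * e)) * (e\<^sup>2 / K)"
      using \<open>e > 0\<close> K elim by (intro add_strict_mono mult_strict_left_mono) auto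
    also have "\<dots> = e" using \<open>e > 0\<close> K by (simp add: power2_eq_square)
    finally have "\<bar>\<integral>x. ?u x * g x \<partial>M\<bar> < e" .
    moreover have "(\<integral>x. ?u x * g x \<partial>M) = (\<integral>x. d t x * g x \<partial>M) - (\<integral>x. h x * g x \<partial>M)"
      using L2_mult_integrable[OF d[OF elim(2)] g] L2_mult_integrable[OF h g]
      by (simp add: left_diff_distrib)
    ultimately show ?case by (simp add: dist_real_def)
  qed
qed

lemma borel_measurable_gaussian [simp]:
  "borel_measurable (gaussian \<sigma>) = borel_measurable borel"
  by (rule measurable_cong_sets) simp_all

lemma borel_measurable_fst_snd [measurable]:
  "(fst :: 'a::topological_space \<times> 'b::topological_space \<Rightarrow> 'a) \<in> borel_measurable borel"
  "(snd :: 'a \<times> 'b \<Rightarrow> 'b) \<in> borel_measurable borel"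
  by (intro borel_measurable_continuous_onI continuous_intros)+

lemma quadratic_in_L2:
  fixes f :: "'a::euclidean_space \<Rightarrow> real"
  assumes "f \<in> borel_measurable borel" "\<And>z. \<bar>f z\<bar> \<le> C * (1 + z \<bullet> z)"
  shows "f \<in> L2 (gaussian 1)"
  using integrable_gaussian_quadratics[OF assms(1,1) assms(2,2)] assms(1)
  by (simp add: L2_def power2_eq_square)

lemma herm_sum_in_L2:
  "(\<lambda>z. (\<Sum>i\<in>I. herm (a i) (b i) z) + c \<bullet> z) \<in> L2 (gaussian 1)" for c :: "'a::euclidean_space"
proof (rule quadratic_in_L2)
  fix z
  have "\<bar>\<Sum>i\<in>I. herm (a i) (b i) z\<bar> \<le> (\<Sum>i\<in>I. norm (a i) * norm (b i) * (1 + z \<bullet> z))"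
    by (rule sum_abs[THEN order_trans]) (intro sum_mono abs_herm_le)
  then show "\<bar>(\<Sum>i\<in>I. herm (a i) (b i) z) + c \<bullet> z\<bar>
      \<le> ((\<Sum>i\<in>I. norm (a i) * norm (b i)) + norm c) * (1 + z \<bullet> z)"
    using abs_inner_le_quadratic[of c z] by (simp add: sum_distrib_right distrib_right)
qed simp

lemma lin_exp_tendsto_0:
  assumes "linear T"
  shows "((\<lambda>t. lin_exp T t x) \<longlongrightarrow> x) (at_right 0)"
    and "((\<lambda>t. (1 / t) *\<^sub>R (lin_exp T t x - x) - T x) \<longlongrightarrow> 0) (at_right 0)"
proof -
  have d: "((\<lambda>t. lin_exp T t x) has_vector_derivative T x) (at 0 within {0<..})"
    using lin_exp_vector_derivative[OF assms, of x 0] by simp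
  show "((\<lambda>t. lin_exp T t x) \<longlongrightarrow> x) (at_right 0)"
    using has_vector_derivative_continuous[OF d] by (simp add: continuous_within)
  have "((\<lambda>t. (1 / norm (t - 0)) *\<^sub>R (lin_exp T t x - (lin_exp T 0 x + (t - 0) *\<^sub>R T x))) \<longlongrightarrow> 0) (at_right 0)"
    using d unfolding has_vector_derivative_def has_derivative_within by blast
  then show "((\<lambda>t. (1 / t) *\<^sub>R (lin_exp T t x - x) - T x) \<longlongrightarrow> 0) (at_right 0)"
  proof (rule Lim_transform_eventually)
    show "\<forall>\<^sub>F t in at_right 0. (1 / norm (t - 0)) *\<^sub>R (lin_exp T t x - (lin_exp T 0 x + (t - 0) *\<^sub>R T x))
        = (1 / t) *\<^sub>R (lin_exp T t x - x) - T x"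
      using eventually_at_right_less[of 0] by eventually_elim (simp add: algebra_simps)
  qed
qed

text \<open>A discrete product rule. When \<open>a'\<close> and \<open>b'\<close> follow a flow
  through \<open>a\<close> and \<open>b\<close> with derivatives \<open>Ba\<close> and
  \<open>Bb\<close>, every term on the right contains a factor that tends to 0.\<close>

lemma herm_difference_quotient:
  assumes "t \<noteq> 0"
  shows "(herm a' b' z - herm a b z) / t - (herm Ba b z + herm a Bb z)
    = herm ((1 / t) *\<^sub>R (a' - a) - Ba) b' z + herm Ba (b' - b) z + herm a ((1 / t) *\<^sub>R (b' - b) - Bb) z"
  unfolding herm_def inner_diff_left inner_diff_right inner_scaleR_left inner_scaleR_right
  using assms by (simp add: field_simps)

text \<open>All rotation strengths are kept together, driven by the same Brownian motion, because
  the duality compares the dynamics at \<mu> with the one at -\<mu>.\<close>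

locale langevin_family =
  fixes J :: "real^'n^'n" and \<gamma> :: real and M :: "'w measure" and W :: "real \<Rightarrow> 'w \<Rightarrow> real^'n"
    and X :: "real \<Rightarrow> (real^'n) \<times> (real^'n) \<Rightarrow> real \<Rightarrow> 'w \<Rightarrow> (real^'n) \<times> (real^'n)"
  assumes skew: "transpose J = - J" and friction: "\<gamma> > 0"
    and BM: "standard_brownian_motion M W"
    and sol: "\<And>\<mu> x. langevin_solution M W J \<gamma> \<mu> x (X \<mu> x)"
begin

abbreviation "B \<mu> \<equiv> drift_adj J \<gamma> \<mu>"
abbreviation "A \<mu> \<equiv> langevin_drift J \<gamma> \<mu>"
abbreviation "\<Psi> \<mu> t \<equiv> lin_exp (B \<mu>) t"
abbreviation "\<Phi> \<mu> t \<equiv> lin_exp (A \<mu>) t"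
abbreviation "P \<mu> \<equiv> markov_semigroup M (X \<mu>)"
abbreviation "N \<equiv> (gaussian 1 :: ((real^'n) \<times> (real^'n)) measure)"

sublocale prob_space M
  using BM by (simp add: standard_brownian_motion_def)

sublocale N: prob_space N
  by (rule prob_space_gaussian) simp

lemma X_measurable: "t \<ge> 0 \<Longrightarrow> X \<mu> x t \<in> borel_measurable M"
  using sol[of \<mu> x] by (simp add: langevin_solution_def)

lemma char_X:
  "t \<ge> 0 \<Longrightarrow> (CLINT \<omega>|M. iexp (k \<bullet> X \<mu> x t \<omega>))
    = iexp (\<Psi> \<mu> t k \<bullet> x) * exp (- ((k \<bullet> k - \<Psi> \<mu> t k \<bullet> \<Psi> \<mu> t k) / 2))"
  by (rule langevin_char[OF skew friction _ BM sol])

lemmas X_moments = ou_moments[OF prob_space_axioms X_measurable linear_lin_exp[OF linear_drift_adj]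
    lin_exp_drift_adj_contraction[OF skew friction] char_X]

lemma semigroup_quad:
  assumes "t \<ge> 0"
  shows "P \<mu> t (quad S c) x = (\<Sum>b\<in>Basis. herm (\<Psi> \<mu> t b) (\<Psi> \<mu> t (S b)) x) + \<Psi> \<mu> t c \<bullet> x"
  unfolding markov_semigroup_def quad_def using X_moments[OF assms assms assms]
  by simp

text \<open>The semigroup on these polynomials is explicit, so the error of the difference quotient
  is bounded pointwise by a small constant times 1 + |z|^2, a function whose square is integrable.
  Convergence in the L2 norm follows, and the generator acts on each \<open>herm\<close> by the
  product rule.\<close>

lemma generator_quad:
  "is_generator N (P \<mu>) (quad S c)
    (\<lambda>z. (\<Sum>b\<in>Basis. herm (B \<mu> b) (S b) z + herm b (B \<mu> (S b)) z) + B \<mu> c \<bullet> z)"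
  (is "is_generator N _ _ ?L")
proof -
  define q where "q t v = (1 / t) *\<^sub>R (\<Psi> \<mu> t v - v) - B \<mu> v" for t v
  \<comment> \<open>\<open>C t\<close> collects the norms produced by
    \<open>herm_difference_quotient\<close>: each summand contains either the error \<open>q\<close>
    of a difference quotient or a displacement of the flow, so it vanishes as \<open>t\<close> tends
    to 0.\<close>
  define C where "C t = (\<Sum>b\<in>Basis. norm (q t b) * norm (\<Psi> \<mu> t (S b)) + norm (B \<mu> b) * norm (\<Psi> \<mu> t (S b) - S b)
      + norm b * norm (q t (S b))) + norm (q t c)" for t
  note lim = lin_exp_tendsto_0[OF linear_drift_adj[of J \<gamma> \<mu>]]
  have C0: "(C \<longlongrightarrow> 0) (at_right 0)"
  proof -
    have q: "((\<lambda>t. norm (q t v)) \<longlongrightarrow> 0) (at_right 0)" for v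
      using lim(2)[of v] by (simp add: q_def tendsto_norm_zero)
    have r: "((\<lambda>t. norm (\<Psi> \<mu> t v - v)) \<longlongrightarrow> 0) (at_right 0)" for v
      using lim(1)[of v] by (simp add: tendsto_norm_zero LIM_zero)
    have "(C \<longlongrightarrow> (\<Sum>b\<in>Basis. 0 * norm (S b) + norm (B \<mu> b) * 0 + norm b * 0) + 0) (at_right 0)"
      unfolding C_def[abs_def] by (intro tendsto_intros q r lim(1))
    then show ?thesis by simp
  qed
  have Lin: "?L \<in> L2 N"
    using L2_add[OF herm_sum_in_L2[of "\<lambda>b. B \<mu> b" S Basis 0] herm_sum_in_L2[of "\<lambda>b. b" "\<lambda>b. B \<mu> (S b)" Basis "B \<mu> c"]]
    by (simp add: sum.distrib add.assoc)
  have bound: "\<bar>(P \<mu> t (quad S c) z - quad S c z) / t - ?L z\<bar> \<le> C t * (1 + z \<bullet> z)" if "t > 0" for t z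
  proof -
    have "(P \<mu> t (quad S c) z - quad S c z) / t - ?L z
        = (\<Sum>b\<in>Basis. (herm (\<Psi> \<mu> t b) (\<Psi> \<mu> t (S b)) z - herm b (S b) z) / t
            - (herm (B \<mu> b) (S b) z + herm b (B \<mu> (S b)) z)) + q t c \<bullet> z"
      using that by (simp add: semigroup_quad quad_def q_def sum_subtractf sum_divide_distrib[symmetric]
          inner_diff_left add_divide_distrib diff_divide_distrib)
    also have "\<dots> = (\<Sum>b\<in>Basis. herm (q t b) (\<Psi> \<mu> t (S b)) z + herm (B \<mu> b) (\<Psi> \<mu> t (S b) - S b) z
        + herm b (q t (S b)) z) + q t c \<bullet> z"
      using that by (subst herm_difference_quotient) (auto simp: q_def)
    finally have "\<bar>(P \<mu> t (quad S c) z - quad S c z) / t - ?L z\<bar>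
        = \<bar>(\<Sum>b\<in>Basis. herm (q t b) (\<Psi> \<mu> t (S b)) z + herm (B \<mu> b) (\<Psi> \<mu> t (S b) - S b) z
        + herm b (q t (S b)) z) + q t c \<bullet> z\<bar>" by (rule arg_cong)
    also have "\<dots> \<le> (\<Sum>b\<in>Basis. \<bar>herm (q t b) (\<Psi> \<mu> t (S b)) z + herm (B \<mu> b) (\<Psi> \<mu> t (S b) - S b) z
        + herm b (q t (S b)) z\<bar>) + \<bar>q t c \<bullet> z\<bar>"
      by (intro order_trans[OF abs_triangle_ineq] add_mono sum_abs order_refl)
    also have "\<dots> \<le> (\<Sum>b\<in>Basis. norm (q t b) * norm (\<Psi> \<mu> t (S b)) * (1 + z \<bullet> z)
        + norm (B \<mu> b) * norm (\<Psi> \<mu> t (S b) - S b) * (1 + z \<bullet> z)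
        + norm b * norm (q t (S b)) * (1 + z \<bullet> z)) + norm (q t c) * (1 + z \<bullet> z)"
    proof (rule add_mono[OF sum_mono abs_inner_le_quadratic])
      fix b :: "(real^'n) \<times> (real^'n)"
      show "\<bar>herm (q t b) (\<Psi> \<mu> t (S b)) z + herm (B \<mu> b) (\<Psi> \<mu> t (S b) - S b) z + herm b (q t (S b)) z\<bar>
          \<le> norm (q t b) * norm (\<Psi> \<mu> t (S b)) * (1 + z \<bullet> z)
          + norm (B \<mu> b) * norm (\<Psi> \<mu> t (S b) - S b) * (1 + z \<bullet> z) + norm b * norm (q t (S b)) * (1 + z \<bullet> z)"
        using abs_herm_le[of "q t b" "\<Psi> \<mu> t (S b)" z] abs_herm_le[of "B \<mu> b" "\<Psi> \<mu> t (S b) - S b" z]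
          abs_herm_le[of b "q t (S b)" z] by linarith
    qed
    also have "\<dots> = C t * (1 + z \<bullet> z)"
      unfolding C_def distrib_right sum_distrib_right by simp
    finally show ?thesis .
  qed
  define m where "m = (\<integral>z. (1 + z \<bullet> z)\<^sup>2 \<partial>N)"
  have im: "integrable N (\<lambda>z. (1 + z \<bullet> z)\<^sup>2)"
    by (rule integrable_gaussian_quartic[of _ 1]) auto
  have L2P: "P \<mu> t (quad S c) \<in> L2 N" if "t \<ge> 0" for t
    using herm_sum_in_L2[of "\<Psi> \<mu> t" "\<lambda>b. \<Psi> \<mu> t (S b)" Basis "\<Psi> \<mu> t c"] that
    by (simp add: semigroup_quad[OF that, abs_def])
  have L2q: "quad S c \<in> L2 N"
    using herm_sum_in_L2[of "\<lambda>b. b" S Basis c] by (simp add: quad_def[abs_def])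
  have "((\<lambda>t. \<integral>z. ((P \<mu> t (quad S c) z - quad S c z) / t - ?L z)\<^sup>2 \<partial>N) \<longlongrightarrow> 0) (at_right 0)"
  proof (rule tendsto_sandwich[of "\<lambda>_. 0" _ _ "\<lambda>t. (C t)\<^sup>2 * m"])
    show "\<forall>\<^sub>F t in at_right 0. (\<integral>z. ((P \<mu> t (quad S c) z - quad S c z) / t - ?L z)\<^sup>2 \<partial>N) \<le> (C t)\<^sup>2 * m"
      using eventually_at_right_less[of 0]
    proof eventually_elim
      case (elim t)
      have "(\<lambda>z. (1 / t) * (P \<mu> t (quad S c) z - quad S c z) - ?L z) \<in> L2 N"
        using elim by (intro L2_diff L2_cmult L2P L2q Lin) auto
      then have "integrable N (\<lambda>z. ((P \<mu> t (quad S c) z - quad S c z) / t - ?L z)\<^sup>2)"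
        by (simp add: L2_def)
      then have "(\<integral>z. ((P \<mu> t (quad S c) z - quad S c z) / t - ?L z)\<^sup>2 \<partial>N) \<le> (\<integral>z. (C t)\<^sup>2 * (1 + z \<bullet> z)\<^sup>2 \<partial>N)"
      proof (rule integral_mono)
        fix z
        have "\<bar>(P \<mu> t (quad S c) z - quad S c z) / t - ?L z\<bar>\<^sup>2 \<le> (C t * (1 + z \<bullet> z))\<^sup>2"
          by (rule power_mono[OF bound[OF elim]]) simp
        then show "((P \<mu> t (quad S c) z - quad S c z) / t - ?L z)\<^sup>2 \<le> (C t)\<^sup>2 * (1 + z \<bullet> z)\<^sup>2"
          by (simp add: power_mult_distrib)
      qed (use im in auto)
      then show ?case by (simp add: m_def)
    qed
    show "((\<lambda>t. (C t)\<^sup>2 * m) \<longlongrightarrow> 0) (at_right 0)"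
      using tendsto_mult[OF tendsto_power[OF C0, of 2] tendsto_const[of m]] by simp
  qed auto
  then show ?thesis unfolding is_generator_def using L2q Lin L2P by blast
qed

section \<open>Time reversal and duality of the semigroups\<close>

abbreviation "noise \<mu> t \<equiv> distr M borel (X \<mu> 0 t)"

lemma prob_space_noise: "t \<ge> 0 \<Longrightarrow> prob_space (noise \<mu> t)"
  by (rule prob_space_distr) (rule X_measurable)

lemma vchar_noise:
  assumes "t \<ge> 0"
  shows "vchar (noise \<mu> t) k = exp (- ((k \<bullet> k - \<Psi> \<mu> t k \<bullet> \<Psi> \<mu> t k) / 2))"
  unfolding vchar_def using char_X[OF assms, of k \<mu> 0]
  by (subst integral_distr) (auto simp: X_measurable assms)

lemma flow_adjoint: "\<Phi> \<mu> t x \<bullet> y = x \<bullet> \<Psi> \<mu> t y"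
  by (rule lin_exp_adjoint[OF linear_drift linear_drift_adj drift_adjoint[OF skew]])

lemma flow_measurable [measurable]: "\<Phi> \<mu> t \<in> borel_measurable borel"
  using linear_lin_exp[OF linear_drift, of J \<gamma> \<mu> t]
  by (intro borel_measurable_continuous_onI linear_continuous_on) (simp add: linear_conv_bounded_linear)

lemma flip_measurable [measurable]: "flip \<in> borel_measurable borel"
  using linear_flip
  by (intro borel_measurable_continuous_onI linear_continuous_on) (simp add: linear_conv_bounded_linear)

lemma flip_flow: "flip (\<Phi> \<mu> t x) = \<Psi> (- \<mu>) t (flip x)"
  by (rule lin_exp_intertwine[OF linear_drift linear_flip]) (simp add: drift_adj_def)

text \<open>By linearity the law started at \<open>x\<close> is the law started at 0 translated by
  the flow of \<open>x\<close>. The solutions are given for each \<open>x\<close> separately, with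
  no joint measurability in \<open>x\<close> and the sample point; this kernel form has it, and
  makes Fubini available.\<close>

lemma semigroup_eq:
  assumes "t \<ge> 0" and [measurable]: "G \<in> borel_measurable borel"
  shows "P \<mu> t G x = (\<integral>y. G (\<Phi> \<mu> t x + y) \<partial>noise \<mu> t)"
proof -
  note [measurable] = X_measurable[OF \<open>t \<ge> 0\<close>]
  have "distr M borel (X \<mu> x t) = distr (noise \<mu> t) borel (\<lambda>y. \<Phi> \<mu> t x + y)"
  proof (rule vchar_unique)
    fix k
    have "vchar (distr (noise \<mu> t) borel (\<lambda>y. \<Phi> \<mu> t x + y)) k
        = (CLINT y|noise \<mu> t. iexp (k \<bullet> \<Phi> \<mu> t x) * iexp (k \<bullet> y))"
      unfolding vchar_def by (subst integral_distr) (auto simp: exp_add[symmetric] inner_add_right algebra_simps)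
    also have "\<dots> = iexp (k \<bullet> \<Phi> \<mu> t x) * vchar (noise \<mu> t) k"
      unfolding vchar_def by (rule integral_mult_right_zero)
    also have "k \<bullet> \<Phi> \<mu> t x = \<Psi> \<mu> t k \<bullet> x" using flow_adjoint[of \<mu> t x k] by (simp add: inner_commute)
    finally show "vchar (distr M borel (X \<mu> x t)) k = vchar (distr (noise \<mu> t) borel (\<lambda>y. \<Phi> \<mu> t x + y)) k"
      using char_X[OF assms(1), of k \<mu> x] vchar_noise[OF assms(1), of \<mu> k]
      unfolding vchar_def by (subst integral_distr) auto
  qed (auto intro!: prob_space_distr prob_space.prob_space_distr[OF prob_space_noise] assms)
  then have "(\<integral>y. G y \<partial>distr M borel (X \<mu> x t)) = (\<integral>y. G y \<partial>distr (noise \<mu> t) borel (\<lambda>y. \<Phi> \<mu> t x + y))"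
    by simp
  then show ?thesis by (simp add: markov_semigroup_def integral_distr)
qed

text \<open>The formula describes the stationary pair of positions in phase space at times 0 and
  \<open>t\<close>: both marginals are standard Gaussian, which contains the invariance of
  \<open>N\<close>, and the flow appears only in the cross term.\<close>

lemma joint_char:
  assumes "t \<ge> 0"
  shows "(CLINT p|N \<Otimes>\<^sub>M noise \<mu> t. iexp (a \<bullet> fst p + b \<bullet> (\<Phi> \<mu> t (fst p) + snd p)))
    = exp (- ((a \<bullet> a + b \<bullet> b) / 2) - a \<bullet> \<Psi> \<mu> t b)"
proof -
  interpret Q: prob_space "noise \<mu> t" by (rule prob_space_noise) fact
  interpret pair_prob_space N "noise \<mu> t" ..
  note [measurable] = X_measurable[OF assms]
  have e: "iexp (a \<bullet> x + b \<bullet> (\<Phi> \<mu> t x + y)) = iexp ((a + \<Psi> \<mu> t b) \<bullet> x) * iexp (b \<bullet> y)" for x y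
    using flow_adjoint[of \<mu> t x b]
    by (simp add: exp_add[symmetric] inner_add_right inner_add_left inner_commute algebra_simps)
  have "(CLINT p|N \<Otimes>\<^sub>M noise \<mu> t. iexp (a \<bullet> fst p + b \<bullet> (\<Phi> \<mu> t (fst p) + snd p)))
      = (CLINT x|N. (CLINT y|noise \<mu> t. iexp (a \<bullet> x + b \<bullet> (\<Phi> \<mu> t x + y))))"
    by (subst integral_fst'[symmetric]) (auto intro!: P.integrable_const_bound[of _ 1])
  also have "\<dots> = (CLINT x|N. iexp ((a + \<Psi> \<mu> t b) \<bullet> x) * vchar (noise \<mu> t) b)"
    unfolding e vchar_def by (simp only: integral_mult_right_zero)
  also have "\<dots> = vchar N (a + \<Psi> \<mu> t b) * vchar (noise \<mu> t) b"
    unfolding vchar_def by (simp only: integral_mult_left_zero)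
  also have "\<dots> = exp (- (1\<^sup>2 * ((a + \<Psi> \<mu> t b) \<bullet> (a + \<Psi> \<mu> t b)) / 2) + - ((b \<bullet> b - \<Psi> \<mu> t b \<bullet> \<Psi> \<mu> t b) / 2))"
    by (simp only: vchar_noise[OF assms] vchar_gaussian[OF zero_less_one] of_real_mult[symmetric] exp_add)
  also have "- (1\<^sup>2 * ((a + \<Psi> \<mu> t b) \<bullet> (a + \<Psi> \<mu> t b)) / 2) + - ((b \<bullet> b - \<Psi> \<mu> t b \<bullet> \<Psi> \<mu> t b) / 2)
      = - ((a \<bullet> a + b \<bullet> b) / 2) - a \<bullet> \<Psi> \<mu> t b"
    by (simp add: inner_add_left inner_add_right inner_commute field_simps)
  finally show ?thesis .
qed

text \<open>Time reversal of the stationary process: the pair \<open>(X\<^sub>0, X\<^sub>t)\<close> has the same law as the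
  pair \<open>(flip X'\<^sub>t, flip X'\<^sub>0)\<close> for the process with reversed rotation.\<close>

lemma time_reversal:
  assumes "t \<ge> 0"
  shows "distr (N \<Otimes>\<^sub>M noise \<mu> t) borel (\<lambda>p. (fst p, \<Phi> \<mu> t (fst p) + snd p))
    = distr (N \<Otimes>\<^sub>M noise (- \<mu>) t) borel (\<lambda>p. (flip (\<Phi> (- \<mu>) t (fst p) + snd p), flip (fst p)))"
    (is "?L = ?R")
proof (rule vchar_unique)
  have prob: "prob_space (N \<Otimes>\<^sub>M noise \<mu> t)" for \<mu>
  proof -
    interpret Q: prob_space "noise \<mu> t" by (rule prob_space_noise) fact
    interpret pair_prob_space N "noise \<mu> t" ..
    show ?thesis by (rule P.prob_space_axioms)
  qed
  note [measurable] = X_measurable[OF assms]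
  show "prob_space ?L" "prob_space ?R" by (auto intro!: prob_space.prob_space_distr[OF prob])
  fix k :: "((real^'n) \<times> (real^'n)) \<times> ((real^'n) \<times> (real^'n))"
  have "vchar ?L k = exp (- ((fst k \<bullet> fst k + snd k \<bullet> snd k) / 2) - fst k \<bullet> \<Psi> \<mu> t (snd k))"
    unfolding joint_char[OF assms, symmetric] vchar_def
    by (subst integral_distr) (auto simp: inner_prod_def[of k])
  \<comment> \<open>Exchanging the two times transposes the cross term, and \<open>flip\<close>
    turns the transposed flow into the flow with opposite rotation.\<close>
  also have "fst k \<bullet> \<Psi> \<mu> t (snd k) = flip (snd k) \<bullet> \<Psi> (- \<mu>) t (flip (fst k))"
    unfolding flip_flow[of \<mu>, symmetric] flip_inner flip_flip
    using flow_adjoint[of \<mu> t "fst k" "snd k"] by (simp add: inner_commute)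
  also have "exp (- ((fst k \<bullet> fst k + snd k \<bullet> snd k) / 2) - flip (snd k) \<bullet> \<Psi> (- \<mu>) t (flip (fst k)))
      = exp (- ((flip (snd k) \<bullet> flip (snd k) + flip (fst k) \<bullet> flip (fst k)) / 2) - flip (snd k) \<bullet> \<Psi> (- \<mu>) t (flip (fst k)))"
    by (simp add: flip_inner add.commute)
  also have "complex_of_real \<dots> = vchar ?R k"
    unfolding joint_char[OF assms, symmetric] vchar_def
    by (subst integral_distr) (auto simp: inner_prod_def[of k] flip_inner add.commute)
  finally show "vchar ?L k = vchar ?R k" .
qed auto

lemma integral_flip: "f \<in> borel_measurable borel \<Longrightarrow> (\<integral>z. f (flip z) \<partial>N) = (\<integral>z. f z \<partial>N)"
  for f :: "(real^'n) \<times> (real^'n) \<Rightarrow> real"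
  by (rule integral_gaussian_involution[OF linear_flip flip_inner]) simp_all

lemma L2_flip: "f \<in> L2 N \<Longrightarrow> (\<lambda>z. f (flip z)) \<in> L2 N"
proof -
  assume f: "f \<in> L2 N"
  then have [measurable]: "f \<in> borel_measurable borel" by (simp add: L2_def)
  have "integrable (distr N borel flip) (\<lambda>z. (f z)\<^sup>2)"
    unfolding gaussian_involution[OF linear_flip flip_inner flip_flip] using f by (simp add: L2_def)
  then show "(\<lambda>z. f (flip z)) \<in> L2 N"
    by (subst (asm) integrable_distr_eq) (auto simp: L2_def)
qed

lemma semigroup_duality:
  assumes "t \<ge> 0" and G: "G \<in> L2 N" and H: "H \<in> L2 N"
  shows "(\<integral>x. P \<mu> t G x * H (flip x) \<partial>N) = (\<integral>x. G (flip x) * P (- \<mu>) t H x \<partial>N)"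
proof -
  have [measurable]: "G \<in> borel_measurable borel" "H \<in> borel_measurable borel"
    using G H by (auto simp: L2_def)
  note [measurable] = X_measurable[OF \<open>t \<ge> 0\<close>]
  define D where "D = distr (N \<Otimes>\<^sub>M noise \<mu> t) borel (\<lambda>p. (fst p, \<Phi> \<mu> t (fst p) + snd p))"
  have D': "D = distr (N \<Otimes>\<^sub>M noise (- \<mu>) t) borel (\<lambda>p. (flip (\<Phi> (- \<mu>) t (fst p) + snd p), flip (fst p)))"
    unfolding D_def by (rule time_reversal) fact
  have fstN: "integrable (N \<Otimes>\<^sub>M noise \<mu> t) (\<lambda>p. f (fst p))" if "integrable N f" for f :: "_ \<Rightarrow> real" and \<mu>
  proof -
    interpret Q: prob_space "noise \<mu> t" by (rule prob_space_noise) fact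
    show ?thesis
      using that Q.distr_pair_fst[of N] integrable_distr[of fst "N \<Otimes>\<^sub>M noise \<mu> t" N f] by simp
  qed
  \<comment> \<open>Square integrability in the second component is read off from the reversed
    representation, where that component is the flipped initial point and has law
    \<open>N\<close>.\<close>
  have "(\<lambda>p. G (snd p)) \<in> L2 D"
    using fstN[of "\<lambda>x. (G (flip x))\<^sup>2" "- \<mu>"] L2_flip[OF G] unfolding D' L2_def
    by (subst mem_Collect_eq, subst integrable_distr_eq) auto
  moreover have "(\<lambda>p. H (flip (fst p))) \<in> L2 D"
    using fstN[of "\<lambda>x. (H (flip x))\<^sup>2" \<mu>] L2_flip[OF H] unfolding D_def L2_def
    by (subst mem_Collect_eq, subst integrable_distr_eq) auto
  ultimately have int: "integrable D (\<lambda>p. G (snd p) * H (flip (fst p)))"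
    by (rule L2_mult_integrable)
  have "(\<integral>p. G (snd p) * H (flip (fst p)) \<partial>D) = (\<integral>x. P \<mu> t G x * H (flip x) \<partial>N)"
  proof -
    interpret Q: prob_space "noise \<mu> t" by (rule prob_space_noise) fact
    interpret pair_prob_space N "noise \<mu> t" ..
    have "integrable (N \<Otimes>\<^sub>M noise \<mu> t) (\<lambda>p. G (\<Phi> \<mu> t (fst p) + snd p) * H (flip (fst p)))"
      using int unfolding D_def by (subst (asm) integrable_distr_eq) auto
    then have "(\<integral>p. G (\<Phi> \<mu> t (fst p) + snd p) * H (flip (fst p)) \<partial>(N \<Otimes>\<^sub>M noise \<mu> t))
        = (\<integral>x. (\<integral>y. G (\<Phi> \<mu> t x + y) * H (flip x) \<partial>noise \<mu> t) \<partial>N)"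
      by (subst integral_fst'[symmetric]) auto
    then show ?thesis
      unfolding D_def by (subst integral_distr) (auto simp: semigroup_eq[OF \<open>t \<ge> 0\<close>])
  qed
  moreover have "(\<integral>p. G (snd p) * H (flip (fst p)) \<partial>D) = (\<integral>x. G (flip x) * P (- \<mu>) t H x \<partial>N)"
  proof -
    interpret Q: prob_space "noise (- \<mu>) t" by (rule prob_space_noise) fact
    interpret pair_prob_space N "noise (- \<mu>) t" ..
    have "integrable (N \<Otimes>\<^sub>M noise (- \<mu>) t) (\<lambda>p. G (flip (fst p)) * H (\<Phi> (- \<mu>) t (fst p) + snd p))"
      using int unfolding D' by (subst (asm) integrable_distr_eq) auto
    then have "(\<integral>p. G (flip (fst p)) * H (\<Phi> (- \<mu>) t (fst p) + snd p) \<partial>(N \<Otimes>\<^sub>M noise (- \<mu>) t))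
        = (\<integral>x. (\<integral>y. G (flip x) * H (\<Phi> (- \<mu>) t x + y) \<partial>noise (- \<mu>) t) \<partial>N)"
      by (subst integral_fst'[symmetric]) auto
    then show ?thesis
      unfolding D' by (subst integral_distr) (auto simp: semigroup_eq[OF \<open>t \<ge> 0\<close>])
  qed
  ultimately show ?thesis by simp
qed

text \<open>This is the derivative of \<open>semigroup_duality\<close> at time 0. The terms
  subtracted in the two difference quotients match because \<open>flip\<close> preserves
  \<open>N\<close>, and L2 convergence passes to the inner products.\<close>

lemma generator_duality:
  assumes g: "is_generator N (P \<mu>) g h" and g': "is_generator N (P (- \<mu>)) g' h'"
  shows "(\<integral>z. h z * g' (flip z) \<partial>N) = (\<integral>z. g (flip z) * h' z \<partial>N)"
proof -
  have L2: "g \<in> L2 N" "h \<in> L2 N" "g' \<in> L2 N" "h' \<in> L2 N"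
      "\<And>t. t \<ge> 0 \<Longrightarrow> P \<mu> t g \<in> L2 N" "\<And>t. t \<ge> 0 \<Longrightarrow> P (- \<mu>) t g' \<in> L2 N"
    using g g' by (auto simp: is_generator_def)
  have [measurable]: "g \<in> borel_measurable borel" "g' \<in> borel_measurable borel"
    using L2 by (auto simp: L2_def)
  define d where "d t z = (P \<mu> t g z - g z) / t" for t z
  define d' where "d' t z = (P (- \<mu>) t g' z - g' z) / t" for t z
  have d: "d t \<in> L2 N" "d' t \<in> L2 N" if "t > 0" for t
    using L2_cmult[OF L2_diff[OF L2(5) L2(1)], of t "1 / t"] L2_cmult[OF L2_diff[OF L2(6) L2(3)], of t "1 / t"] that
    by (simp_all add: d_def[abs_def] d'_def[abs_def])
  have l1: "((\<lambda>t. \<integral>z. d t z * g' (flip z) \<partial>N) \<longlongrightarrow> (\<integral>z. h z * g' (flip z) \<partial>N)) (at_right 0)"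
    by (rule L2_tendsto_inner[OF d(1) L2(2) L2_flip[OF L2(3)]])
       (use g in \<open>auto simp: is_generator_def d_def\<close>)
  have l2: "((\<lambda>t. \<integral>z. d' t z * g (flip z) \<partial>N) \<longlongrightarrow> (\<integral>z. h' z * g (flip z) \<partial>N)) (at_right 0)"
    by (rule L2_tendsto_inner[OF d(2) L2(4) L2_flip[OF L2(1)]])
       (use g' in \<open>auto simp: is_generator_def d'_def\<close>)
  have eq: "\<forall>\<^sub>F t in at_right 0. (\<integral>z. d t z * g' (flip z) \<partial>N) = (\<integral>z. d' t z * g (flip z) \<partial>N)"
    using eventually_at_right_less[of 0]
  proof eventually_elim
    case (elim t)
    have "(\<integral>z. d t z * g' (flip z) \<partial>N) = ((\<integral>z. P \<mu> t g z * g' (flip z) \<partial>N) - (\<integral>z. g z * g' (flip z) \<partial>N)) / t"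
      using L2_mult_integrable[OF L2(5) L2_flip[OF L2(3)], of t] L2_mult_integrable[OF L2(1) L2_flip[OF L2(3)]] elim
      by (simp add: d_def left_diff_distrib)
    also have "(\<integral>z. P \<mu> t g z * g' (flip z) \<partial>N) = (\<integral>z. P (- \<mu>) t g' z * g (flip z) \<partial>N)"
      using semigroup_duality[of t g g' \<mu>] L2(1,3) elim by (simp add: mult.commute)
    also have "(\<integral>z. g z * g' (flip z) \<partial>N) = (\<integral>z. g' z * g (flip z) \<partial>N)"
      using integral_flip[of "\<lambda>z. g z * g' (flip z)"] by (simp add: mult.commute)
    also have "((\<integral>z. P (- \<mu>) t g' z * g (flip z) \<partial>N) - (\<integral>z. g' z * g (flip z) \<partial>N)) / t = (\<integral>z. d' t z * g (flip z) \<partial>N)"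
      using L2_mult_integrable[OF L2(6) L2_flip[OF L2(1)], of t] L2_mult_integrable[OF L2(3) L2_flip[OF L2(1)]] elim
      by (simp add: d'_def left_diff_distrib)
    finally show ?case .
  qed
  have "(\<integral>z. h z * g' (flip z) \<partial>N) = (\<integral>z. h' z * g (flip z) \<partial>N)"
    by (rule tendsto_unique[OF trivial_limit_at_right_real Lim_transform_eventually[OF l1 eq] l2])
  then show ?thesis by (simp add: mult.commute)
qed

end

subsection \<open>The Poisson equation for quadratic observables\<close>

lemma sum_Basis_prod:
  "(\<Sum>b\<in>Basis. f b) = (\<Sum>i\<in>Basis. f (i, 0)) + (\<Sum>i\<in>Basis. f (0, i))"
  for f :: "'a::euclidean_space \<times> 'b::euclidean_space \<Rightarrow> real"
proof -
  have "(\<Sum>b\<in>Basis. f b) = sum f ((\<lambda>i. (i, 0)) ` Basis) + sum f ((\<lambda>i. (0, i)) ` Basis)"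
    unfolding Basis_prod_def by (rule sum.union_disjoint) auto
  then show ?thesis by (simp add: sum.reindex inj_on_def)
qed

lemma linear_matrix_fst: "linear (\<lambda>z. (K *v fst z, 0))" for K :: "real^'n^'n"
  by (rule linearI) (auto simp: matrix_vector_right_distrib matrix_vector_mult_scaleR)

lemma symmetric_inner:
  fixes K :: "real^'n^'n"
  assumes "transpose K = K"
  shows "(K *v x) \<bullet> y = x \<bullet> (K *v y)"
  by (metis assms dot_lmul_matrix vector_transpose_matrix)

text \<open>The mean of the observable is the trace of \<open>K\<close> plus \<open>C\<close>. The
  trace is the same whether taken over positions or for the position block on phase space, so
  centring agrees with the subtraction built into \<open>quad\<close>.\<close>

lemma centered_quadratic:
  fixes K :: "real^'n^'n" and l :: "real^'n" and z :: "(real^'n) \<times> (real^'n)"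
  shows "centered (\<lambda>q. q \<bullet> (K *v q) + l \<bullet> q + C) (fst z) = quad (\<lambda>z. (K *v fst z, 0)) (l, 0) z"
proof -
  interpret G: prob_space "gaussian 1 :: (real^'n) measure" by (rule prob_space_gaussian) simp
  define tr where "tr = (\<Sum>b\<in>Basis. b \<bullet> (K *v b))"
  have lin: "linear ((*v) K)" by simp
  have f: "q \<bullet> (K *v q) + l \<bullet> q + C = quad ((*v) K) l q + (tr + C)" for q
    by (simp add: quad_eq[OF lin] tr_def inner_commute)
  have "integrable (gaussian 1) (quad ((*v) K) l)"
    by (rule integrable_quadratic[OF quad_measurable abs_quad_le])
  then have "(\<integral>q. q \<bullet> (K *v q) + l \<bullet> q + C \<partial>gaussian 1) = tr + C"
    unfolding f by (simp add: integral_quad G.prob_space[simplified])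
  moreover have "(\<Sum>b\<in>Basis. b \<bullet> (K *v fst b, 0 :: real^'n)) = tr"
    unfolding tr_def by (subst sum_Basis_prod) (simp add: inner_prod_def)
  ultimately show ?thesis
    by (simp add: centered_def quad_eq[OF linear_matrix_fst] inner_prod_def inner_commute)
qed

context langevin_family
begin

text \<open>The generator has quadratic part \<open>2 * (S z \<bullet> A \<mu> z)\<close> and linear
  part \<open>B \<mu> c\<close>, so two conditions on coefficients suffice. The constants then agree
  by themselves: they are traces, and summing the quadratic condition over the basis identifies
  them.\<close>

lemma poisson_solution_quad:
  fixes K :: "real^'n^'n" and l :: "real^'n"
  assumes S: "linear S" "\<And>x y. S x \<bullet> y = x \<bullet> S y"
    and quadratic: "\<And>z. 2 * (S z \<bullet> A \<mu> z) = - (fst z \<bullet> (K *v fst z))"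
    and lin: "B \<mu> c = (- l, 0)"
  shows "poisson_solution (P \<mu>) (\<lambda>q. q \<bullet> (K *v q) + l \<bullet> q + C) (quad S c)"
proof -
  have BA: "B \<mu> x \<bullet> y = x \<bullet> A \<mu> y" for x y
    using drift_adjoint[OF skew, of \<gamma> \<mu> y x] by (simp add: inner_commute)
  have par: "(\<Sum>b\<in>Basis. (b \<bullet> x) * (b \<bullet> y)) = x \<bullet> y" for x y :: "(real^'n) \<times> (real^'n)"
    by (subst euclidean_inner) (simp add: inner_commute)
  have AS: "A \<mu> x \<bullet> S x = x \<bullet> S (A \<mu> x)" for x by (metis S(2) inner_commute)
  \<comment> \<open>Both sides are the trace of \<open>S\<close> times the drift: the left one is
    expanded in the basis, and exchanging the sums passes from the adjoint to the drift.\<close>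
  have trace: "(\<Sum>b\<in>Basis. B \<mu> b \<bullet> S b) = (\<Sum>b\<in>Basis. A \<mu> b \<bullet> S b)"
  proof -
    have "(\<Sum>b\<in>Basis. B \<mu> b \<bullet> S b) = (\<Sum>b\<in>Basis. \<Sum>c\<in>Basis. (b \<bullet> A \<mu> c) * (b \<bullet> S c))"
      by (subst euclidean_inner) (simp add: BA S(2))
    also have "\<dots> = (\<Sum>c\<in>Basis. \<Sum>b\<in>Basis. (b \<bullet> A \<mu> c) * (b \<bullet> S c))" by (rule sum.swap)
    finally show ?thesis by (simp add: par)
  qed
  have "(\<Sum>b\<in>Basis. herm (B \<mu> b) (S b) z + herm b (B \<mu> (S b)) z) + B \<mu> c \<bullet> z
      = - quad (\<lambda>z. (K *v fst z, 0)) (l, 0) z" for z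
  proof -
    have "(\<Sum>b\<in>Basis. herm (B \<mu> b) (S b) z + herm b (B \<mu> (S b)) z)
        = (\<Sum>b\<in>Basis. (b \<bullet> A \<mu> z) * (b \<bullet> S z)) + (\<Sum>b\<in>Basis. (b \<bullet> z) * (b \<bullet> S (A \<mu> z)))
          - ((\<Sum>b\<in>Basis. B \<mu> b \<bullet> S b) + (\<Sum>b\<in>Basis. A \<mu> b \<bullet> S b))"
      by (simp add: herm_def BA AS S(2) sum.distrib sum_subtractf inner_commute[of b "B \<mu> (S b)" for b]
          inner_commute[of "S b" "A \<mu> b" for b])
    also have "\<dots> = 2 * (S z \<bullet> A \<mu> z) - (\<Sum>b\<in>Basis. 2 * (S b \<bullet> A \<mu> b))"
    proof -
      have e: "z \<bullet> S (A \<mu> z) = S z \<bullet> A \<mu> z" "\<And>x. A \<mu> x \<bullet> S x = S x \<bullet> A \<mu> x"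
        by (simp_all add: S(2) inner_commute)
      show ?thesis unfolding par trace e by (simp add: sum_distrib_left[symmetric])
    qed
    also have "\<dots> = - (fst z \<bullet> (K *v fst z)) + (\<Sum>b\<in>(Basis :: ((real^'n) \<times> (real^'n)) set). fst b \<bullet> (K *v fst b))"
      unfolding quadratic by (simp add: sum_negf)
    finally show ?thesis
      by (simp add: quad_eq[OF linear_matrix_fst] lin inner_prod_def inner_commute)
  qed
  then show ?thesis
    using generator_quad[of \<mu> S c] by (simp add: poisson_solution_def centered_quadratic integral_quad)
qed

text \<open>Duality pairs an arbitrary solution at \<mu> with the fixed solution \<open>g'\<close>
  at -\<mu>. Since the observable depends on positions only, \<open>flip\<close> leaves it alone,
  and every solution yields the integral of \<open>g'\<close> against it.\<close>

lemma asymptotic_variance_eq: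
  fixes f :: "real^'n \<Rightarrow> real"
  assumes [measurable]: "f \<in> borel_measurable borel"
    and g: "poisson_solution (P \<mu>) f g" and g': "poisson_solution (P (- \<mu>)) f g'"
  shows "asymptotic_variance (P \<mu>) f = (\<integral>z. g z * centered f (fst z) \<partial>N)"
proof -
  have [measurable]: "centered f \<in> borel_measurable borel" by (simp add: centered_def[abs_def])
  have flip0: "(\<integral>z. h (flip z) * centered f (fst z) \<partial>N) = (\<integral>z. h z * centered f (fst z) \<partial>N)"
    if [measurable]: "h \<in> borel_measurable borel" for h :: "(real^'n) \<times> (real^'n) \<Rightarrow> real"
    using integral_flip[of "\<lambda>z. h z * centered f (fst z)"] by (simp add: flip_def)
  have pair: "(\<integral>z. \<phi> z * centered f (fst z) \<partial>N) = (\<integral>z. g' z * centered f (fst z) \<partial>N)"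
    if \<phi>: "poisson_solution (P \<mu>) f \<phi>" for \<phi>
  proof -
    have gen: "is_generator N (P \<mu>) \<phi> (\<lambda>z. - centered f (fst z))"
      "is_generator N (P (- \<mu>)) g' (\<lambda>z. - centered f (fst z))"
      using \<phi> g' by (auto simp: poisson_solution_def)
    then have "\<phi> \<in> borel_measurable borel" "g' \<in> borel_measurable borel"
      by (auto simp: is_generator_def L2_def)
    then show ?thesis
      using generator_duality[OF gen] flip0[of \<phi>] flip0[of g'] by (simp add: mult.commute)
  qed
  show ?thesis
    unfolding asymptotic_variance_def
    by (rule the_equality) (use g pair pair[OF g] in auto)
qed

end

subsection \<open>Commutators and the block Lyapunov equation\<close>

definition ad :: "real^'n^'n \<Rightarrow> real^'n^'n \<Rightarrow> real^'n^'n" where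
  "ad J S = J ** S - S ** J"

lemma linear_ad: "linear (ad J)"
  by (rule linearI)
     (auto simp: ad_def matrix_matrix_mult_def vec_eq_iff sum_distrib_left sum.distrib algebra_simps)

lemma transpose_ad:
  assumes "transpose J = - J"
  shows "transpose (ad J S) = ad J (transpose S)"
proof -
  have J: "J $ i $ j = - (J $ j $ i)" for i j
    using arg_cong[OF assms, of "\<lambda>A. A $ j $ i"] by (simp add: transpose_def)
  have "(\<Sum>k\<in>UNIV. J $ j $ k * S $ k $ i) = - (\<Sum>k\<in>UNIV. S $ k $ i * J $ k $ j)"
    "(\<Sum>k\<in>UNIV. S $ j $ k * J $ k $ i) = - (\<Sum>k\<in>UNIV. J $ i $ k * S $ j $ k)" for i j
    by (simp_all add: J[of j] J[of _ i] sum_negf mult.commute)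
  then show ?thesis
    by (simp add: ad_def matrix_matrix_mult_def vec_eq_iff transpose_def)
qed

text \<open>Moving the skew matrix \<open>J\<close> to the other factor of the Frobenius product
  costs a sign on either side. So \<open>K\<close> is orthogonal to its commutator, and pairing
  \<open>K\<close> with the double commutator gives minus a square.\<close>

lemma inner_ad:
  assumes "transpose J = - J"
  shows "K \<bullet> ad J S = - (ad J K \<bullet> S)"
proof -
  have J: "J $ i $ j = - (J $ j $ i)" for i j
    using arg_cong[OF assms, of "\<lambda>A. A $ j $ i"] by (simp add: transpose_def)
  have "K \<bullet> (J ** S) = (\<Sum>i\<in>UNIV. \<Sum>j\<in>UNIV. \<Sum>k\<in>UNIV. K $ i $ j * (J $ i $ k * S $ k $ j))"
    by (simp add: inner_vec_def matrix_matrix_mult_def sum_distrib_left)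
  also have "\<dots> = (\<Sum>k\<in>UNIV. \<Sum>j\<in>UNIV. \<Sum>i\<in>UNIV. K $ i $ j * (J $ i $ k * S $ k $ j))"
    by (subst sum.swap, subst sum.swap[of _ UNIV UNIV], subst sum.swap) (rule refl)
  also have "\<dots> = (\<Sum>k\<in>UNIV. \<Sum>j\<in>UNIV. \<Sum>i\<in>UNIV. - ((J $ k $ i * K $ i $ j) * S $ k $ j))"
    by (intro sum.cong refl, subst J) simp
  also have "\<dots> = - ((J ** K) \<bullet> S)"
    by (simp add: inner_vec_def matrix_matrix_mult_def sum_distrib_right sum_negf)
  finally have 1: "K \<bullet> (J ** S) = - ((J ** K) \<bullet> S)" .
  have "K \<bullet> (S ** J) = (\<Sum>i\<in>UNIV. \<Sum>j\<in>UNIV. \<Sum>k\<in>UNIV. K $ i $ j * (S $ i $ k * J $ k $ j))"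
    by (simp add: inner_vec_def matrix_matrix_mult_def sum_distrib_left)
  also have "\<dots> = (\<Sum>i\<in>UNIV. \<Sum>k\<in>UNIV. \<Sum>j\<in>UNIV. K $ i $ j * (S $ i $ k * J $ k $ j))"
    by (intro sum.cong refl sum.swap)
  also have "\<dots> = (\<Sum>i\<in>UNIV. \<Sum>k\<in>UNIV. \<Sum>j\<in>UNIV. - ((K $ i $ j * J $ j $ k) * S $ i $ k))"
    by (intro sum.cong refl, subst J) simp
  also have "\<dots> = - ((K ** J) \<bullet> S)"
    by (simp add: inner_vec_def matrix_matrix_mult_def sum_distrib_right sum_negf)
  finally show ?thesis by (simp add: ad_def 1 inner_diff_left inner_diff_right)
qed

lemma sum_Basis_vec: "(\<Sum>b\<in>Basis. f b) = (\<Sum>i\<in>UNIV. f (axis i 1))"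
  for f :: "real^'n \<Rightarrow> real"
proof -
  have b: "(Basis :: (real^'n) set) = range (\<lambda>i. axis i 1)" by (auto simp: Basis_vec_def)
  have i: "inj (\<lambda>i. axis i 1 :: real^'n)" by (simp add: inj_on_def axis_eq_axis)
  show ?thesis unfolding b using i by (simp add: sum.reindex)
qed

lemma sum_Basis_matrix_inner:
  fixes S K :: "real^'n^'n"
  shows "(\<Sum>b\<in>Basis. (S *v b) \<bullet> (K *v b)) = transpose S \<bullet> transpose K"
  by (simp add: sum_Basis_vec matrix_vector_mult_basis inner_vec_def column_def transpose_def)

text \<open>The blocks of a quadratic form \<open>q \<bullet> S1 q + 2 q \<bullet> S2 p + p \<bullet> S3 p\<close> and the two components
  of a linear form, in which the Poisson equation is the fixed point equation
  \<open>u = poisson_rhs + \<mu> * poisson_op u\<close>.\<close>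

type_synonym 'n coeffs = "((real^'n^'n) \<times> (real^'n^'n) \<times> (real^'n^'n)) \<times> ((real^'n) \<times> (real^'n))"

definition poisson_op :: "real^'n^'n \<Rightarrow> real \<Rightarrow> 'n coeffs \<Rightarrow> 'n coeffs" where
  "poisson_op J \<gamma> u = (case u of ((S1, S2, S3), (a, b)) \<Rightarrow>
     (((1 / (2 * \<gamma>) + \<gamma> / 2) *\<^sub>R ad J S1 - ad J S2 + (1 / (2 * \<gamma>)) *\<^sub>R ad J S3,
       (1 / 2) *\<^sub>R ad J S1,
       (1 / (2 * \<gamma>)) *\<^sub>R ad J S1 + (1 / (2 * \<gamma>)) *\<^sub>R ad J S3),
      (\<gamma> *\<^sub>R (J *v a) - J *v b, J *v a)))"

definition poisson_rhs :: "real \<Rightarrow> real^'n^'n \<Rightarrow> real^'n \<Rightarrow> 'n coeffs" where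
  "poisson_rhs \<gamma> K l =
     (((1 / (2 * \<gamma>) + \<gamma> / 2) *\<^sub>R K, (1 / 2) *\<^sub>R K, (1 / (2 * \<gamma>)) *\<^sub>R K), (\<gamma> *\<^sub>R l, l))"

lemma linear_poisson_op: "linear (poisson_op J \<gamma>)"
  by (rule linearI)
     (auto simp: poisson_op_def linear_add[OF linear_ad] linear_cmul[OF linear_ad]
        matrix_vector_right_distrib matrix_vector_mult_scaleR algebra_simps)

lemma poisson_fixpoint_iff:
  "((S1, S2, S3), (a, b)) = poisson_rhs \<gamma> K l + \<mu> *\<^sub>R poisson_op J \<gamma> ((S1, S2, S3), (a, b)) \<longleftrightarrow>
     S1 = (1 / (2 * \<gamma>) + \<gamma> / 2) *\<^sub>R K
        + \<mu> *\<^sub>R ((1 / (2 * \<gamma>) + \<gamma> / 2) *\<^sub>R ad J S1 - ad J S2 + (1 / (2 * \<gamma>)) *\<^sub>R ad J S3) \<and>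
     S2 = (1 / 2) *\<^sub>R K + \<mu> *\<^sub>R ((1 / 2) *\<^sub>R ad J S1) \<and>
     S3 = (1 / (2 * \<gamma>)) *\<^sub>R K + \<mu> *\<^sub>R ((1 / (2 * \<gamma>)) *\<^sub>R ad J S1 + (1 / (2 * \<gamma>)) *\<^sub>R ad J S3) \<and>
     a = \<gamma> *\<^sub>R l + \<mu> *\<^sub>R (\<gamma> *\<^sub>R (J *v a) - J *v b) \<and> b = l + \<mu> *\<^sub>R (J *v a)"
  unfolding poisson_rhs_def poisson_op_def prod.case scaleR_Pair add_Pair prod.inject conj_assoc ..

text \<open>Transposition commutes with \<open>ad J\<close> and fixes \<open>K\<close>, so the
  transposed blocks solve the same equation; uniqueness of the fixed point does the rest.\<close>

lemma poisson_fixpoint_symmetric: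
  assumes J: "transpose J = - J" and K: "transpose K = K"
    and small: "\<bar>\<mu>\<bar> * onorm (poisson_op J \<gamma>) < 1"
    and u: "((S1, S2, S3), (a, b)) = poisson_rhs \<gamma> K l + \<mu> *\<^sub>R poisson_op J \<gamma> ((S1, S2, S3), (a, b))"
  shows "transpose S1 = S1" "transpose S2 = S2" "transpose S3 = S3"
proof -
  have t: "transpose (x + y) = transpose x + transpose y" "transpose (x - y) = transpose x - transpose y"
    "transpose (c *\<^sub>R x) = c *\<^sub>R transpose x" for x y :: "real^'n^'n" and c
    by (simp_all add: transpose_def vec_eq_iff)
  note e = u[unfolded poisson_fixpoint_iff]
  have "((transpose S1, transpose S2, transpose S3), (a, b)) = poisson_rhs \<gamma> K l
      + \<mu> *\<^sub>R poisson_op J \<gamma> ((transpose S1, transpose S2, transpose S3), (a, b))"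
    unfolding poisson_fixpoint_iff
  proof (intro conjI)
    show "transpose S1 = (1 / (2 * \<gamma>) + \<gamma> / 2) *\<^sub>R K + \<mu> *\<^sub>R ((1 / (2 * \<gamma>) + \<gamma> / 2) *\<^sub>R ad J (transpose S1)
        - ad J (transpose S2) + (1 / (2 * \<gamma>)) *\<^sub>R ad J (transpose S3))"
      using e[THEN conjunct1, THEN arg_cong[where f = transpose]] by (simp only: t transpose_ad[OF J] K)
    show "transpose S2 = (1 / 2) *\<^sub>R K + \<mu> *\<^sub>R ((1 / 2) *\<^sub>R ad J (transpose S1))"
      using e[THEN conjunct2, THEN conjunct1, THEN arg_cong[where f = transpose]]
      by (simp only: t transpose_ad[OF J] K)
    show "transpose S3 = (1 / (2 * \<gamma>)) *\<^sub>R K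
        + \<mu> *\<^sub>R ((1 / (2 * \<gamma>)) *\<^sub>R ad J (transpose S1) + (1 / (2 * \<gamma>)) *\<^sub>R ad J (transpose S3))"
      using e[THEN conjunct2, THEN conjunct2, THEN conjunct1, THEN arg_cong[where f = transpose]]
      by (simp only: t transpose_ad[OF J] K)
  qed (use e in blast)+
  then have "((transpose S1, transpose S2, transpose S3), (a, b)) = ((S1, S2, S3), (a, b))"
    using neumann_unique[OF linear_poisson_op small] u by blast
  then show "transpose S1 = S1" "transpose S2 = S2" "transpose S3 = S3" by auto
qed

section \<open>The variance near \<mu> = 0 as a power series\<close>

context langevin_family
begin

text \<open>The entries \<open>2 *\<^sub>R K\<close> and \<open>l\<close> come from
  \<open>integral_quad_mult_quad\<close>. The zeros reflect that the observable sees positions only,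
  so just the position block \<open>S1\<close> and the position component \<open>a\<close> of the
  solution are tested.\<close>

lemma asymptotic_variance_neumann:
  fixes K :: "real^'n^'n" and l :: "real^'n"
  assumes K: "transpose K = K" and small: "\<bar>\<mu>\<bar> * onorm (poisson_op J \<gamma>) < 1"
  shows "asymptotic_variance (P \<mu>) (\<lambda>q. q \<bullet> (K *v q) + l \<bullet> q + C)
    = ((2 *\<^sub>R K, 0, 0), (l, 0)) \<bullet> neumann (poisson_op J \<gamma>) (poisson_rhs \<gamma> K l) \<mu>"
proof -
  let ?f = "\<lambda>q. q \<bullet> (K *v q) + l \<bullet> q + C"
  define S where "S u z = (fst (fst u) *v fst z + fst (snd (fst u)) *v snd z,
    fst (snd (fst u)) *v fst z + snd (snd (fst u)) *v snd z)" for u :: "'n coeffs" and z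
  \<comment> \<open>The claim is made for every small \<nu> because
    \<open>asymptotic_variance_eq\<close> takes a solution at \<mu> and another at -\<mu>.\<close>
  have sol: "linear (S u)" "poisson_solution (P \<nu>) ?f (quad (S u) (snd u))"
      "transpose (fst (fst u)) = fst (fst u)"
    if small: "\<bar>\<nu>\<bar> * onorm (poisson_op J \<gamma>) < 1" and u: "u = neumann (poisson_op J \<gamma>) (poisson_rhs \<gamma> K l) \<nu>"
    for u \<nu>
  proof -
    obtain S1 S2 S3 a b where ue: "u = ((S1, S2, S3), (a, b))" by (metis prod.exhaust)
    have fp: "((S1, S2, S3), (a, b)) = poisson_rhs \<gamma> K l + \<nu> *\<^sub>R poisson_op J \<gamma> ((S1, S2, S3), (a, b))"
      using neumann_fixpoint[OF linear_poisson_op small, of "poisson_rhs \<gamma> K l"] unfolding u[symmetric] ue .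
    note sym = poisson_fixpoint_symmetric[OF skew K small fp]
    note si = sym[THEN symmetric_inner]
    show lin: "linear (S u)"
      by (rule linearI) (simp_all add: S_def matrix_vector_right_distrib matrix_vector_mult_scaleR algebra_simps)
    show "transpose (fst (fst u)) = fst (fst u)" using sym by (simp add: ue)
    have Su: "S u (q, p) = (S1 *v q + S2 *v p, S2 *v q + S3 *v p)" for q p by (simp add: S_def ue)
    have adj: "S u x \<bullet> y = x \<bullet> S u y" for x y
      by (cases x; cases y) (simp add: Su inner_prod_def inner_add_left inner_add_right si)
    have adv: "ad J T *v q = J *v (T *v q) - T *v (J *v q)" for T q
      by (simp add: ad_def matrix_vector_mult_diff_rdistrib matrix_vector_mul_assoc)
    have e1: "S1 = (1 / (2 * \<gamma>) + \<gamma> / 2) *\<^sub>R K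
        + \<nu> *\<^sub>R ((1 / (2 * \<gamma>) + \<gamma> / 2) *\<^sub>R ad J S1 - ad J S2 + (1 / (2 * \<gamma>)) *\<^sub>R ad J S3)"
      and e2: "S2 = (1 / 2) *\<^sub>R K + \<nu> *\<^sub>R ((1 / 2) *\<^sub>R ad J S1)"
      and e3: "S3 = (1 / (2 * \<gamma>)) *\<^sub>R K + \<nu> *\<^sub>R ((1 / (2 * \<gamma>)) *\<^sub>R ad J S1 + (1 / (2 * \<gamma>)) *\<^sub>R ad J S3)"
      and ea: "a = \<gamma> *\<^sub>R l + \<nu> *\<^sub>R (\<gamma> *\<^sub>R (J *v a) - J *v b)" and eb: "b = l + \<nu> *\<^sub>R (J *v a)"
      using fp unfolding poisson_fixpoint_iff by blast+
    \<comment> \<open>This and the next two equations are the position, momentum and mixed parts of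
      the quadratic condition. Solving them in turn for S2, S3 and S1 produces the constants 1/2,
      1/(2 \<gamma>) and 1/(2 \<gamma>) + \<gamma>/2 of \<open>poisson_op\<close>.\<close>
    have b11: "2 *\<^sub>R S2 = K + \<nu> *\<^sub>R ad J S1"
      by (subst e2) (simp add: scaleR_add_right)
    have b22: "(2 * \<gamma>) *\<^sub>R S3 = 2 *\<^sub>R S2 + \<nu> *\<^sub>R ad J S3"
      unfolding b11 using friction by (subst e3) (simp add: scaleR_add_right)
    have b12: "S1 = S3 + \<gamma> *\<^sub>R S2 - \<nu> *\<^sub>R ad J S2"
    proof -
      have "S3 + \<gamma> *\<^sub>R S2 - \<nu> *\<^sub>R ad J S2
          = ((1 / (2 * \<gamma>)) *\<^sub>R K + \<nu> *\<^sub>R ((1 / (2 * \<gamma>)) *\<^sub>R ad J S1 + (1 / (2 * \<gamma>)) *\<^sub>R ad J S3))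
          + \<gamma> *\<^sub>R ((1 / 2) *\<^sub>R K + \<nu> *\<^sub>R ((1 / 2) *\<^sub>R ad J S1)) - \<nu> *\<^sub>R ad J S2"
        using e2 e3 by presburger
      also have "\<dots> = (1 / (2 * \<gamma>) + \<gamma> / 2) *\<^sub>R K
        + \<nu> *\<^sub>R ((1 / (2 * \<gamma>) + \<gamma> / 2) *\<^sub>R ad J S1 - ad J S2 + (1 / (2 * \<gamma>)) *\<^sub>R ad J S3)"
        by (simp add: algebra_simps)
      finally show ?thesis using e1 by presburger
    qed
    have ax: "x \<bullet> (ad J T *v y) = - ((J *v x) \<bullet> (T *v y)) - (T *v x) \<bullet> (J *v y)"
      if "transpose T = T" for T x y
      using skew_inner[OF skew, of x "T *v y"] symmetric_inner[OF that, of x "J *v y"]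
      by (simp add: adv inner_diff_right)
    have quadratic: "2 * (S u z \<bullet> A \<nu> z) = - (fst z \<bullet> (K *v fst z))" for z
    proof -
      obtain q p where z: "z = (q, p)" by (cases z)
      have qq: "2 * (q \<bullet> (S2 *v q)) = q \<bullet> (K *v q) - 2 * \<nu> * ((S1 *v q) \<bullet> (J *v q))"
        using arg_cong[OF b11, of "\<lambda>T. q \<bullet> (T *v q)"] ax[OF sym(1), of q q]
        by (simp add: matrix_vector_mult_add_rdistrib scaleR_matrix_vector_assoc[symmetric]
            inner_add_right inner_commute[of "J *v q"])
      have pp: "2 * \<gamma> * (p \<bullet> (S3 *v p)) = 2 * (p \<bullet> (S2 *v p)) - 2 * \<nu> * ((S3 *v p) \<bullet> (J *v p))"
        using arg_cong[OF b22, of "\<lambda>T. p \<bullet> (T *v p)"] ax[OF sym(3), of p p]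
        by (simp add: matrix_vector_mult_add_rdistrib scaleR_matrix_vector_assoc[symmetric]
            inner_add_right inner_commute[of "J *v p"])
      have qp: "q \<bullet> (S1 *v p) = q \<bullet> (S3 *v p) + \<gamma> * (q \<bullet> (S2 *v p))
          + \<nu> * ((J *v q) \<bullet> (S2 *v p) + (S2 *v q) \<bullet> (J *v p))"
        using arg_cong[OF b12, of "\<lambda>T. q \<bullet> (T *v p)"] ax[OF sym(2), of q p]
        by (simp add: matrix_vector_mult_add_rdistrib matrix_vector_mult_diff_rdistrib
            scaleR_matrix_vector_assoc[symmetric] inner_add_right inner_diff_right algebra_simps)
      have "S u z \<bullet> A \<nu> z = q \<bullet> (S1 *v p) - \<nu> * ((S1 *v q) \<bullet> (J *v q)) + p \<bullet> (S2 *v p)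
          - \<nu> * ((J *v q) \<bullet> (S2 *v p)) - q \<bullet> (S2 *v q) - \<nu> * ((S2 *v q) \<bullet> (J *v p)) - \<gamma> * (q \<bullet> (S2 *v p))
          - q \<bullet> (S3 *v p) - \<nu> * ((S3 *v p) \<bullet> (J *v p)) - \<gamma> * (p \<bullet> (S3 *v p))"
      proof -
        have "S u z \<bullet> A \<nu> z = (S1 *v q + S2 *v p) \<bullet> (p - \<nu> *\<^sub>R (J *v q))
            + (S2 *v q + S3 *v p) \<bullet> (- q - \<nu> *\<^sub>R (J *v p) - \<gamma> *\<^sub>R p)"
          by (simp add: z Su langevin_drift_def)
        moreover have "(S1 *v q) \<bullet> p = q \<bullet> (S1 *v p)" "(S2 *v q) \<bullet> p = q \<bullet> (S2 *v p)"
          "(S2 *v q) \<bullet> q = q \<bullet> (S2 *v q)" "(S3 *v p) \<bullet> p = p \<bullet> (S3 *v p)" "(S2 *v p) \<bullet> p = p \<bullet> (S2 *v p)"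
          by (simp_all only: si)
        moreover have "(S3 *v p) \<bullet> q = q \<bullet> (S3 *v p)" "(S2 *v p) \<bullet> (J *v q) = (J *v q) \<bullet> (S2 *v p)"
          by (simp_all only: inner_commute)
        ultimately show ?thesis
          unfolding inner_add_left inner_diff_right inner_minus_right inner_scaleR_right
          by (simp add: distrib_left)
      qed
      then show ?thesis using qq pp qp by (simp add: z algebra_simps)
    qed
    \<comment> \<open>The two components read b = l + \<nu> J a and a = \<gamma> b - \<nu> J b;
      inserting the first into the term \<gamma> b gives the vector part of
      \<open>poisson_op\<close>.\<close>
    have lin_eq: "B \<nu> (snd u) = (- l, 0)"
    proof -
      have "\<nu> *\<^sub>R (J *v a) - b = - l" using eb by (simp add: algebra_simps)
      moreover have "a + \<nu> *\<^sub>R (J *v b) - \<gamma> *\<^sub>R b = 0"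
      proof -
        have "\<gamma> *\<^sub>R b = \<gamma> *\<^sub>R l + (\<gamma> * \<nu>) *\<^sub>R (J *v a)"
          using arg_cong[OF eb, of "\<lambda>v. \<gamma> *\<^sub>R v"] by (simp add: scaleR_add_right)
        moreover have "a + \<nu> *\<^sub>R (J *v b) = \<gamma> *\<^sub>R l + (\<gamma> * \<nu>) *\<^sub>R (J *v a)"
          by (subst ea) (simp add: scaleR_diff_right mult.commute)
        ultimately show ?thesis by simp
      qed
      ultimately show ?thesis by (simp add: drift_adj_eq ue)
    qed
    show "poisson_solution (P \<nu>) ?f (quad (S u) (snd u))"
      by (rule poisson_solution_quad[OF lin adj quadratic lin_eq])
  qed
  define u where "u = neumann (poisson_op J \<gamma>) (poisson_rhs \<gamma> K l) \<mu>"
  note s = sol[OF small u_def]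
  have small': "\<bar>- \<mu>\<bar> * onorm (poisson_op J \<gamma>) < 1" using small by simp
  have fm: "?f \<in> borel_measurable borel"
    by (intro borel_measurable_continuous_onI continuous_intros linear_continuous_on) simp
  have "asymptotic_variance (P \<mu>) ?f = (\<integral>z. quad (S u) (snd u) z * centered ?f (fst z) \<partial>N)"
    by (rule asymptotic_variance_eq[OF fm s(2) sol(2)[OF small' refl]])
  also have "\<dots> = (\<integral>z. quad (S u) (snd u) z * quad (\<lambda>z. (K *v fst z, 0)) (l, 0) z \<partial>N)"
    by (simp only: centered_quadratic)
  also have "\<dots> = 2 * (\<Sum>b\<in>Basis. S u b \<bullet> (K *v fst b, 0)) + snd u \<bullet> (l, 0)"
    by (rule integral_quad_mult_quad[OF s(1) linear_matrix_fst])
       (simp add: inner_prod_def symmetric_inner[OF K])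
  also have "(\<Sum>b\<in>Basis. S u b \<bullet> (K *v fst b, 0)) = (\<Sum>i\<in>Basis. (fst (fst u) *v i) \<bullet> (K *v i))"
    by (subst sum_Basis_prod) (simp add: S_def inner_prod_def)
  also have "\<dots> = fst (fst u) \<bullet> K"
    unfolding sum_Basis_matrix_inner s(3) K ..
  finally show ?thesis
    by (simp add: u_def[symmetric] inner_prod_def inner_commute)
qed

end

text \<open>After n steps all three blocks are multiples of the n-fold commutator of
  \<open>K\<close> with \<open>J\<close>, and both vectors are multiples of the n-th power of
  \<open>J\<close> applied to \<open>l\<close>. Only the scalar multiples have to be
  tracked.\<close>

lemma poisson_op_coefficients:
  fixes J K :: "real^'n^'n" and l :: "real^'n"
  assumes J: "transpose J = - J" and "\<gamma> > 0"
  shows "((2 *\<^sub>R K, 0, 0), (l, 0)) \<bullet> poisson_op J \<gamma> (poisson_rhs \<gamma> K l) = 0"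
    and "((2 *\<^sub>R K, 0, 0), (l, 0)) \<bullet> poisson_op J \<gamma> (poisson_op J \<gamma> (poisson_rhs \<gamma> K l))
      = - ((\<gamma> ^ 6 - \<gamma> ^ 4 + \<gamma>\<^sup>2 + 4) / (4 * \<gamma> ^ 3) * (ad J K \<bullet> ad J K)
          + \<gamma> * (\<gamma>\<^sup>2 - 2) * ((J *v l) \<bullet> (J *v l)))"
proof -
  have K1: "K \<bullet> ad J K = 0" using inner_ad[OF J, of K K] by (simp add: inner_commute)
  have K2: "K \<bullet> ad J (ad J K) = - (ad J K \<bullet> ad J K)" by (rule inner_ad[OF J])
  have l1: "l \<bullet> (J *v l) = 0" using skew_inner[OF J, of l l] by (simp add: inner_commute)
  have l2: "l \<bullet> (J *v (J *v l)) = - ((J *v l) \<bullet> (J *v l))" using skew_inner[OF J, of l "J *v l"] by simp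
  let ?b = "1 / (2 * \<gamma>)" and ?a = "1 / (2 * \<gamma>) + \<gamma> / 2"
  \<comment> \<open>One step acts on these multiples as a 3 by 3 matrix for the blocks and a 2 by 2
    matrix for the vectors.\<close>
  have op: "poisson_op J \<gamma> ((x *\<^sub>R T, y *\<^sub>R T, z *\<^sub>R T), (c *\<^sub>R v, d *\<^sub>R v))
      = (((?a * x - y + ?b * z) *\<^sub>R ad J T, (x / 2) *\<^sub>R ad J T, (?b * (x + z)) *\<^sub>R ad J T),
         ((\<gamma> * c - d) *\<^sub>R (J *v v), c *\<^sub>R (J *v v)))" for x y z c d T v
    by (simp add: poisson_op_def linear_cmul[OF linear_ad] matrix_vector_mult_scaleR
        scaleR_add_left[symmetric] scaleR_diff_left[symmetric] distrib_left del: scaleR_left_distrib)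
  have rhs: "poisson_rhs \<gamma> K l = ((?a *\<^sub>R K, (1 / 2) *\<^sub>R K, ?b *\<^sub>R K), (\<gamma> *\<^sub>R l, 1 *\<^sub>R l))"
    by (simp add: poisson_rhs_def)
  show "((2 *\<^sub>R K, 0, 0), (l, 0)) \<bullet> poisson_op J \<gamma> (poisson_rhs \<gamma> K l) = 0"
    unfolding rhs op by (simp add: inner_prod_def K1 l1)
  have "((2 *\<^sub>R K, 0, 0), (l, 0)) \<bullet> poisson_op J \<gamma> (poisson_op J \<gamma> (poisson_rhs \<gamma> K l))
      = - (2 * (?a * (?a * ?a - 1 / 2 + ?b * ?b) - ?a / 2 + ?b * (?b * (?a + ?b))) * (ad J K \<bullet> ad J K)
        + (\<gamma> * (\<gamma> * \<gamma> - 1) - \<gamma>) * ((J *v l) \<bullet> (J *v l)))"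
    unfolding rhs op by (simp add: inner_prod_def K2 l2)
  also have "2 * (?a * (?a * ?a - 1 / 2 + ?b * ?b) - ?a / 2 + ?b * (?b * (?a + ?b)))
      = (\<gamma> ^ 6 - \<gamma> ^ 4 + \<gamma>\<^sup>2 + 4) / (4 * \<gamma> ^ 3)"
    using \<open>\<gamma> > 0\<close> by (simp add: field_simps power_numeral_reduce)
  also have "\<gamma> * (\<gamma> * \<gamma> - 1) - \<gamma> = \<gamma> * (\<gamma>\<^sup>2 - 2)"
    by (simp add: power2_eq_square algebra_simps)
  finally show "((2 *\<^sub>R K, 0, 0), (l, 0)) \<bullet> poisson_op J \<gamma> (poisson_op J \<gamma> (poisson_rhs \<gamma> K l))
      = - ((\<gamma> ^ 6 - \<gamma> ^ 4 + \<gamma>\<^sup>2 + 4) / (4 * \<gamma> ^ 3) * (ad J K \<bullet> ad J K)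
          + \<gamma> * (\<gamma>\<^sup>2 - 2) * ((J *v l) \<bullet> (J *v l)))" .
qed

theorem theorem3:
  fixes J K :: "real^'n^'n" and l :: "real^'n" and C \<gamma> :: real
    and M :: "'w measure" and W :: "real \<Rightarrow> 'w \<Rightarrow> real^'n"
    and X :: "real \<Rightarrow> (real^'n) \<times> (real^'n) \<Rightarrow> real \<Rightarrow> 'w \<Rightarrow> (real^'n) \<times> (real^'n)"
    and f :: "real^'n \<Rightarrow> real" and \<sigma>2 :: "real \<Rightarrow> real"
  assumes "transpose J = - J"
    and "transpose K = K"
    and "\<gamma> > sqrt 2"
    and "standard_brownian_motion M W"
    and "\<And>\<mu> x. langevin_solution M W J \<gamma> \<mu> x (X \<mu> x)"
    and "f = (\<lambda>q. q \<bullet> (K *v q) + l \<bullet> q + C)"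
    and "\<sigma>2 = (\<lambda>\<mu>. asymptotic_variance (markov_semigroup M (X \<mu>)) f)"
    and "J ** K - K ** J \<noteq> 0 \<or> J *v l \<noteq> 0"
  shows "(\<forall>\<^sub>F \<mu> in nhds 0. \<sigma>2 differentiable at \<mu>) \<and> deriv \<sigma>2 0 = 0 \<and>
         deriv \<sigma>2 differentiable at 0 \<and> deriv (deriv \<sigma>2) 0 < 0"
proof -
  have \<gamma>: "\<gamma> > 0" "\<gamma>\<^sup>2 > 2"
  proof -
    show "\<gamma> > 0" using assms(3) by (meson le_less_trans real_sqrt_ge_zero zero_le_numeral)
    have "(sqrt 2)\<^sup>2 < \<gamma>\<^sup>2" using assms(3) by (intro power_strict_mono) auto
    then show "\<gamma>\<^sup>2 > 2" by simp
  qed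
  interpret langevin_family J \<gamma> M W X
    using assms \<gamma> by unfold_locales auto
  let ?T = "poisson_op J \<gamma>" and ?u = "poisson_rhs \<gamma> K l" and ?k = "((2 *\<^sub>R K, 0, 0), (l, 0)) :: 'n coeffs"
  \<comment> \<open>Adding 1 keeps \<open>r\<close> well defined when the operator vanishes, and
    \<open>\<bar>\<mu>\<bar> < r\<close> still gives convergence of the Neumann series.\<close>
  define r where "r = 1 / (onorm ?T + 1)"
  define c where "c n = ?k \<bullet> (?T ^^ n) ?u" for n
  have onorm: "onorm ?T \<ge> 0"
    using linear_poisson_op[of J \<gamma>] by (simp add: linear_conv_bounded_linear onorm_pos_le)
  then have "r > 0" by (simp add: r_def)
  have "(\<lambda>n. c n * \<mu> ^ n) sums \<sigma>2 \<mu>" if "\<bar>\<mu>\<bar> < r" for \<mu>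
  proof -
    have "\<bar>\<mu>\<bar> * (onorm ?T + 1) < 1" using that onorm by (simp add: r_def field_simps)
    then have small: "\<bar>\<mu>\<bar> * onorm ?T < 1" by (simp add: distrib_left)
    show ?thesis
      unfolding assms(7) assms(6) asymptotic_variance_neumann[OF assms(2) small] c_def
      by (rule inner_neumann[OF linear_poisson_op small])
  qed
  note deriv = power_series_derivatives[OF \<open>r > 0\<close> this]
  have c1: "c 1 = 0"
    using poisson_op_coefficients(1)[OF assms(1) \<gamma>(1), of K l] by (simp add: c_def)
  \<comment> \<open>In the numerator, \<gamma>^6 - \<gamma>^4 = \<gamma>^4 (\<gamma>^2 - 1) is
    nonnegative, as \<gamma>^2 exceeds 1.\<close>
  have "0 < (\<gamma> ^ 6 - \<gamma> ^ 4 + \<gamma>\<^sup>2 + 4) / (4 * \<gamma> ^ 3)"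
  proof -
    have "\<gamma> ^ 6 - \<gamma> ^ 4 = (\<gamma>\<^sup>2)\<^sup>2 * (\<gamma>\<^sup>2 - 1)" by (simp add: algebra_simps power_numeral_reduce)
    moreover have "0 \<le> (\<gamma>\<^sup>2)\<^sup>2 * (\<gamma>\<^sup>2 - 1)" using \<gamma> by (intro mult_nonneg_nonneg) auto
    ultimately have "0 < \<gamma> ^ 6 - \<gamma> ^ 4 + \<gamma>\<^sup>2 + 4" using \<gamma> by linarith
    then show ?thesis using \<gamma> by simp
  qed
  \<comment> \<open>Here the bound \<gamma>^2 > 2 is used at its exact value. With both weights
    positive, one of the two squares being nonzero makes the whole sum positive.\<close>
  moreover have "0 < \<gamma> * (\<gamma>\<^sup>2 - 2)" using \<gamma> by simp
  moreover have "ad J K \<noteq> 0 \<or> J *v l \<noteq> 0" using assms(8) by (simp add: ad_def)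
  ultimately have "0 < (\<gamma> ^ 6 - \<gamma> ^ 4 + \<gamma>\<^sup>2 + 4) / (4 * \<gamma> ^ 3) * (ad J K \<bullet> ad J K)
          + \<gamma> * (\<gamma>\<^sup>2 - 2) * ((J *v l) \<bullet> (J *v l))"
    by (metis add_nonneg_pos add_pos_nonneg inner_ge_zero inner_gt_zero_iff less_imp_le mult_nonneg_nonneg mult_pos_pos)
  then have "c 2 < 0"
    using poisson_op_coefficients(2)[OF assms(1) \<gamma>(1), of K l] by (simp add: c_def numeral_2_eq_2)
  with deriv c1 show ?thesis by simp
qed

end
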